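(* The surrogate problem $$\min_{\pi\in\Delta(\mathcal I_l)}\ \max_{x\in\mathcal P_f\cap\{0,1\}^n}\widetilde L^{q(\pi)}(x)$$ has the same optimal value as $$\min_{q\in\mathcal P_l}\ \max_{x\in\mathcal P_f\cap\{0,1\}^n}\widetilde L^{q}(x).$$ Moreover, an optimal marginal vector $q\in\mathcal P_l$ of the latter problem can be converted in polynomial time into a distribution $\pi\in\Delta(\mathcal I_l)$, with $q(\pi)=q$, supported on at most $n+1$ independent sets of $\mathcal M_l$.
   Context: $G=(V,E)$ is a finite undirected graph with $V=\{1,\dots,n\}$ (each edge joins two distinct vertices; an edge is written $e=(u,v)$) and edge weights $w_e$. $\mathcal M_l=(V,\mathcal I_l)$ and $\mathcal M_f=(V,\mathcal I_f)$ are matroids on $V$, given by independence oracles, with matroid polytopes $\mathcal P_l,\mathcal P_f\subseteq[0,1]^n$ (convex hulls of incidence vectors of independent sets). $\Delta(\mathcal I_l)$ is the set of probability distributions on $\mathcal I_l$. For $\pi\in\Delta(\mathcal I_l)$ the marginal vector is $q(\pi)=(q_v(\pi))_{v\in V}$ with $q_v(\pi)=\sum_{S\in\mathcal I_l:\,v\in S}\pi(S)$. For $q\in[0,1]^n$, $$\widetilde L^{q}(x)=\sum_{e=(u,v)\in E}\left[x_uw_e(1-q_u)+x_vw_e(1-q_v)\right].$$ Polynomial time means that the number of elementary operations and oracle calls is polynomial in $n$ and the encoding length of the (rational) vector $q$; a distribution is output as a list of its support sets with their probabilities. *)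

theory Defs
  imports
    "HOL-Probability.Probability"
    "HOL-Library.Function_Algebras"
    "HOL-Library.Log_Nat"
    "HOL-Computational_Algebra.Polynomial"
begin

section \<open>Functions as a real vector space\<close>

text \<open>
  Since \<open>n\<close> varies (polynomial running time is a statement about all \<open>n\<close> at once), a vector of
  dimension \<open>n\<close> is a function \<open>nat \<Rightarrow> real\<close> that vanishes outside \<open>{1..n}\<close>. The pointwise scalar
  multiplication below makes the library's \<^const>\<open>convex\<close> and \<^term>\<open>convex hull S\<close> applicable.
\<close>

instantiation "fun" :: (type, real_vector) real_vector
begin

definition scaleR_fun :: "real \<Rightarrow> ('a \<Rightarrow> 'b) \<Rightarrow> 'a \<Rightarrow> 'b" where
  "scaleR_fun r f = (\<lambda>x. r *\<^sub>R f x)"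

instance
  by standard (auto simp: scaleR_fun_def fun_eq_iff algebra_simps)

end

section \<open>Graphs, matroids and the surrogate problem\<close>

definition ground :: "nat \<Rightarrow> nat set" where
  "ground n = {1..n}"

definition simple_graph :: "'a set \<Rightarrow> 'a set set \<Rightarrow> bool" where
  "simple_graph V E \<longleftrightarrow> finite V \<and> (\<forall>e\<in>E. e \<subseteq> V \<and> card e = 2)"

definition matroid :: "'a set \<Rightarrow> 'a set set \<Rightarrow> bool" where
  "matroid V I \<longleftrightarrow>
     finite V \<and> I \<subseteq> Pow V \<and> {} \<in> I \<and>
     (\<forall>A\<in>I. \<forall>B. B \<subseteq> A \<longrightarrow> B \<in> I) \<and>
     (\<forall>A\<in>I. \<forall>B\<in>I. card A < card B \<longrightarrow> (\<exists>x\<in>B - A. insert x A \<in> I))"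

definition matroid_polytope :: "nat set set \<Rightarrow> (nat \<Rightarrow> real) set" where
  "matroid_polytope I = convex hull (indicator ` I)"

definition zero_one_vectors :: "nat \<Rightarrow> (nat \<Rightarrow> real) set" where
  "zero_one_vectors n =
     {x. (\<forall>v\<in>ground n. x v \<in> {0, 1}) \<and> (\<forall>v. v \<notin> ground n \<longrightarrow> x v = 0)}"

definition distributions :: "nat set set \<Rightarrow> nat set pmf set" where
  "distributions I = {\<pi>. set_pmf \<pi> \<subseteq> I}"

definition marginal :: "nat set set \<Rightarrow> nat set pmf \<Rightarrow> nat \<Rightarrow> real" where
  "marginal I \<pi> v = (\<Sum>S\<in>{S\<in>I. v \<in> S}. pmf \<pi> S)"

text \<open>
  As every edge \<open>e = {u, v}\<close> has exactly two elements, the inner sum is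
  \<open>x u * w e * (1 - q u) + x v * w e * (1 - q v)\<close>.
\<close>

definition Ltilde ::
  "nat set set \<Rightarrow> (nat set \<Rightarrow> real) \<Rightarrow> (nat \<Rightarrow> real) \<Rightarrow> (nat \<Rightarrow> real) \<Rightarrow> real" where
  "Ltilde E w q x = (\<Sum>e\<in>E. \<Sum>u\<in>e. x u * w e * (1 - q u))"

text \<open>The inner maximum; its feasible set is finite, and it is nonempty for a matroid \<open>I_f\<close>.\<close>

definition max_Ltilde ::
  "nat \<Rightarrow> nat set set \<Rightarrow> (nat set \<Rightarrow> real) \<Rightarrow> nat set set \<Rightarrow> (nat \<Rightarrow> real) \<Rightarrow> real" where
  "max_Ltilde n E w I_f q = Max (Ltilde E w q ` (matroid_polytope I_f \<inter> zero_one_vectors n))"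

definition surrogate_optimal ::
  "nat \<Rightarrow> nat set set \<Rightarrow> (nat set \<Rightarrow> real) \<Rightarrow> nat set set \<Rightarrow> nat set set \<Rightarrow> nat set pmf \<Rightarrow> bool" where
  "surrogate_optimal n E w I_l I_f \<pi> \<longleftrightarrow>
     is_arg_min (\<lambda>\<pi>. max_Ltilde n E w I_f (marginal I_l \<pi>)) (\<lambda>\<pi>. \<pi> \<in> distributions I_l) \<pi>"

definition marginal_optimal ::
  "nat \<Rightarrow> nat set set \<Rightarrow> (nat set \<Rightarrow> real) \<Rightarrow> nat set set \<Rightarrow> nat set set \<Rightarrow> (nat \<Rightarrow> real) \<Rightarrow> bool" where
  "marginal_optimal n E w I_l I_f q \<longleftrightarrow>
     is_arg_min (max_Ltilde n E w I_f) (\<lambda>q. q \<in> matroid_polytope I_l) q"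

section \<open>Polynomial time with an independence oracle\<close>

text \<open>
  Algorithms are programs over integer arrays; a scalar is the cell with index 0 of its array. The
  only access to the matroid is \<open>Query x a\<close>, which asks whether the set of those \<open>v \<in> {1..n}\<close>
  whose cell of the array \<open>a\<close> is nonzero is independent, and puts the answer (1 or 0) into \<open>x\<close>.

  Every elementary operation and every oracle call costs at least 1. Multiplication and division
  cost in addition the bit lengths of their operands. Hence every number occurring in a computation
  of cost \<open>t\<close> is at most about \<open>t\<close> bits longer than the longest number in the input or the
  program, so polynomially bounded cost also means polynomially many bit operations. With
  unit-cost multiplication this would fail, because repeated squaring produces numbers of
  exponential length.
\<close>

type_synonym vname = string
type_synonym state = "vname \<Rightarrow> int \<Rightarrow> int"

datatype aexp =
    Const int
  | Get vname aexp
  | Plus aexp aexp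
  | Minus aexp aexp
  | Times aexp aexp
  | Quot aexp aexp

datatype bexp =
    Less aexp aexp
  | Eq aexp aexp
  | Neg bexp
  | Conj bexp bexp

datatype com =
    Skip
  | Set vname aexp aexp
  | Query vname vname
  | Seq com com
  | Cond bexp com com
  | While bexp com

definition bit_length :: "int \<Rightarrow> nat" where
  "bit_length i = floorlog 2 (nat \<bar>i\<bar>)"

primrec aval :: "aexp \<Rightarrow> state \<Rightarrow> int" where
  "aval (Const i) s = i"
| "aval (Get x e) s = s x (aval e s)"
| "aval (Plus a b) s = aval a s + aval b s"
| "aval (Minus a b) s = aval a s - aval b s"
| "aval (Times a b) s = aval a s * aval b s"
| "aval (Quot a b) s = aval a s div aval b s"

primrec acost :: "aexp \<Rightarrow> state \<Rightarrow> nat" where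
  "acost (Const i) s = 1"
| "acost (Get x e) s = 1 + acost e s"
| "acost (Plus a b) s = 1 + acost a s + acost b s"
| "acost (Minus a b) s = 1 + acost a s + acost b s"
| "acost (Times a b) s =
     1 + bit_length (aval a s) + bit_length (aval b s) + acost a s + acost b s"
| "acost (Quot a b) s =
     1 + bit_length (aval a s) + bit_length (aval b s) + acost a s + acost b s"

primrec bval :: "bexp \<Rightarrow> state \<Rightarrow> bool" where
  "bval (Less a b) s \<longleftrightarrow> aval a s < aval b s"
| "bval (Eq a b) s \<longleftrightarrow> aval a s = aval b s"
| "bval (Neg b) s \<longleftrightarrow> \<not> bval b s"
| "bval (Conj b c) s \<longleftrightarrow> bval b s \<and> bval c s"

primrec bcost :: "bexp \<Rightarrow> state \<Rightarrow> nat" where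
  "bcost (Less a b) s = 1 + acost a s + acost b s"
| "bcost (Eq a b) s = 1 + acost a s + acost b s"
| "bcost (Neg b) s = 1 + bcost b s"
| "bcost (Conj b c) s = 1 + bcost b s + bcost c s"

definition update :: "vname \<Rightarrow> int \<Rightarrow> int \<Rightarrow> state \<Rightarrow> state" where
  "update x i k s = s(x := (s x)(i := k))"

definition query_set :: "nat \<Rightarrow> vname \<Rightarrow> state \<Rightarrow> nat set" where
  "query_set n a s = {v \<in> ground n. s a (int v) \<noteq> 0}"

text \<open>
  \<open>exec n I c s t s'\<close>: with the independence oracle for \<open>I\<close> on \<open>{1..n}\<close>, program \<open>c\<close> started in
  state \<open>s\<close> terminates in state \<open>s'\<close> at cost \<open>t\<close>.
\<close>

inductive exec :: "nat \<Rightarrow> nat set set \<Rightarrow> com \<Rightarrow> state \<Rightarrow> nat \<Rightarrow> state \<Rightarrow> bool"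
  for n :: nat and I :: "nat set set" where
  Skip: "exec n I Skip s 1 s"
| Set: "exec n I (Set x i e) s (1 + acost i s + acost e s) (update x (aval i s) (aval e s) s)"
| Query: "exec n I (Query x a) s 1 (update x 0 (if query_set n a s \<in> I then 1 else 0) s)"
| Seq: "exec n I c1 s1 t1 s2 \<Longrightarrow> exec n I c2 s2 t2 s3 \<Longrightarrow> exec n I (Seq c1 c2) s1 (t1 + t2) s3"
| CondTrue:
    "bval b s \<Longrightarrow> exec n I c1 s t s' \<Longrightarrow> exec n I (Cond b c1 c2) s (1 + bcost b s + t) s'"
| CondFalse:
    "\<not> bval b s \<Longrightarrow> exec n I c2 s t s' \<Longrightarrow> exec n I (Cond b c1 c2) s (1 + bcost b s + t) s'"
| WhileFalse: "\<not> bval b s \<Longrightarrow> exec n I (While b c) s (1 + bcost b s) s"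
| WhileTrue:
    "bval b s1 \<Longrightarrow> exec n I c s1 t1 s2 \<Longrightarrow> exec n I (While b c) s2 t2 s3 \<Longrightarrow>
     exec n I (While b c) s1 (1 + bcost b s1 + t1 + t2) s3"

text \<open>The rationals \<open>q 1, \<dots>, q n\<close> are given by numerator and denominator in lowest terms.\<close>

definition input_state :: "nat \<Rightarrow> (nat \<Rightarrow> rat) \<Rightarrow> state" where
  "input_state n q = (\<lambda>x i.
     if x = ''n'' \<and> i = 0 then int n
     else if x = ''num'' \<and> 1 \<le> i \<and> i \<le> int n then fst (quotient_of (q (nat i)))
     else if x = ''den'' \<and> 1 \<le> i \<and> i \<le> int n then snd (quotient_of (q (nat i)))
     else 0)"

definition encoding_length :: "nat \<Rightarrow> (nat \<Rightarrow> rat) \<Rightarrow> nat" where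
  "encoding_length n q =
     (\<Sum>v\<in>ground n. 1 + bit_length (fst (quotient_of (q v))) + bit_length (snd (quotient_of (q v))))"

text \<open>
  The output is a list of \<open>k\<close> pairs of a set and its probability. The \<open>n\<close> cells
  \<open>i * n + 1, \<dots>, i * n + n\<close> of \<open>out_set\<close> hold the characteristic vector of the \<open>i\<close>-th set
  (counted from 0).
\<close>

definition output_list :: "nat \<Rightarrow> state \<Rightarrow> (nat set \<times> rat) list" where
  "output_list n s =
     map (\<lambda>i. ({v \<in> ground n. s ''out_set'' (int (i * n + v)) \<noteq> 0},
               of_int (s ''out_num'' (int i)) / of_int (s ''out_den'' (int i))))
       [0..<nat (s ''k'' 0)]"

definition represents :: "(nat set \<times> rat) list \<Rightarrow> nat set pmf \<Rightarrow> bool" where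
  "represents xs \<pi> \<longleftrightarrow>
     distinct (map fst xs) \<and> fst ` set xs = set_pmf \<pi> \<and>
     (\<forall>(S, p)\<in>set xs. pmf \<pi> S = of_rat p)"

end

theory Submission
  imports Defs
begin

text \<open>
  The marginal map sends \<open>\<Delta>(I)\<close> onto the matroid polytope, so both problems minimise the same
  function of \<open>q\<close>; a minimum exists by compactness of the weight simplex.

  For the conversion, homogenise: a nonnegative integer vector \<open>z\<close> with mass \<open>z 0\<close> is to be written as a
  sum of \<open>z 0\<close> independent sets. This is a matroid partition problem with multiplicities, solved by
  scaling: the phase for \<open>2^k\<close> moves portions of \<open>2^k\<close> by a push-relabel method whose pushes are
  single exchanges in one independent set. If it gets stuck, it exhibits a violated rank inequality.
  Hence feasibility can be tested in time polynomial in the bit length.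

  One set \<open>S\<close> of such a decomposition lies in the minimal face of \<open>z\<close>. Bisection finds the largest \<open>l\<close>
  such that \<open>z - l * S\<close> is still decomposable; after scaling by \<open>fact n\<close> this \<open>l\<close> is the exact maximum,
  so some constraint becomes tight that \<open>S\<close> itself does not satisfy with equality. Repeating this yields
  sets that are triangular with respect to these constraints, hence linearly independent, and there
  are at most \<open>n + 1\<close> of them.
\<close>

section \<open>Exchanges in a matroid\<close>

text \<open>The running time must depend on the lengths of the numbers, not on their sizes. In the
  phase for step \<open>dl\<close> all weights are multiples of \<open>dl\<close>, the cover
  \<open>y\<close> is at most the target and the total weight \<open>M\<close> is at least the
  required mass. So each phase solves a relaxation: a rank inequality violated there refutes the
  exact target too, and for \<open>dl = 1\<close> nothing is rounded. Augmenting along a path may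
  change one independent set several times at once, where independence is hard to keep. Pushing
  along one arc needs only two exchange lemmas. As every run ends with a packing or a violated
  constraint, integer decomposition is a result of the algorithm, not an ingredient. An independent
  set has slack at most \<open>n\<close> in a rank constraint, so a nonzero slack divides
  \<open>fact n\<close>. This factor is applied anew in each peeling step; at most
  \<open>n + 1\<close> steps keep the bit length polynomial. Counting the mass as coordinate 0 puts
  the incidence vectors into dimension \<open>n + 1\<close>, which bounds the support, and makes
  total probability 1 one more coordinate equation.\<close>

lemma matroid_subset: "matroid V I \<Longrightarrow> A \<in> I \<Longrightarrow> B \<subseteq> A \<Longrightarrow> B \<in> I"
  unfolding matroid_def by blast

lemma matroid_ground: "matroid V I \<Longrightarrow> A \<in> I \<Longrightarrow> A \<subseteq> V"
  unfolding matroid_def by blast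

lemma matroid_finite: "matroid V I \<Longrightarrow> A \<in> I \<Longrightarrow> finite A"
  unfolding matroid_def by (meson PowD finite_subset subset_iff)

lemma matroid_finite_sets: "matroid V I \<Longrightarrow> finite I"
  unfolding matroid_def by (meson finite_Pow_iff finite_subset)

lemma matroid_empty: "matroid V I \<Longrightarrow> {} \<in> I"
  unfolding matroid_def by blast

lemma matroid_augment:
  "matroid V I \<Longrightarrow> A \<in> I \<Longrightarrow> B \<in> I \<Longrightarrow> card A < card B \<Longrightarrow> \<exists>x\<in>B - A. insert x A \<in> I"
  unfolding matroid_def by blast

lemma card_exchange: "finite S \<Longrightarrow> u \<in> S \<Longrightarrow> v \<notin> S \<Longrightarrow> card (insert v (S - {u})) = card S"
  by (metis DiffD1 card.remove card_insert_disjoint finite_Diff)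

text \<open>Let \<open>K\<close> be \<open>S\<close> without \<open>u\<close> and \<open>b\<close>.
  If \<open>K + u + a\<close> is dependent, then augmenting \<open>K + u\<close> from
  \<open>K + a + v\<close> must add \<open>v\<close>, and augmenting \<open>K + a\<close> from
  \<open>S\<close> must add \<open>b\<close>. In terms of arcs: an arc from \<open>a\<close> to
  \<open>b\<close> after the exchange of \<open>u\<close> by \<open>v\<close> either was there
  before or is matched by the old arcs from \<open>a\<close> to \<open>u\<close> and from
  \<open>v\<close> to \<open>b\<close>.\<close>

lemma exchange_arc:
  assumes M: "matroid V I" and S: "S \<in> I" "u \<in> S" "v \<notin> S" and J: "insert v (S - {u}) \<in> I"
    and a: "a \<notin> S" "a \<noteq> v" and b: "b \<in> S" "b \<noteq> u"
    and new: "insert a (insert v (S - {u}) - {b}) \<in> I"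
  shows "insert a (S - {b}) \<in> I \<or> insert a (S - {u}) \<in> I \<and> insert v (S - {b}) \<in> I"
proof (rule ccontr)
  assume neg: "\<not> ?thesis"
  define K where "K = S - {u, b}"
  have fin: "finite S" "finite K" using matroid_finite[OF M S(1)] by (auto simp: K_def)
  have SK: "S = insert u (insert b K)" and K: "u \<notin> K" "b \<notin> K" "v \<notin> K" "a \<notin> K"
    using S a b by (auto simp: K_def)
  have eqs: "S - {b} = insert u K" "S - {u} = insert b K" "v \<noteq> u" "v \<noteq> b" "a \<noteq> u" "a \<noteq> b"
    "insert v (S - {u}) - {b} = insert v K"
    using S a b by (auto simp: K_def)
  have new': "insert a (insert v K) \<in> I" using new eqs by simp
  have n1: "insert a (insert u K) \<notin> I" using neg eqs by simp
  have Su: "insert u K \<in> I" "insert b K \<in> I"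
    by (rule matroid_subset[OF M S(1)], use SK in blast)+
  have aK: "insert a K \<in> I" by (rule matroid_subset[OF M new']) auto
  have "\<exists>x\<in>insert a (insert v K) - insert u K. insert x (insert u K) \<in> I"
    by (rule matroid_augment[OF M Su(1) new']) (use fin K eqs a in auto)
  then have vb: "insert v (S - {b}) \<in> I" using n1 eqs by auto
  have "\<exists>x\<in>insert u (insert b K) - insert a K. insert x (insert a K) \<in> I"
    by (rule matroid_augment[OF M aK S(1)[unfolded SK]]) (use fin K eqs b in auto)
  then obtain x where "x = u \<or> x = b" "insert x (insert a K) \<in> I" by blast
  then have "insert b (insert a K) \<in> I" using n1 insert_commute[of u a K] by metis
  then have "insert a (S - {u}) \<in> I" unfolding eqs insert_commute[of a b K] .
  with vb neg show False by blast
qed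

text \<open>The new set is larger than \<open>S\<close>, and its only elements outside
  \<open>S\<close> are \<open>v\<close> and \<open>a\<close>, so augmentation of \<open>S\<close>
  adds one of these two.\<close>

lemma exchange_sink:
  assumes M: "matroid V I" and S: "S \<in> I" "u \<in> S" "v \<notin> S"
    and a: "a \<notin> S" "a \<noteq> v" and new: "insert a (insert v (S - {u})) \<in> I"
  shows "insert v S \<in> I \<or> insert a S \<in> I"
proof -
  have "finite S" using matroid_finite[OF M S(1)] .
  then have "card (insert a (insert v (S - {u}))) = Suc (card S)"
    using a card_exchange[OF _ S(2,3)] by simp
  then show ?thesis using matroid_augment[OF M S(1) new] by auto
qed

text \<open>
  An arc \<open>v \<rightarrow> u\<close> says that \<open>v\<close> can replace \<open>u\<close> in \<open>S\<close>. The element 0, which is not in the ground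
  set, stands for the sink: an arc \<open>v \<rightarrow> 0\<close> says that \<open>v\<close> can be added to \<open>S\<close>.
\<close>

definition valid_labels :: "nat set \<Rightarrow> nat set set \<Rightarrow> (nat \<Rightarrow> int) \<Rightarrow> nat set \<Rightarrow> bool" where
  "valid_labels V I d S \<longleftrightarrow>
     (\<forall>v\<in>V - S. \<forall>u\<in>insert 0 S. insert v (S - {u}) \<in> I \<longrightarrow> d v \<le> d u + 1)"

lemma valid_labelsD:
  "valid_labels V I d S \<Longrightarrow> v \<in> V \<Longrightarrow> v \<notin> S \<Longrightarrow> u \<in> insert 0 S \<Longrightarrow> insert v (S - {u}) \<in> I \<Longrightarrow>
   d v \<le> d u + 1"
  unfolding valid_labels_def by blast

text \<open>A new arc is compared with old arcs through the pushed one, along which the label drops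
  by exactly one: \<open>d a \<le> d u + 1 = d v \<le> d b + 1\<close>. Hence a push leaves the
  labels valid without touching them.\<close>

lemma valid_labels_push:
  assumes M: "matroid V I" and 0: "0 \<notin> V" and S: "S \<in> I" and v: "v \<in> V" "v \<notin> S"
    and u: "u \<in> insert 0 S" and J: "insert v (S - {u}) \<in> I"
    and d0: "d 0 = -1" and d: "\<And>x. x \<in> V \<Longrightarrow> 0 \<le> d x" and uv: "d u + 1 = d v"
    and val: "valid_labels V I d S"
  shows "valid_labels V I d (insert v (S - {u}))"
  unfolding valid_labels_def
proof (intro ballI impI)
  fix a b
  assume a: "a \<in> V - insert v (S - {u})" and b: "b \<in> insert 0 (insert v (S - {u}))"
    and new: "insert a (insert v (S - {u}) - {b}) \<in> I"
  have SV: "S \<subseteq> V" by (rule matroid_ground[OF M S])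
  have 0: "0 \<notin> S" using 0 SV by blast
  show "d a \<le> d b + 1"
  proof (cases "u = 0")
    case True
    have aS: "a \<notin> S" using a True 0 by auto
    have old: "x \<in> insert 0 S \<Longrightarrow> insert a (S - {x}) \<in> I \<Longrightarrow> d a \<le> d x + 1" for x
      using valid_labelsD[OF val] a aS by auto
    show ?thesis
    proof (cases "b = v")
      case True
      \<comment> \<open>Removing \<open>v\<close> again leaves \<open>S + a\<close>, so
        \<open>a\<close> had an arc to the sink and its label is at most 0.\<close>
      then have "insert a (S - {0}) \<in> I"
        using matroid_subset[OF M new] 0 v \<open>u = 0\<close> by (metis Diff_empty Diff_insert0 Diff_insert_absorb subset_refl)
      from old[OF _ this] d[of a] d[of v] a v True d0 show ?thesis by auto
    next
      case False
      then have "insert a (S - {b}) \<in> I" by (intro matroid_subset[OF M new]) (use True 0 in auto)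
      from old[OF _ this] False b True 0 show ?thesis by auto
    qed
  next
    case False
    then have uS: "u \<in> S" and du: "0 \<le> d u" using u d SV by auto
    \<comment> \<open>An arc from \<open>v\<close> to the sink would force \<open>d v\<close> to be
      at most 0, but \<open>d v = d u + 1\<close> is positive.\<close>
    have vsink: "insert v S \<notin> I"
      using valid_labelsD[OF val v, of 0] uv du d0 0 by auto
    have va: "v \<noteq> u" "a \<noteq> v" using uS v a by auto
    show ?thesis
    proof (cases "a = u")
      case True
      show ?thesis
      proof (cases "b = 0 \<or> b = v")
        case bv: True
        have "insert u (insert v (S - {u})) = insert v S" using uS by blast
        moreover have "insert v (S - {u}) - {0} = insert v (S - {u})" using 0 v \<open>0 \<notin> V\<close> by auto
        ultimately have "b \<noteq> 0" using new vsink True by metis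
        then show ?thesis using bv uv True by simp
      next
        case False
        moreover have "b \<noteq> u" using b uS False va by auto
        ultimately have "insert u (insert v (S - {u}) - {b}) = insert v (S - {b})"
          using uS va by blast
        then have "insert v (S - {b}) \<in> I" using new True by simp
        from valid_labelsD[OF val v _ this] False b uv True show ?thesis by auto
      qed
    next
      case False
      then have aS: "a \<notin> S" "a \<in> V" using a by auto
      have old: "x \<in> insert 0 S \<Longrightarrow> insert a (S - {x}) \<in> I \<Longrightarrow> d a \<le> d x + 1" for x
        using valid_labelsD[OF val] aS by auto
      consider "b = 0" | "b = v" "b \<noteq> 0" | "b \<noteq> v" "b \<in> S" "b \<noteq> u" "b \<noteq> 0" using b by auto
      then show ?thesis
      proof cases
        case 1
        moreover have "insert v (S - {u}) - {0} = insert v (S - {u})" using 0 v \<open>0 \<notin> V\<close> by auto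
        ultimately have "insert a (insert v (S - {u})) \<in> I" using new by simp
        from exchange_sink[OF M S uS v(2) aS(1) va(2) this] vsink have "insert a S \<in> I" by simp
        with old[of 0] 0 1 show ?thesis by auto
      next
        case 2
        then have "insert a (S - {u}) \<in> I" using new v by auto
        with old[of u] uS uv 2 show ?thesis by auto
      next
        case 3
        from exchange_arc[OF M S uS v(2) J aS(1) va(2) 3(2,3) new]
        consider "insert a (S - {b}) \<in> I" | "insert a (S - {u}) \<in> I" "insert v (S - {b}) \<in> I" by blast
        then show ?thesis
        proof cases
          case 1
          with old[of b] 3 show ?thesis by auto
        next
          case 2: 2
          with old[of u] valid_labelsD[OF val v, of b] 3 uS uv show ?thesis by auto
        qed
      qed
    qed
  qed
qed

section \<open>Linear constraints valid for all independent sets\<close>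

definition dot :: "nat \<Rightarrow> (nat \<Rightarrow> int) \<Rightarrow> (nat \<Rightarrow> int) \<Rightarrow> int" where
  "dot n c z = (\<Sum>v\<le>n. c v * z v)"

text \<open>The entry 1 at index 0 makes coordinate 0 of a weighted sum of sets the total
  weight.\<close>

definition ivec :: "nat set \<Rightarrow> nat \<Rightarrow> int" where
  "ivec S v = (if v = 0 \<or> v \<in> S then 1 else 0)"

text \<open>
  A vector \<open>z\<close> of mass \<open>z 0\<close> is homogenised: \<open>z\<close> is \<open>z 0\<close> times a point of the matroid polytope iff it
  satisfies all constraints. The divisibility makes the step lengths of the decomposition integers
  after scaling by \<open>fact n\<close>.
\<close>

definition valid_constraint :: "nat \<Rightarrow> nat set set \<Rightarrow> (nat \<Rightarrow> int) \<Rightarrow> bool" where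
  "valid_constraint n I c \<longleftrightarrow>
     (\<forall>S\<in>I. 0 \<le> dot n c (ivec S) \<and> (dot n c (ivec S) = 0 \<or> dot n c (ivec S) dvd fact n))"

lemma atMost_ground: "{..n} = insert 0 (ground n)"
  by (auto simp: ground_def)

lemma ground_simps [simp]: "0 \<notin> ground n" "finite (ground n)" "card (ground n) = n"
  by (auto simp: ground_def)

lemma dot_ground: "dot n c z = c 0 * z 0 + (\<Sum>v\<in>ground n. c v * z v)"
  unfolding dot_def atMost_ground by simp

lemma dot_unit: "v \<le> n \<Longrightarrow> dot n (\<lambda>x. if x = v then 1 else 0) z = z v"
  unfolding dot_def mult_delta_left by simp

lemma valid_constraint_unit:
  assumes "v \<le> n" shows "valid_constraint n I (\<lambda>x. if x = v then 1 else 0)"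
  unfolding valid_constraint_def using assms by (auto simp: dot_unit ivec_def)

section \<open>Rank function and rank constraints\<close>

definition rk :: "nat set set \<Rightarrow> nat set \<Rightarrow> nat" where
  "rk I R = Max (card ` {S \<in> I. S \<subseteq> R})"

lemma rk_ge: "matroid V I \<Longrightarrow> S \<in> I \<Longrightarrow> S \<subseteq> R \<Longrightarrow> card S \<le> rk I R"
  unfolding rk_def by (intro Max_ge) (auto dest: matroid_finite_sets)

lemma rk_eqI:
  assumes "matroid V I" "A \<in> I" "A \<subseteq> R" "\<And>T. T \<in> I \<Longrightarrow> T \<subseteq> R \<Longrightarrow> card T \<le> card A"
  shows "rk I R = card A"
  unfolding rk_def using assms matroid_finite_sets[OF assms(1)] by (intro Max_eqI) auto

lemma rk_obtain:
  assumes "matroid V I" obtains A where "A \<in> I" "A \<subseteq> R" "card A = rk I R"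
proof -
  have "rk I R \<in> card ` {S \<in> I. S \<subseteq> R}"
    unfolding rk_def using matroid_finite_sets[OF assms] matroid_empty[OF assms] by (intro Max_in) auto
  then show ?thesis using that by auto
qed

definition rank_constraint :: "nat set set \<Rightarrow> nat set \<Rightarrow> nat \<Rightarrow> int" where
  "rank_constraint I R v = (if v = 0 then int (rk I R) else if v \<in> R then -1 else 0)"

lemma dot_rank_constraint:
  assumes "R \<subseteq> ground n"
  shows "dot n (rank_constraint I R) z = int (rk I R) * z 0 - (\<Sum>v\<in>R. z v)"
proof -
  have "(\<Sum>v\<in>ground n. rank_constraint I R v * z v) = (\<Sum>v\<in>R. - z v)"
    by (rule sum.mono_neutral_cong_right) (use assms in \<open>auto simp: rank_constraint_def ground_def\<close>)
  then show ?thesis unfolding dot_ground by (simp add: rank_constraint_def sum_negf)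
qed

lemma sum_ivec:
  assumes "finite R" "0 \<notin> R" shows "(\<Sum>v\<in>R. ivec S v) = int (card (S \<inter> R))"
proof -
  have "(\<Sum>v\<in>R. ivec S v) = (\<Sum>v\<in>S \<inter> R. 1)"
    by (rule sum.mono_neutral_cong_right) (use assms in \<open>auto simp: ivec_def intro!: gr0I\<close>)
  then show ?thesis by simp
qed

text \<open>The slack of \<open>S\<close> is \<open>rk I R - card (S \<inter> R)\<close>, a number
  between 0 and \<open>n\<close>; if it is nonzero, it divides \<open>fact n\<close>.\<close>

lemma valid_rank_constraint:
  assumes M: "matroid (ground n) I" and R: "R \<subseteq> ground n"
  shows "valid_constraint n I (rank_constraint I R)"
  unfolding valid_constraint_def
proof
  fix S assume S: "S \<in> I"
  have fR: "finite R" by (rule finite_subset[OF R]) simp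
  have "0 \<notin> R" using R ground_simps(1)[of n] by blast
  note fR = fR this
  have eq: "dot n (rank_constraint I R) (ivec S) = int (rk I R) - int (card (S \<inter> R))"
    unfolding dot_rank_constraint[OF R] sum_ivec[OF fR] by (simp add: ivec_def)
  have le: "card (S \<inter> R) \<le> rk I R"
    by (rule rk_ge[OF M matroid_subset[OF M S Int_lower1] Int_lower2])
  obtain A where A: "A \<in> I" "A \<subseteq> R" "card A = rk I R" using rk_obtain[OF M] .
  have "card A \<le> n" using card_mono[of "ground n" A] A R by simp
  then have kn: "rk I R - card (S \<inter> R) \<le> n" using A by simp
  define k where "k = rk I R - card (S \<inter> R)"
  have "k = 0 \<or> k dvd fact n" using kn by (cases "k = 0") (auto simp: k_def intro!: dvd_fact)
  then have "int k = 0 \<or> int k dvd int (fact n)" by (simp only: of_nat_dvd_iff of_nat_eq_0_iff)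
  moreover have "dot n (rank_constraint I R) (ivec S) = int k" unfolding eq k_def using le by (simp add: of_nat_diff)
  ultimately show "0 \<le> dot n (rank_constraint I R) (ivec S) \<and>
    (dot n (rank_constraint I R) (ivec S) = 0 \<or> dot n (rank_constraint I R) (ivec S) dvd fact n)"
    by (simp add: of_nat_fact)
qed

text \<open>A set \<open>R\<close> that no exchange leaves is spanned by \<open>S\<close>. If
  \<open>S \<inter> R\<close> were not a basis of \<open>R\<close>, some \<open>a\<close> in
  \<open>R\<close> would extend it. Growing this extension inside \<open>S + a\<close> to at least
  the size of \<open>S\<close> yields \<open>S + a\<close> itself or an exchange of \<open>a\<close>
  for some \<open>u\<close> outside \<open>R\<close>.\<close>

lemma rk_closed:
  assumes M: "matroid V I" and S: "S \<in> I"
    and sink: "\<And>a. a \<in> R \<Longrightarrow> a \<notin> S \<Longrightarrow> insert a S \<notin> I"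
    and arc: "\<And>a u. a \<in> R \<Longrightarrow> a \<notin> S \<Longrightarrow> u \<in> S \<Longrightarrow> u \<notin> R \<Longrightarrow> insert a (S - {u}) \<notin> I"
  shows "rk I R = card (S \<inter> R)"
proof (rule rk_eqI[OF M])
  show SR: "S \<inter> R \<in> I" by (rule matroid_subset[OF M S]) auto
  fix T assume T: "T \<in> I" "T \<subseteq> R"
  have fS: "finite S" using matroid_finite[OF M S] .
  show "card T \<le> card (S \<inter> R)"
  proof (rule ccontr)
    assume "\<not> ?thesis"
    then have "card (S \<inter> R) < card T" by simp
    from matroid_augment[OF M SR T(1) this] 
    obtain a where a: "a \<in> T" "a \<notin> S \<inter> R" "insert a (S \<inter> R) \<in> I" by blast
    then have aR: "a \<in> R" "a \<notin> S" using T by auto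
    \<comment> \<open>A largest independent set \<open>B\<close> between
      \<open>(S \<inter> R) + a\<close> and \<open>S + a\<close> has at least \<open>card S\<close>
      elements, so it misses at most one element of \<open>S\<close>.\<close>
    define F where "F = {B \<in> I. insert a (S \<inter> R) \<subseteq> B \<and> B \<subseteq> insert a S}"
    have "finite F" "F \<noteq> {}" using matroid_finite_sets[OF M] a by (auto simp: F_def)
    then have "Max (card ` F) \<in> card ` F" "\<And>C. C \<in> F \<Longrightarrow> card C \<le> Max (card ` F)"
      by (auto intro: Max_in)
    then obtain B where B: "B \<in> F" "\<And>C. C \<in> F \<Longrightarrow> card C \<le> card B" by auto
    have fB: "finite B" and BI: "B \<in> I" using matroid_finite[OF M] B by (auto simp: F_def)
    have "card S \<le> card B"
    proof (rule ccontr)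
      assume "\<not> card S \<le> card B"
      then obtain x where "x \<in> S - B" "insert x B \<in> I" using matroid_augment[OF M BI S] by auto
      then have "insert x B \<in> F" "card (insert x B) = Suc (card B)" using B fB by (auto simp: F_def)
      then show False using B(2) by fastforce
    qed
    have sub: "B - {a} \<subseteq> S" "a \<in> B" using B by (auto simp: F_def)
    have "card (B - {a}) = card B - 1" using sub by simp
    show False
    proof (cases "S \<subseteq> B")
      case True
      then have "insert a S \<in> I" by (intro matroid_subset[OF M BI]) (use sub in auto)
      then show False using sink aR by blast
    next
      case False
      then obtain u where u: "u \<in> S" "u \<notin> B" by auto
      have "card (S - {u}) = card S - 1" using u fS by simp
      moreover have "B - {a} \<subseteq> S - {u}" using sub u by auto
      ultimately have "B - {a} = S - {u}"
        using \<open>card S \<le> card B\<close> \<open>card (B - {a}) = card B - 1\<close> fS by (intro card_seteq) auto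
      then have "insert a (S - {u}) \<in> I" using BI sub by (metis insert_Diff)
      moreover have "u \<notin> R" using u B by (auto simp: F_def)
      ultimately show False using arc aR u by blast
    qed
  qed
qed (rule Int_lower2)

section \<open>Distributions and the matroid polytope\<close>

lemma pmf_of_weights:
  fixes u :: "'a \<Rightarrow> real"
  assumes I: "finite I" and u: "\<And>S. S \<in> I \<Longrightarrow> 0 \<le> u S" "sum u I = 1"
  obtains \<pi> where "\<And>S. pmf \<pi> S = (if S \<in> I then u S else 0)"
proof -
  define f where "f S = (if S \<in> I then u S else 0)" for S
  have nn: "0 \<le> f S" for S using u(1) by (simp add: f_def)
  have "(\<integral>\<^sup>+S. ennreal (f S) \<partial>count_space UNIV) = (\<Sum>S\<in>I. ennreal (f S))"
    by (rule nn_integral_count_space'[OF I]) (auto simp: f_def)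
  also have "\<dots> = ennreal (\<Sum>S\<in>I. f S)" by (rule sum_ennreal) (rule nn)
  also have "\<dots> = 1" using u(2) by (simp add: f_def)
  finally have "(\<integral>\<^sup>+S. ennreal (f S) \<partial>count_space UNIV) = 1" .
  from pmf_embed_pmf[of f, OF nn this] have "pmf (embed_pmf f) S = f S" for S by simp
  then show ?thesis using that unfolding f_def by blast
qed

text \<open>The values are confined to compact sets, with 0 off \<open>I\<close>, so that Tychonoff
  applies although the index type has infinitely many elements.\<close>

definition weights :: "nat set set \<Rightarrow> (nat set \<Rightarrow> real) set" where
  "weights I = {u. u \<in> PiE UNIV (\<lambda>S. if S \<in> I then {0..1} else {0}) \<and> sum u I = 1}"

definition mix :: "nat set set \<Rightarrow> (nat set \<Rightarrow> real) \<Rightarrow> nat \<Rightarrow> real" where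
  "mix I u v = (\<Sum>S\<in>I. u S * indicator S v)"

lemma weightsD:
  "u \<in> weights I \<Longrightarrow> sum u I = 1" "u \<in> weights I \<Longrightarrow> S \<in> I \<Longrightarrow> 0 \<le> u S"
  unfolding weights_def by (simp, force simp: PiE_iff split: if_splits)

lemma weightsI:
  assumes "finite I" "\<And>S. S \<in> I \<Longrightarrow> 0 \<le> u S" "sum u I = 1"
  shows "(\<lambda>S. if S \<in> I then u S else 0) \<in> weights I"
proof -
  have "u S \<le> 1" if "S \<in> I" for S using member_le_sum[of S I u] assms that by simp
  then show ?thesis using assms by (auto simp: weights_def)
qed

lemma matroid_polytope_eq_mix:
  assumes I: "finite I" shows "matroid_polytope I = mix I ` weights I"
proof
  \<comment> \<open>The convex hull is a sum over points, the mixture a sum over sets; distinct sets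
    have distinct incidence vectors.\<close>
  have inj: "inj_on (indicator :: nat set \<Rightarrow> nat \<Rightarrow> real) I"
  proof (rule inj_onI)
    fix S T :: "nat set" assume "(indicator S :: nat \<Rightarrow> real) = indicator T"
    then have e: "(indicator S x :: real) = indicator T x" for x by (rule fun_cong)
    have "x \<in> S \<longleftrightarrow> x \<in> T" for x using e[of x] by (cases "x \<in> S"; cases "x \<in> T") auto
    then show "S = T" by blast
  qed
  have app: "(\<Sum>S\<in>I. u S *\<^sub>R (indicator S :: nat \<Rightarrow> real)) = mix I u" for u :: "nat set \<Rightarrow> real"
  proof
    fix v
    have "(\<Sum>S\<in>I. u S *\<^sub>R (indicator S :: nat \<Rightarrow> real)) v = (\<Sum>S\<in>I. (u S *\<^sub>R (indicator S :: nat \<Rightarrow> real)) v)"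
      using I by (induction I rule: finite_induct) simp_all
    then show "(\<Sum>S\<in>I. u S *\<^sub>R (indicator S :: nat \<Rightarrow> real)) v = mix I u v"
      by (simp add: mix_def scaleR_fun_def)
  qed
  show "matroid_polytope I \<subseteq> mix I ` weights I"
  proof
    fix y assume "y \<in> matroid_polytope I"
    then obtain g where g: "\<And>x. x \<in> indicator ` I \<Longrightarrow> 0 \<le> g x" "sum g (indicator ` I) = 1"
      "(\<Sum>x\<in>indicator ` I. g x *\<^sub>R x) = y"
      unfolding matroid_polytope_def convex_hull_finite[OF finite_imageI[OF I]] by blast
    define u where "u S = g (indicator S)" for S
    have "sum u I = 1" using g(2) by (simp add: sum.reindex[OF inj] u_def o_def)
    moreover have "mix I u = y" using g(3) by (simp add: sum.reindex[OF inj] app[symmetric] u_def o_def)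
    moreover have "mix I (\<lambda>S. if S \<in> I then u S else 0) = mix I u" by (rule ext) (simp add: mix_def)
    moreover have "(\<lambda>S. if S \<in> I then u S else 0) \<in> weights I" if "sum u I = 1"
      by (rule weightsI[OF I _ that]) (use g(1) in \<open>simp add: u_def\<close>)
    ultimately show "y \<in> mix I ` weights I" by (intro image_eqI) simp_all
  qed
  show "mix I ` weights I \<subseteq> matroid_polytope I"
  proof
    fix y assume "y \<in> mix I ` weights I"
    then obtain u where u: "u \<in> weights I" "y = mix I u" by auto
    have "(\<Sum>S\<in>I. u S *\<^sub>R (indicator S :: nat \<Rightarrow> real)) \<in> convex hull (indicator ` I)"
      by (intro convex_sum convex_convex_hull I) (use weightsD[OF u(1)] in \<open>auto intro: hull_inc\<close>)
    then show "y \<in> matroid_polytope I" unfolding app u(2) matroid_polytope_def .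
  qed
qed

lemma marginal_distributions:
  assumes M: "matroid V I" shows "marginal I ` distributions I = matroid_polytope I"
proof -
  have I: "finite I" by (rule matroid_finite_sets[OF M])
  have eq: "marginal I \<pi> = mix I (pmf \<pi>)" for \<pi>
  proof
    fix v
    have "mix I (pmf \<pi>) v = (\<Sum>S\<in>I. if v \<in> S then pmf \<pi> S else 0)"
      unfolding mix_def by (rule sum.cong) (auto simp: indicator_def)
    also have "\<dots> = marginal I \<pi> v" unfolding marginal_def by (rule sum.inter_filter[OF I, symmetric])
    finally show "marginal I \<pi> v = mix I (pmf \<pi>) v" by simp
  qed
  show ?thesis unfolding matroid_polytope_eq_mix[OF I]
  proof
    show "marginal I ` distributions I \<subseteq> mix I ` weights I"
    proof
      fix y assume "y \<in> marginal I ` distributions I"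
      then obtain \<pi> where \<pi>: "set_pmf \<pi> \<subseteq> I" "y = marginal I \<pi>" by (auto simp: distributions_def)
      have "sum (pmf \<pi>) I = 1" by (rule sum_pmf_eq_1[OF I \<pi>(1)])
      then have "(\<lambda>S. if S \<in> I then pmf \<pi> S else 0) \<in> weights I" by (intro weightsI[OF I]) simp_all
      moreover have "mix I (\<lambda>S. if S \<in> I then pmf \<pi> S else 0) = mix I (pmf \<pi>)" by (rule ext) (simp add: mix_def)
      ultimately show "y \<in> mix I ` weights I" using \<pi>(2) eq by (intro image_eqI) simp_all
    qed
    show "mix I ` weights I \<subseteq> marginal I ` distributions I"
    proof
      fix y assume "y \<in> mix I ` weights I"
      then obtain u where u: "u \<in> weights I" "y = mix I u" by auto
      obtain \<pi> where \<pi>: "\<And>S. pmf \<pi> S = (if S \<in> I then u S else 0)"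
        using pmf_of_weights[OF I weightsD(2)[OF u(1)] weightsD(1)[OF u(1)]] by blast
      have "\<pi> \<in> distributions I" by (auto simp: distributions_def set_pmf_eq \<pi>)
      moreover have "marginal I \<pi> = y" unfolding eq u(2) by (rule ext) (simp add: mix_def \<pi>)
      ultimately show "y \<in> marginal I ` distributions I" by blast
    qed
  qed
qed

section \<open>Existence of the minima\<close>

lemma compact_weights: "compact (weights I)"
proof -
  have "compactin (product_topology (\<lambda>_. euclidean) UNIV) (PiE UNIV (\<lambda>S. if S \<in> I then {0..1} else {0 :: real}))"
    by (auto simp: compactin_PiE)
  then have c: "compact (PiE UNIV (\<lambda>S :: nat set. if S \<in> I then {0..1} else {0 :: real}))"
    by (simp add: euclidean_product_topology)
  have "continuous_on UNIV (\<lambda>u :: nat set \<Rightarrow> real. sum u I)" by (intro continuous_on_sum) simp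
  then have "closed {u :: nat set \<Rightarrow> real. sum u I = 1}" by (intro closed_Collect_eq) simp_all
  then have "compact (PiE UNIV (\<lambda>S :: nat set. if S \<in> I then {0..1} else {0 :: real}) \<inter> {u. sum u I = 1})"
    by (rule compact_Int_closed[OF c])
  moreover have "weights I = PiE UNIV (\<lambda>S :: nat set. if S \<in> I then {0..1} else {0 :: real}) \<inter> {u. sum u I = 1}"
    by (auto simp: weights_def)
  ultimately show ?thesis by simp
qed

lemma continuous_on_Max:
  fixes f :: "'a \<Rightarrow> 'b :: topological_space \<Rightarrow> real"
  assumes "finite A" "A \<noteq> {}" "\<And>a. a \<in> A \<Longrightarrow> continuous_on K (f a)"
  shows "continuous_on K (\<lambda>x. Max ((\<lambda>a. f a x) ` A))"
  using assms
proof (induction rule: finite_ne_induct)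
  case (insert a A)
  then have "continuous_on K (\<lambda>x. max (f a x) (Max ((\<lambda>a. f a x) ` A)))" by (intro continuous_on_max) auto
  then show ?case using insert.hyps by simp
qed simp

lemma finite_zero_one_vectors: "finite (zero_one_vectors n)"
proof -
  have "zero_one_vectors n \<subseteq> indicator ` Pow (ground n)"
  proof
    fix x assume x: "x \<in> zero_one_vectors n"
    have "x = indicator {v \<in> ground n. x v = 1}"
    proof
      fix v show "x v = indicator {v \<in> ground n. x v = 1} v"
        using x by (cases "v \<in> ground n") (auto simp: zero_one_vectors_def indicator_def)
    qed
    then show "x \<in> indicator ` Pow (ground n)" by blast
  qed
  then show ?thesis by (rule finite_subset) simp
qed

lemma marginal_optimal_exists:
  assumes Ml: "matroid (ground n) I_l" and Mf: "matroid (ground n) I_f"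
  shows "\<exists>q. marginal_optimal n E w I_l I_f q"
proof -
  have I: "finite I_l" by (rule matroid_finite_sets[OF Ml])
  let ?A = "matroid_polytope I_f \<inter> zero_one_vectors n"
  have "(indicator {} :: nat \<Rightarrow> real) \<in> matroid_polytope I_f"
    unfolding matroid_polytope_def by (rule hull_inc) (use matroid_empty[OF Mf] in blast)
  moreover have "(indicator {} :: nat \<Rightarrow> real) \<in> zero_one_vectors n" by (simp add: zero_one_vectors_def)
  ultimately have A: "finite ?A" "?A \<noteq> {}" using finite_zero_one_vectors by auto
  \<comment> \<open>For fixed \<open>x\<close> the objective is affine in the weights, and a maximum
    over the finite set \<open>?A\<close> remains continuous.\<close>
  have "continuous_on (weights I_l) (\<lambda>u. Ltilde E w (mix I_l u) x)" for x
    unfolding Ltilde_def mix_def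
    by (intro continuous_intros continuous_on_subset[OF continuous_on_product_coordinates]) auto
  then have "continuous_on (weights I_l) (\<lambda>u. Max ((\<lambda>x. Ltilde E w (mix I_l u) x) ` ?A))"
    by (intro continuous_on_Max A)
  then have cont: "continuous_on (weights I_l) (\<lambda>u. max_Ltilde n E w I_f (mix I_l u))"
    by (simp add: max_Ltilde_def)
  have "(\<lambda>S. if S \<in> I_l then if S = {} then 1 else 0 else 0 :: real) \<in> weights I_l"
    by (intro weightsI[OF I]) (use I matroid_empty[OF Ml] in simp_all)
  then have "weights I_l \<noteq> {}" by blast
  from continuous_attains_inf[OF compact_weights this cont]
  obtain u where u: "u \<in> weights I_l"
    "\<And>u'. u' \<in> weights I_l \<Longrightarrow> max_Ltilde n E w I_f (mix I_l u) \<le> max_Ltilde n E w I_f (mix I_l u')" by blast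
  then have "marginal_optimal n E w I_l I_f (mix I_l u)"
    unfolding marginal_optimal_def is_arg_min_def matroid_polytope_eq_mix[OF I] by (auto simp: not_less)
  then show ?thesis by blast
qed

lemma equal_optimal_values:
  assumes Ml: "matroid (ground n) I_l" and Mf: "matroid (ground n) I_f"
  shows "\<exists>\<pi> q. surrogate_optimal n E w I_l I_f \<pi> \<and> marginal_optimal n E w I_l I_f q \<and>
    max_Ltilde n E w I_f (marginal I_l \<pi>) = max_Ltilde n E w I_f q"
proof -
  obtain q where q: "marginal_optimal n E w I_l I_f q" using marginal_optimal_exists[OF assms] by blast
  then have "q \<in> marginal I_l ` distributions I_l"
    unfolding marginal_distributions[OF Ml] by (simp add: marginal_optimal_def is_arg_min_def)
  then obtain \<pi> where \<pi>: "\<pi> \<in> distributions I_l" "q = marginal I_l \<pi>" by blast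
  have "marginal I_l \<pi>' \<in> matroid_polytope I_l" if "\<pi>' \<in> distributions I_l" for \<pi>'
    using that marginal_distributions[OF Ml] by blast
  then have "surrogate_optimal n E w I_l I_f \<pi>"
    using q \<pi> unfolding surrogate_optimal_def marginal_optimal_def is_arg_min_def by blast
  then show ?thesis using q \<pi>(2) by blast
qed

section \<open>Push-relabel steps on weighted independent sets\<close>

definition packing ::
  "nat \<Rightarrow> nat set set \<Rightarrow> nat \<Rightarrow> (nat \<Rightarrow> nat set) \<Rightarrow> (nat \<Rightarrow> int) \<Rightarrow> (nat \<Rightarrow> int) \<Rightarrow> int \<Rightarrow> bool" where
  "packing n I m S w y M \<longleftrightarrow>
     (\<forall>i<m. S i \<in> I \<and> 0 \<le> w i) \<and> (\<Sum>i<m. w i) = M \<and>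
     (\<forall>v\<in>ground n. y v = (\<Sum>i<m. w i * ivec (S i) v))"

text \<open>Validity of the labels is asked of blocks with positive weight only, since an emptied
  block never qualifies for an exchange. The last clause keeps weight on block 0, so that its set
  can be handed over for peeling when the last phase ends.\<close>

definition pr_inv ::
  "nat \<Rightarrow> nat set set \<Rightarrow> int \<Rightarrow> (nat \<Rightarrow> int) \<Rightarrow> nat \<Rightarrow> (nat \<Rightarrow> nat set) \<Rightarrow> (nat \<Rightarrow> int) \<Rightarrow> (nat \<Rightarrow> int) \<Rightarrow>
   (nat \<Rightarrow> int) \<Rightarrow> int \<Rightarrow> bool" where
  "pr_inv n I dl Z m S w y d M \<longleftrightarrow>
     packing n I m S w y M \<and> 0 < dl \<and> (\<forall>i<m. dl dvd w i) \<and> (\<forall>v\<in>ground n. y v \<le> Z v) \<and>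
     d 0 = -1 \<and> (\<forall>v\<in>ground n. 0 \<le> d v \<and> d v < int n) \<and>
     (\<forall>i<m. 0 < w i \<longrightarrow> valid_labels (ground n) I d (S i)) \<and>
     Z 0 \<le> M \<and> (0 < Z 0 \<longrightarrow> 0 < m \<and> dl \<le> w 0)"

definition units :: "int \<Rightarrow> (nat \<Rightarrow> int) \<Rightarrow> (nat \<Rightarrow> int) \<Rightarrow> nat \<Rightarrow> int" where
  "units dl Z y v = (Z v - y v) div dl"

text \<open>
  The first sum drops with every push, because a push moves a unit one level down. A relabelling
  raises it by at most \<open>2 n\<close>, the bound on the number of missing units.
\<close>

definition potential :: "nat \<Rightarrow> int \<Rightarrow> (nat \<Rightarrow> int) \<Rightarrow> (nat \<Rightarrow> int) \<Rightarrow> (nat \<Rightarrow> int) \<Rightarrow> int" where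
  "potential n dl Z y d =
     (\<Sum>v\<in>ground n. units dl Z y v * (d v + 1)) + (2 * int n + 1) * (\<Sum>v\<in>ground n. int n - d v)"

section \<open>Effect of pushing and relabelling on the invariant and the potential\<close>

lemma sum_fun_upd:
  fixes f :: "'a \<Rightarrow> int"
  assumes "finite A"
  shows "sum (f(v := a)) A = sum f A + (if v \<in> A then a - f v else 0)"
proof (cases "v \<in> A")
  case True
  then have "sum (f(v := a)) A = a + sum (f(v := a)) (A - {v})" "sum f A = f v + sum f (A - {v})"
    using assms by (simp_all add: sum.remove)
  moreover have "sum (f(v := a)) (A - {v}) = sum f (A - {v})" by (rule sum.cong) auto
  ultimately show ?thesis using True by simp
next
  case False
  then have "sum (f(v := a)) A = sum f A" by (intro sum.cong) auto
  then show ?thesis using False by simp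
qed

lemma ivec_exchange:
  assumes "v \<notin> S" "v \<noteq> 0" "0 \<notin> S" "u \<in> insert 0 S"
  shows "ivec (insert v (S - {u})) x - ivec S x =
    (if x = v then 1 else 0) - (if x = u \<and> u \<noteq> 0 then 1 else 0)"
  using assms by (auto simp: ivec_def)

text \<open>Block \<open>i\<close> is split: a portion \<open>dl\<close> gets the new set
  \<open>J\<close> in place, the remainder keeps the old set in the fresh block \<open>m\<close>.
  Leaving exactly \<open>dl\<close> in place ensures that block 0 never falls below
  \<open>dl\<close>.\<close>

lemma sum_split_entry:
  fixes F :: "nat set \<Rightarrow> int" and w :: "nat \<Rightarrow> int"
  assumes "i < m"
  shows "(\<Sum>j<Suc m. (w(i := dl, m := w i - dl)) j * F ((S(i := J, m := S i)) j)) =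
    (\<Sum>j<m. w j * F (S j)) + dl * (F J - F (S i))"
proof -
  let ?f = "\<lambda>j. w j * F (S j)"
  have "(\<Sum>j<Suc m. (w(i := dl, m := w i - dl)) j * F ((S(i := J, m := S i)) j)) =
     (\<Sum>j<m. (?f(i := dl * F J)) j) + (w i - dl) * F (S i)"
    using assms by (auto intro!: sum.cong)
  also have "\<dots> = (\<Sum>j<m. ?f j) + (dl * F J - w i * F (S i)) + (w i - dl) * F (S i)"
    by (subst sum_fun_upd) (use assms in auto)
  finally show ?thesis by (simp add: algebra_simps)
qed

text \<open>The deficit of \<open>v\<close> shrinks by \<open>dl\<close> and that of
  \<open>u\<close> grows by \<open>dl\<close>. For \<open>u = 0\<close> the deficit disappears:
  entry 0 of \<open>y\<close> is a dummy outside the ground set, so a push to the sink needs no case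
  split.\<close>

lemma pr_inv_push:
  assumes M: "matroid (ground n) I" and inv: "pr_inv n I dl Z m S w y d M"
    and v: "v \<in> ground n" "y v + dl \<le> Z v"
    and i: "i < m" "dl \<le> w i" "v \<notin> S i" "u \<in> insert 0 (S i)" "d u + 1 = d v"
    and J: "insert v (S i - {u}) \<in> I"
    and few: "(\<Sum>v\<in>ground n. units dl Z y v) \<le> 2 * int n"
  defines "S' \<equiv> S(i := insert v (S i - {u}), m := S i)"
    and "w' \<equiv> w(i := dl, m := w i - dl)"
    and "y' \<equiv> (y(v := y v + dl))(u := (y(v := y v + dl)) u - dl)"
  shows "pr_inv n I dl Z (Suc m) S' w' y' d M"
    and "(\<Sum>v\<in>ground n. units dl Z y' v) \<le> 2 * int n"
    and "potential n dl Z y' d < potential n dl Z y d"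
proof -
  have P: "\<And>j. j < m \<Longrightarrow> S j \<in> I \<and> 0 \<le> w j" "(\<Sum>j<m. w j) = M"
    "\<And>x. x \<in> ground n \<Longrightarrow> y x = (\<Sum>j<m. w j * ivec (S j) x)"
    and dl: "0 < dl" "\<And>j. j < m \<Longrightarrow> dl dvd w j" and yZ: "\<And>x. x \<in> ground n \<Longrightarrow> y x \<le> Z x"
    and d: "d 0 = -1" "\<And>x. x \<in> ground n \<Longrightarrow> 0 \<le> d x \<and> d x < int n"
    and val: "\<And>j. j < m \<Longrightarrow> 0 < w j \<Longrightarrow> valid_labels (ground n) I d (S j)"
    and Z0: "Z 0 \<le> M" "0 < Z 0 \<Longrightarrow> 0 < m \<and> dl \<le> w 0"
    using inv unfolding pr_inv_def packing_def by auto
  have Si: "S i \<in> I" "S i \<subseteq> ground n"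
    using P(1)[OF i(1)] matroid_ground[OF M] by auto
  then have Si: "S i \<in> I" "S i \<subseteq> ground n" "0 \<notin> S i" by (auto simp: ground_def)
  have v0: "v \<noteq> 0" "v \<noteq> u" using v i by (auto simp: ground_def)
  have ex: "ivec (insert v (S i - {u})) x - ivec (S i) x =
      (if x = v then 1 else 0) - (if x = u \<and> u \<noteq> 0 then 1 else 0)" for x
    by (rule ivec_exchange) (use i Si v0 in auto)
  have "packing n I (Suc m) S' w' y' M"
    unfolding packing_def
  proof (intro conjI allI impI ballI)
    fix j assume "j < Suc m"
    then show "S' j \<in> I" "0 \<le> w' j"
      using P(1) i J Si dl unfolding S'_def w'_def by (auto simp: less_Suc_eq)
  next
    have "(\<Sum>j<Suc m. w' j) = (\<Sum>j<Suc m. w' j * (\<lambda>_. 1) (S' j))" by simp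
    also have "\<dots> = (\<Sum>j<m. w j * 1) + dl * (1 - 1)"
      unfolding w'_def S'_def by (rule sum_split_entry[OF i(1), where F = "\<lambda>_. 1"])
    finally show "(\<Sum>j<Suc m. w' j) = M" using P(2) by simp
  next
    fix x assume x: "x \<in> ground n"
    have "(\<Sum>j<Suc m. w' j * ivec (S' j) x) = y x + dl * ((if x = v then 1 else 0) - (if x = u \<and> u \<noteq> 0 then 1 else 0))"
      unfolding w'_def S'_def sum_split_entry[OF i(1), where F = "\<lambda>S. ivec S x"] ex P(3)[OF x] ..
    then show "y' x = (\<Sum>j<Suc m. w' j * ivec (S' j) x)"
      using x v0 by (auto simp: y'_def)
  qed
  moreover have "dl dvd w' j" if "j < Suc m" for j
    using that dl i unfolding w'_def by (auto simp: less_Suc_eq)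
  moreover have "y' x \<le> Z x" if "x \<in> ground n" for x
    using that yZ[OF that] v dl v0 by (auto simp: y'_def)
  moreover have "valid_labels (ground n) I d (S' j)" if j: "j < Suc m" "0 < w' j" for j
  proof -
    have wi: "0 < w i" using i dl by simp
    consider "j = i" | "j = m" | "j < m" "j \<noteq> i" "j \<noteq> m" using j by linarith
    then show ?thesis
    proof cases
      case 1
      have "valid_labels (ground n) I d (insert v (S i - {u}))"
        by (rule valid_labels_push[OF M _ Si(1) v(1) i(3,4) J d(1) _ i(5) val[OF i(1) wi]])
          (use d in auto)
      then show ?thesis using 1 i by (simp add: S'_def)
    qed (use val i wi j in \<open>auto simp: S'_def w'_def\<close>)
  qed
  moreover have "0 < Z 0 \<Longrightarrow> dl \<le> w' 0" using Z0 i by (auto simp: w'_def)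
  ultimately show "pr_inv n I dl Z (Suc m) S' w' y' d M"
    unfolding pr_inv_def using dl d Z0 by simp
  have un: "units dl Z y' x = units dl Z y x - (if x = v then 1 else 0) + (if x = u then 1 else 0)" for x
  proof -
    have 1: "(a - dl) div dl = a div dl - 1" "(a + dl) div dl = a div dl + 1" for a
      using dl div_mult_self1[of dl a "-1"] div_mult_self1[of dl a 1] by auto
    have 2: "Z v - (y v + dl) = (Z v - y v) - dl" "Z u - (y u - dl) = (Z u - y u) + dl" by simp_all
    show ?thesis unfolding units_def y'_def using v0 by (simp add: 2 1)
  qed
  have sv: "(\<Sum>x\<in>ground n. (if x = v then 1 else 0) * g x) = g v" for g :: "nat \<Rightarrow> int"
    unfolding mult_delta_left using v by simp
  have su: "(\<Sum>x\<in>ground n. (if x = u then 1 else 0) * g x) = (if u \<in> ground n then g u else 0)" for g :: "nat \<Rightarrow> int"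
    unfolding mult_delta_left by simp
  have eq: "(\<Sum>x\<in>ground n. units dl Z y' x * g x) = (\<Sum>x\<in>ground n. units dl Z y x * g x) - g v +
      (if u \<in> ground n then g u else 0)" for g
    unfolding un distrib_right left_diff_distrib sum.distrib sum_subtractf sv su by simp
  show "(\<Sum>v\<in>ground n. units dl Z y' v) \<le> 2 * int n"
    using eq[of "\<lambda>_. 1"] few by (simp split: if_splits)
  \<comment> \<open>The first sum changes by \<open>(d u + 1) - (d v + 1) = -1\<close>. For the sink
    the first term is absent and \<open>d v = 0\<close>, so the change is again -1.\<close>
  show "potential n dl Z y' d < potential n dl Z y d"
    unfolding potential_def eq[of "\<lambda>v. d v + 1"] using i(5) d(1) d(2)[OF v(1)] i(4) Si by auto
qed

text \<open>An arc out of \<open>v\<close> that is not admissible satisfies its label inequality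
  strictly, which leaves room to raise \<open>d v\<close> by one; arcs into \<open>v\<close> only
  gain slack.\<close>

lemma pr_inv_relabel:
  assumes M: "matroid (ground n) I" and inv: "pr_inv n I dl Z m S w y d M"
    and v: "v \<in> ground n"
    and no: "\<And>i u. i < m \<Longrightarrow> dl \<le> w i \<Longrightarrow> v \<notin> S i \<Longrightarrow> u \<in> insert 0 (S i) \<Longrightarrow>
       d u + 1 = d v \<Longrightarrow> insert v (S i - {u}) \<notin> I"
    and few: "(\<Sum>v\<in>ground n. units dl Z y v) \<le> 2 * int n"
  shows "i < m \<Longrightarrow> 0 < w i \<Longrightarrow> valid_labels (ground n) I (d(v := d v + 1)) (S i)"
    and "potential n dl Z y (d(v := d v + 1)) < potential n dl Z y d"
    and "d v + 1 < int n \<Longrightarrow> pr_inv n I dl Z m S w y (d(v := d v + 1)) M"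
proof -
  have dl: "0 < dl" "\<And>j. j < m \<Longrightarrow> dl dvd w j" and yZ: "\<And>x. x \<in> ground n \<Longrightarrow> y x \<le> Z x"
    and d: "d 0 = -1" "\<And>x. x \<in> ground n \<Longrightarrow> 0 \<le> d x \<and> d x < int n"
    and val: "\<And>j. j < m \<Longrightarrow> 0 < w j \<Longrightarrow> valid_labels (ground n) I d (S j)"
    using inv unfolding pr_inv_def by auto
  have v0: "v \<noteq> 0" using v by (auto simp: ground_def)
  show lab: "valid_labels (ground n) I (d(v := d v + 1)) (S i)" if i: "i < m" "0 < w i" for i
    unfolding valid_labels_def
  proof (intro ballI impI)
    fix a u assume a: "a \<in> ground n - S i" and u: "u \<in> insert 0 (S i)" and ex: "insert a (S i - {u}) \<in> I"
    have le: "d a \<le> d u + 1" using valid_labelsD[OF val[OF i]] a u ex by blast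
    \<comment> \<open>Weights are multiples of \<open>dl\<close>, so every block of positive weight
      is covered by the hypothesis on exchanges.\<close>
    have "dl \<le> w i" using dl i zdvd_imp_le by blast
    then have "a = v \<Longrightarrow> d u + 1 \<noteq> d v" using no[OF i(1)] a u ex by blast
    then show "(d(v := d v + 1)) a \<le> (d(v := d v + 1)) u + 1" using le a u v0 by auto
  qed
  show "pr_inv n I dl Z m S w y (d(v := d v + 1)) M" if "d v + 1 < int n"
    using inv that d lab v0 v unfolding pr_inv_def by auto
  have nonneg: "0 \<le> units dl Z y x" if "x \<in> ground n" for x
    unfolding units_def using yZ[OF that] dl by (simp add: pos_imp_zdiv_nonneg_iff)
  have "units dl Z y v \<le> (\<Sum>v\<in>ground n. units dl Z y v)"
    by (rule member_le_sum) (use v nonneg in auto)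
  then have uv: "units dl Z y v \<le> 2 * int n" using few by simp
  have "(\<lambda>x. units dl Z y x * ((d(v := d v + 1)) x + 1)) =
      (\<lambda>x. units dl Z y x * (d x + 1))(v := units dl Z y v * (d v + 2))" by auto
  then have 1: "(\<Sum>x\<in>ground n. units dl Z y x * ((d(v := d v + 1)) x + 1)) =
      (\<Sum>x\<in>ground n. units dl Z y x * (d x + 1)) + units dl Z y v"
    using v by (simp only: sum_fun_upd ground_simps if_True) (simp add: algebra_simps)
  have "(\<lambda>x. int n - (d(v := d v + 1)) x) = (\<lambda>x. int n - d x)(v := int n - d v - 1)" by auto
  then have 2: "(\<Sum>x\<in>ground n. int n - (d(v := d v + 1)) x) = (\<Sum>x\<in>ground n. int n - d x) - 1"
    using v by (simp only: sum_fun_upd ground_simps if_True)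
  show "potential n dl Z y (d(v := d v + 1)) < potential n dl Z y d"
    unfolding potential_def 1 2 using uv by (simp add: algebra_simps)
qed

text \<open>
  If a label reaches \<open>n\<close>, then some level below \<open>n\<close> is empty, and the elements above it form a set
  that no exchange leaves, so that every independent set of the packing spans it.
\<close>

lemma pr_inv_fail:
  assumes M: "matroid (ground n) I" and pack: "packing n I m S w y M"
    and yZ: "\<And>x. x \<in> ground n \<Longrightarrow> y x \<le> Z x"
    and d: "d 0 = -1" "\<And>x. x \<in> ground n \<Longrightarrow> 0 \<le> d x"
    and val: "\<And>j. j < m \<Longrightarrow> 0 < w j \<Longrightarrow> valid_labels (ground n) I d (S j)"
    and Z0: "Z 0 \<le> M" and v: "v \<in> ground n" "y v < Z v" "int n \<le> d v"
  shows "\<exists>c. valid_constraint n I c \<and> dot n c Z < 0"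
proof -
  have P: "\<And>j. j < m \<Longrightarrow> S j \<in> I \<and> 0 \<le> w j" "(\<Sum>j<m. w j) = M"
    "\<And>x. x \<in> ground n \<Longrightarrow> y x = (\<Sum>j<m. w j * ivec (S j) x)"
    using pack unfolding packing_def by auto
  \<comment> \<open>The other \<open>n - 1\<close> elements cannot occupy all of the
    \<open>n\<close> levels \<open>0, ..., n - 1\<close>, and \<open>v\<close> lies at level
    \<open>n\<close> or higher.\<close>
  have "card ((\<lambda>x. nat (d x)) ` (ground n - {v})) \<le> card (ground n - {v})"
    by (rule card_image_le) simp
  also have "\<dots> < n" using v(1) by (metis card_Diff1_less ground_simps(2,3))
  finally have "\<not> {..<n} \<subseteq> (\<lambda>x. nat (d x)) ` (ground n - {v})"
    using card_mono[of "(\<lambda>x. nat (d x)) ` (ground n - {v})" "{..<n}"] by auto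
  then obtain l where l: "l < n" "l \<notin> (\<lambda>x. nat (d x)) ` (ground n - {v})" by auto
  have gap: "d x \<noteq> int l" if "x \<in> ground n" for x
  proof (cases "x = v")
    case True
    then show ?thesis using l v by simp
  next
    case False
    then have "nat (d x) \<noteq> l" using l(2) that by auto
    then show ?thesis by auto
  qed
  \<comment> \<open>Since level \<open>l\<close> is empty, an arc from \<open>R\<close> to an
    element outside \<open>R\<close>, or to the sink, would descend by at least two levels.\<close>
  define R where "R = {x \<in> ground n. int l < d x}"
  have R: "R \<subseteq> ground n" "v \<in> R" "finite R" "0 \<notin> R" using v l by (auto simp: R_def ground_def)
  have rk: "rk I R = card (S j \<inter> R)" if j: "j < m" "0 < w j" for j
  proof (rule rk_closed[OF M])
    show Sj: "S j \<in> I" using P j by blast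
    have Sg: "S j \<subseteq> ground n" by (rule matroid_ground[OF M Sj])
    show "insert a (S j) \<notin> I" if a: "a \<in> R" "a \<notin> S j" for a
    proof
      assume "insert a (S j) \<in> I"
      then have "insert a (S j - {0}) \<in> I" by (rule matroid_subset[OF M]) auto
      then have "d a \<le> d 0 + 1" using valid_labelsD[OF val[OF j], of a 0] a R by auto
      then show False using a d by (auto simp: R_def)
    qed
    show "insert a (S j - {u}) \<notin> I" if a: "a \<in> R" "a \<notin> S j" and u: "u \<in> S j" "u \<notin> R" for a u
    proof
      assume "insert a (S j - {u}) \<in> I"
      then have "d a \<le> d u + 1" using valid_labelsD[OF val[OF j], of a u] a u R by auto
      moreover have "u \<in> ground n" using u Sg by auto
      then have "d u < int l" using u gap[of u] by (auto simp: R_def)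
      ultimately show False using a by (auto simp: R_def)
    qed
  qed
  have "(\<Sum>x\<in>R. y x) = (\<Sum>x\<in>R. \<Sum>j<m. w j * ivec (S j) x)"
    by (rule sum.cong) (use P(3) R in auto)
  also have "\<dots> = (\<Sum>j<m. \<Sum>x\<in>R. w j * ivec (S j) x)" by (rule sum.swap)
  also have "\<dots> = (\<Sum>j<m. w j * int (rk I R))"
  proof (rule sum.cong)
    fix j assume "j \<in> {..<m}"
    then have j: "j < m" by simp
    show "(\<Sum>x\<in>R. w j * ivec (S j) x) = w j * int (rk I R)"
    proof (cases "w j = 0")
      case False
      then have "0 < w j" using P(1)[OF j] by simp
      then show ?thesis
        unfolding rk[OF j \<open>0 < w j\<close>] sum_distrib_left[symmetric] sum_ivec[OF R(3,4)] by simp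
    qed simp
  qed simp
  also have "\<dots> = M * int (rk I R)" unfolding sum_distrib_right[symmetric] P(2) ..
  finally have 1: "(\<Sum>x\<in>R. y x) = M * int (rk I R)" .
  \<comment> \<open>Every set of positive weight meets \<open>R\<close> in \<open>rk I R\<close>
    elements, so the packing covers \<open>R\<close> as well as the mass \<open>M\<close> permits,
    and still \<open>v\<close> falls short of its target.\<close>
  have "(\<Sum>x\<in>R. y x) < (\<Sum>x\<in>R. Z x)"
    by (rule sum_strict_mono_ex1) (use R yZ v in auto)
  moreover have "Z 0 * int (rk I R) \<le> M * int (rk I R)" by (rule mult_right_mono[OF Z0]) simp
  ultimately have "dot n (rank_constraint I R) Z < 0"
    unfolding dot_rank_constraint[OF R(1)] using 1 by (simp add: mult.commute)
  then show ?thesis using valid_rank_constraint[OF M R(1)] by blast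
qed

section \<open>A weakest-precondition calculus with running time\<close>

text \<open>The existence of a terminating run is what the final statement asks for. Postconditions
  see the cost \<open>t\<close>, so time bounds compose together with correctness.\<close>

definition wp :: "nat \<Rightarrow> nat set set \<Rightarrow> com \<Rightarrow> state \<Rightarrow> (nat \<Rightarrow> state \<Rightarrow> bool) \<Rightarrow> bool" where
  "wp n I c s Q \<longleftrightarrow> (\<exists>t s'. exec n I c s t s' \<and> Q t s')"

inductive_cases exec_SkipE: "exec n I Skip s t s'"
inductive_cases exec_SetE: "exec n I (Set x i e) s t s'"
inductive_cases exec_QueryE: "exec n I (Query x a) s t s'"
inductive_cases exec_SeqE: "exec n I (Seq c1 c2) s t s'"
inductive_cases exec_CondE: "exec n I (Cond b c1 c2) s t s'"

lemma wp_Skip: "wp n I Skip s Q = Q 1 s"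
  unfolding wp_def using exec.Skip[of n I s] by (auto elim: exec_SkipE)

lemma wp_Set:
  "wp n I (Set x i e) s Q = Q (1 + acost i s + acost e s) (update x (aval i s) (aval e s) s)"
  unfolding wp_def plus_1_eq_Suc add_Suc by (blast elim: exec_SetE intro: exec.Set[unfolded plus_1_eq_Suc add_Suc])

lemma wp_Query:
  "wp n I (Query x a) s Q = Q 1 (update x 0 (if query_set n a s \<in> I then 1 else 0) s)"
  unfolding wp_def One_nat_def by (blast elim: exec_QueryE intro: exec.Query[unfolded One_nat_def])

lemma wp_Seq:
  "wp n I (Seq c1 c2) s Q = wp n I c1 s (\<lambda>t1 s1. wp n I c2 s1 (\<lambda>t2 s2. Q (t1 + t2) s2))"
  unfolding wp_def by (blast elim: exec_SeqE intro: exec.Seq)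

lemma wp_Cond:
  "wp n I (Cond b c1 c2) s Q =
     (if bval b s then wp n I c1 s (\<lambda>t. Q (1 + bcost b s + t))
      else wp n I c2 s (\<lambda>t. Q (1 + bcost b s + t)))"
  unfolding wp_def plus_1_eq_Suc add_Suc
  by (auto elim!: exec_CondE) (blast intro: exec.CondTrue[unfolded plus_1_eq_Suc add_Suc] exec.CondFalse[unfolded plus_1_eq_Suc add_Suc])+

lemmas wp_simps = wp_Skip wp_Set wp_Query wp_Seq wp_Cond

lemma wp_mono: "wp n I c s Q \<Longrightarrow> (\<And>t s'. Q t s' \<Longrightarrow> Q' t s') \<Longrightarrow> wp n I c s Q'"
  unfolding wp_def by blast

section \<open>Frames: the variables that a command may change\<close>

primrec mods :: "com \<Rightarrow> vname set" where
  "mods Skip = {}"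
| "mods (Set x i e) = {x}"
| "mods (Query x a) = {x}"
| "mods (Seq c1 c2) = mods c1 \<union> mods c2"
| "mods (Cond b c1 c2) = mods c1 \<union> mods c2"
| "mods (While b c) = mods c"

definition frame :: "vname set \<Rightarrow> state \<Rightarrow> state \<Rightarrow> bool" where
  "frame X s s' \<longleftrightarrow> (\<forall>x. x \<notin> X \<longrightarrow> s' x = s x)"

lemma frameD: "frame X s s' \<Longrightarrow> x \<notin> X \<Longrightarrow> s' x = s x"
  by (simp add: frame_def)

lemma exec_frame: "exec n I c s t s' \<Longrightarrow> frame (mods c) s s'"
  by (induction rule: exec.induct) (auto simp: update_def frame_def)

lemma wp_frame:
  "wp n I c s Q \<Longrightarrow> (\<And>t s'. Q t s' \<Longrightarrow> frame (mods c) s s' \<Longrightarrow> Q' t s') \<Longrightarrow> wp n I c s Q'"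
  unfolding wp_def using exec_frame by blast

text \<open>The index \<open>k\<close> of the invariant is a strictly decreasing variant. The bound
  \<open>T\<close> on the body is the same for every \<open>k\<close>, so the invariant has to carry
  whatever limits the cost, such as the number of blocks. The frame relative to the initial state
  spares the invariant all unmodified variables.\<close>

lemma wp_While:
  fixes inv :: "nat \<Rightarrow> state \<Rightarrow> bool"
  assumes inv: "inv k s"
    and body: "\<And>k s1. inv k s1 \<Longrightarrow> bval b s1 \<Longrightarrow> frame (mods c) s s1 \<Longrightarrow>
       wp n I c s1 (\<lambda>t s'. t \<le> T \<and> (\<exists>k'<k. inv k' s'))"
    and cost: "\<And>s1. bcost b s1 \<le> B"
  shows "wp n I (While b c) s
    (\<lambda>t s'. t \<le> k * (T + B + 1) + B + 1 \<and> (\<exists>k'\<le>k. inv k' s') \<and> \<not> bval b s' \<and> frame (mods c) s s')"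
proof -
  have "frame (mods c) s s1 \<Longrightarrow> inv k s1 \<Longrightarrow> \<exists>t s'. exec n I (While b c) s1 t s' \<and>
      t \<le> k * (T + B + 1) + B + 1 \<and> (\<exists>k'\<le>k. inv k' s') \<and> \<not> bval b s'" for s1 k
  proof (induction k arbitrary: s1 rule: less_induct)
    case (less k s1)
    show ?case
    proof (cases "bval b s1")
      case False
      then show ?thesis using less cost[of s1] exec.WhileFalse[OF False, of n I c]
        by (intro exI[of _ "1 + bcost b s1"] exI[of _ s1]) auto
    next
      case True
      obtain t1 s2 k' where 1: "exec n I c s1 t1 s2" "t1 \<le> T" "k' < k" "inv k' s2"
        using body[OF less(3) True less(2)] unfolding wp_def by blast
      have "frame (mods c) s s2"
        using exec_frame[OF 1(1)] less(2) by (simp add: frame_def)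
      from less(1)[OF 1(3) this 1(4)] obtain t2 s3 k'' where
        2: "exec n I (While b c) s2 t2 s3" "t2 \<le> k' * (T + B + 1) + B + 1" "k''\<le>k'" "inv k'' s3"
           "\<not> bval b s3" by blast
      have "1 + bcost b s1 + t1 + t2 \<le> (k' + 1) * (T + B + 1) + B + 1"
        using 1(2) 2(2) cost[of s1] by simp
      also have "\<dots> \<le> k * (T + B + 1) + B + 1"
        using 1(3) by (intro add_right_mono mult_right_mono) auto
      finally show ?thesis
        using exec.WhileTrue[OF True 1(1) 2(1)] 2(4-5) le_trans[OF 2(3) less_imp_le[OF 1(3)]]
        by (intro exI[of _ "1 + bcost b s1 + t1 + t2"] exI[of _ s3]) auto
    qed
  qed
  from this[of s k] inv obtain t s' where *: "exec n I (While b c) s t s'"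
      "t \<le> k * (T + B + 1) + B + 1" "\<exists>k'\<le>k. inv k' s'" "\<not> bval b s'"
    by (auto simp: frame_def)
  with exec_frame[OF *(1)] show ?thesis unfolding wp_def by auto
qed

section \<open>Counting loops\<close>

abbreviation Val :: "vname \<Rightarrow> aexp" where "Val x \<equiv> Get x (Const 0)"

definition For :: "vname \<Rightarrow> nat \<Rightarrow> com \<Rightarrow> com" where
  "For x a c = Seq (Set x (Const 0) (Const (int a)))
     (While (Neg (Less (Val ''n'') (Val x)))
        (Seq c (Set x (Const 0) (Plus (Val x) (Const 1)))))"

lemma mods_For [simp]: "mods (For x a c) = insert x (mods c)"
  by (auto simp: For_def)

text \<open>The invariant for index \<open>i\<close> refers to the state in which \<open>x\<close>
  already holds \<open>i\<close>, that is, to the state at the loop test. The summands 20 absorb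
  tests and increments.\<close>

lemma wp_For:
  fixes inv :: "nat \<Rightarrow> state \<Rightarrow> bool"
  assumes n: "s ''n'' 0 = int n" and x: "x \<notin> mods c" "x \<noteq> ''n''" and nm: "''n'' \<notin> mods c"
    and a: "a \<le> n + 1"
    and init: "inv a (update x 0 (int a) s)"
    and step: "\<And>i s1. a \<le> i \<Longrightarrow> i \<le> n \<Longrightarrow> s1 x 0 = int i \<Longrightarrow> frame (insert x (mods c)) s s1 \<Longrightarrow>
       inv i s1 \<Longrightarrow> wp n I c s1 (\<lambda>t s'. t \<le> T \<and> inv (i + 1) (update x 0 (int (i + 1)) s'))"
  shows "wp n I (For x a c) s
    (\<lambda>t s'. t \<le> (n + 1) * (T + 20) + 20 \<and> inv (n + 1) s' \<and> frame (insert x (mods c)) s s')"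
proof -
  let ?s0 = "update x 0 (int a) s"
  define inv' where "inv' k s1 \<longleftrightarrow> (\<exists>i. a \<le> i \<and> i + k = n + 1 \<and> s1 x 0 = int i \<and> inv i s1)" for k s1
  have fr0: "frame (insert x (mods c)) s s1" if "frame (mods (Seq c (Set x (Const 0) (Plus (Val x) (Const 1))))) ?s0 s1" for s1
    using that by (auto simp: frame_def update_def)
  have "wp n I (While (Neg (Less (Val ''n'') (Val x))) (Seq c (Set x (Const 0) (Plus (Val x) (Const 1))))) ?s0
    (\<lambda>t s'. t \<le> (n+1-a) * ((T + 6) + 6 + 1) + 6 + 1 \<and> (\<exists>k'\<le>n+1-a. inv' k' s') \<and> \<not> bval (Neg (Less (Val ''n'') (Val x))) s' \<and>
       frame (mods (Seq c (Set x (Const 0) (Plus (Val x) (Const 1))))) ?s0 s')"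
  proof (rule wp_While)
    show "inv' (n + 1 - a) ?s0" unfolding inv'_def using a init by (intro exI[of _ a]) (auto simp: update_def)
    fix k s1 assume 1: "inv' k s1" and 2: "bval (Neg (Less (Val ''n'') (Val x))) s1"
      and 3: "frame (mods (Seq c (Set x (Const 0) (Plus (Val x) (Const 1))))) ?s0 s1"
    from 1 obtain i where i: "a \<le> i" "i + k = n + 1" "s1 x 0 = int i" "inv i s1"
      unfolding inv'_def by auto
    have fr: "frame (insert x (mods c)) s s1" by (rule fr0[OF 3])
    have "i \<le> n" using 2 i(3) frameD[OF fr, of "''n''"] n x nm by auto
    show "wp n I (Seq c (Set x (Const 0) (Plus (Val x) (Const 1)))) s1
          (\<lambda>t s'. t \<le> T + 6 \<and> (\<exists>k'<k. inv' k' s'))"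
      unfolding wp_Seq
    proof (rule wp_frame[OF step[OF i(1) \<open>i \<le> n\<close> i(3) fr i(4)]])
      fix t s' assume 4: "t \<le> T \<and> inv (i + 1) (update x 0 (int (i + 1)) s')" and 5: "frame (mods c) s1 s'"
      have "s' x 0 = int i" using frameD[OF 5 x(1)] i(3) by simp
      have "inv' (k - 1) (update x 0 (int (i + 1)) s')"
        unfolding inv'_def using 4 i \<open>i \<le> n\<close> by (intro exI[of _ "i + 1"]) (simp add: update_def)
      moreover have "k - 1 < k" using i \<open>i \<le> n\<close> by simp
      ultimately have "\<exists>k'<k. inv' k' (update x 0 (int (i + 1)) s')" by blast
      then show "wp n I (Set x (Const 0) (Plus (Val x) (Const 1))) s'
         (\<lambda>t2 s2. t + t2 \<le> T + 6 \<and> (\<exists>k'<k. inv' k' s2))"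
        using 4 \<open>s' x 0 = int i\<close> unfolding wp_simps by (simp add: add.commute)
    qed
  qed simp
  then have "wp n I (While (Neg (Less (Val ''n'') (Val x))) (Seq c (Set x (Const 0) (Plus (Val x) (Const 1))))) ?s0
    (\<lambda>t s'. 3 + t \<le> (n + 1) * (T + 20) + 20 \<and> inv (n + 1) s' \<and> frame (insert x (mods c)) s s')"
  proof (rule wp_mono)
    fix t s'
    assume A: "t \<le> (n+1-a) * ((T + 6) + 6 + 1) + 6 + 1 \<and> (\<exists>k'\<le>n+1-a. inv' k' s') \<and> \<not> bval (Neg (Less (Val ''n'') (Val x))) s' \<and>
       frame (mods (Seq c (Set x (Const 0) (Plus (Val x) (Const 1))))) ?s0 s'"
    then obtain k i where i: "a \<le> i" "i + k = n + 1" "s' x 0 = int i" "inv i s'"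
      unfolding inv'_def by auto
    have fr: "frame (insert x (mods c)) s s'" using A fr0 by blast
    have "i = n + 1" using A i frameD[OF fr, of "''n''"] n x nm by auto
    moreover have "(n+1-a) * ((T + 6) + 6 + 1) \<le> (n+1) * (T + 20)"
      by (intro mult_mono) auto
    ultimately show "3 + t \<le> (n + 1) * (T + 20) + 20 \<and> inv (n + 1) s' \<and> frame (insert x (mods c)) s s'"
      using A fr i by auto
  qed
  then show ?thesis unfolding For_def wp_Seq wp_Set by (simp add: numeral_eq_Suc)
qed

section \<open>The decomposition program\<close>

text \<open>
  The array \<open>A\<close> holds the weighted sets in blocks of \<open>n + 1\<close> cells: the weight, followed by the
  characteristic vector.
\<close>

abbreviation seq :: "com \<Rightarrow> com \<Rightarrow> com" (infixr ";;" 60) where "c1 ;; c2 \<equiv> Seq c1 c2"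
abbreviation assign :: "vname \<Rightarrow> aexp \<Rightarrow> com" where "assign x e \<equiv> Set x (Const 0) e"

definition off :: "nat \<Rightarrow> nat \<Rightarrow> int" where "off n i = int i * (int n + 1)"

lemma off_0 [simp]: "off n 0 = 0" by (simp add: off_def)

lemma off_Suc: "off n (Suc i) = off n i + int n + 1" by (simp add: off_def algebra_simps)

lemma off_mono: "i < j \<Longrightarrow> off n i + int n < off n j"
proof -
  assume "i < j"
  then have "(int i + 1) * (int n + 1) \<le> int j * (int n + 1)" by (intro mult_right_mono) auto
  then show ?thesis by (simp add: off_def algebra_simps)
qed

lemma off_less_iff: "off n i < off n j \<longleftrightarrow> i < j"
  unfolding off_def by simp

lemma off_eq_iff:
  assumes "x \<le> n" "x' \<le> n"
  shows "off n i + int x = off n j + int x' \<longleftrightarrow> i = j \<and> x = x'"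
  using off_mono[of i j n] off_mono[of j i n] assms by (cases i j rule: linorder_cases) auto

lemma off_eq_iff':
  assumes "x \<le> n"
  shows "off n i + int x = off n j \<longleftrightarrow> i = j \<and> x = 0" "off n j = off n i + int x \<longleftrightarrow> i = j \<and> x = 0"
    "off n i = off n j \<longleftrightarrow> i = j"
  using off_eq_iff[OF assms, of 0 i j] off_eq_iff[of 0 n 0 i j] by auto

definition rep :: "nat \<Rightarrow> (int \<Rightarrow> int) \<Rightarrow> nat \<Rightarrow> (nat \<Rightarrow> nat set) \<Rightarrow> (nat \<Rightarrow> int) \<Rightarrow> bool" where
  "rep n A m S w \<longleftrightarrow>
     (\<forall>i<m. A (off n i) = w i \<and> S i = {x \<in> ground n. A (off n i + int x) \<noteq> 0})"

section \<open>Search for an admissible exchange\<close>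

definition admissible ::
  "nat set set \<Rightarrow> (nat \<Rightarrow> nat set) \<Rightarrow> (nat \<Rightarrow> int) \<Rightarrow> (nat \<Rightarrow> int) \<Rightarrow> int \<Rightarrow> nat \<Rightarrow> nat \<Rightarrow> nat \<Rightarrow> bool" where
  "admissible I S w d dl v i u \<longleftrightarrow>
     dl \<le> w i \<and> v \<notin> S i \<and> u \<in> insert 0 (S i) \<and> d u + 1 = d v \<and> insert v (S i - {u}) \<in> I"

text \<open>The same code serves the sink: cell 0 lies outside the ground set, so for
  \<open>u = 0\<close> clearing it leaves the query for \<open>S + v\<close>.\<close>

definition test_exchange :: com where
  "test_exchange =
     For ''w'' 1 (Set ''Q'' (Val ''w'') (Get ''A'' (Plus (Val ''p'') (Val ''w'')))) ;;
     Set ''Q'' (Val ''v'') (Const 1) ;;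
     Set ''Q'' (Val ''u'') (Const 0) ;;
     Query ''r'' ''Q'' ;;
     Cond (Eq (Val ''r'') (Const 0)) Skip
       (assign ''fnd'' (Const 1) ;; assign ''fp'' (Val ''p'') ;; assign ''fu'' (Val ''u''))"

text \<open>The third test expresses \<open>u \<in> insert 0 S\<close>: for \<open>u = 0\<close> the
  cell read is the weight of the block, which is nonzero as soon as the first test holds and
  \<open>dl\<close> is positive.\<close>

definition scan_guard :: bexp where
  "scan_guard =
     Conj (Neg (Less (Get ''A'' (Val ''p'')) (Val ''dl'')))
     (Conj (Eq (Get ''A'' (Plus (Val ''p'') (Val ''v''))) (Const 0))
     (Conj (Neg (Eq (Get ''A'' (Plus (Val ''p'') (Val ''u''))) (Const 0)))
       (Eq (Plus (Get ''d'' (Val ''u'')) (Const 1)) (Get ''d'' (Val ''v'')))))"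

definition scan :: com where
  "scan = Cond scan_guard test_exchange Skip"

text \<open>There is no early exit: the loops have a fixed length, and the last hit is kept.\<close>

definition find :: com where
  "find = assign ''fnd'' (Const 0) ;; assign ''p'' (Const 0) ;;
     While (Less (Val ''p'') (Val ''L''))
       (For ''u'' 0 scan ;; assign ''p'' (Plus (Plus (Val ''p'') (Val ''n'')) (Const 1)))"

lemma mods_test_exchange [simp]: "mods test_exchange = {''w'', ''Q'', ''r'', ''fnd'', ''fp'', ''fu''}"
  by (auto simp: test_exchange_def)

lemma mods_scan [simp]: "mods scan = {''w'', ''Q'', ''r'', ''fnd'', ''fp'', ''fu''}"
  by (auto simp: scan_def)

lemma mods_find [simp]: "mods find = {''w'', ''Q'', ''r'', ''fnd'', ''fp'', ''fu'', ''p'', ''u''}"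
  by (auto simp: find_def)

lemma wp_test_exchange:
  assumes n: "s ''n'' 0 = int n" and p: "s ''p'' 0 = off n i"
    and v: "s ''v'' 0 = int v" "v \<in> ground n" and u: "s ''u'' 0 = int u" "u \<le> n" "u \<noteq> v"
    and T: "T = {x \<in> ground n. s ''A'' (off n i + int x) \<noteq> 0}"
  shows "wp n I test_exchange s (\<lambda>t s'. t \<le> 100 * (n + 1) \<and>
    (if insert v (T - {u}) \<in> I then s' ''fnd'' 0 = 1 \<and> s' ''fp'' 0 = off n i \<and> s' ''fu'' 0 = int u
     else s' ''fnd'' = s ''fnd'' \<and> s' ''fp'' = s ''fp'' \<and> s' ''fu'' = s ''fu''))"
proof -
  let ?c = "Set ''Q'' (Val ''w'') (Get ''A'' (Plus (Val ''p'') (Val ''w'')))"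
  define inv where "inv j s1 \<longleftrightarrow> (\<forall>x. 1 \<le> x \<and> x < j \<longrightarrow> s1 ''Q'' (int x) = s ''A'' (off n i + int x))"
    for j :: nat and s1 :: state
  have "wp n I (For ''w'' 1 ?c) s
    (\<lambda>t s'. t \<le> (n + 1) * (10 + 20) + 20 \<and> inv (n + 1) s' \<and> frame (insert ''w'' (mods ?c)) s s')"
  proof (rule wp_For[where inv = inv])
    fix j s1 assume j: "1 \<le> j" "j \<le> n" "s1 ''w'' 0 = int j"
      and fr: "frame (insert ''w'' (mods ?c)) s s1" and inv: "inv j s1"
    have "s1 ''A'' = s ''A''" "s1 ''p'' = s ''p''" using fr by (auto simp: frame_def)
    then show "wp n I ?c s1 (\<lambda>t s'. t \<le> 10 \<and> inv (j + 1) (update ''w'' 0 (int (j + 1)) s'))"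
      using inv j p unfolding inv_def by (auto simp: wp_simps update_def less_Suc_eq)
  qed (use n in \<open>auto simp: inv_def\<close>)
  then show ?thesis unfolding test_exchange_def wp_Seq
  proof (rule wp_mono, elim conjE)
    fix t s1 assume t: "t \<le> (n + 1) * (10 + 20) + 20" and inv: "inv (n + 1) s1"
      and fr: "frame (insert ''w'' (mods ?c)) s s1"
    have eq: "s1 z = s z" if "z \<notin> {''w'', ''Q''}" for z using fr that by (auto simp: frame_def)
    let ?s2 = "update ''Q'' (int u) 0 (update ''Q'' (int v) 1 s1)"
    have Q: "query_set n ''Q'' ?s2 = insert v (T - {u})"
      using v u inv by (auto simp: query_set_def update_def T inv_def ground_def)
    show "wp n I (Set ''Q'' (Val ''v'') (Const 1)) s1 (\<lambda>t1 s1.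
      wp n I (Set ''Q'' (Val ''u'') (Const 0)) s1 (\<lambda>t1a s1.
      wp n I (Query ''r'' ''Q'') s1 (\<lambda>t1b s1.
      wp n I (Cond (Eq (Val ''r'') (Const 0)) Skip
       (assign ''fnd'' (Const 1) ;; assign ''fp'' (Val ''p'') ;; assign ''fu'' (Val ''u''))) s1
       (\<lambda>t2 s2. t + (t1 + (t1a + (t1b + t2))) \<le> 100 * (n + 1) \<and>
    (if insert v (T - {u}) \<in> I then s2 ''fnd'' 0 = 1 \<and> s2 ''fp'' 0 = off n i \<and> s2 ''fu'' 0 = int u
     else s2 ''fnd'' = s ''fnd'' \<and> s2 ''fp'' = s ''fp'' \<and> s2 ''fu'' = s ''fu'')))))"
      using t v u p Q by (simp add: wp_simps eq) (simp add: update_def eq)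
  qed
qed

lemma wp_scan:
  assumes n: "s ''n'' 0 = int n" and p: "s ''p'' 0 = off n i"
    and v: "s ''v'' 0 = int v" "v \<in> ground n" and u: "s ''u'' 0 = int u" "u \<le> n"
    and dl: "s ''dl'' 0 = dl" "0 < dl" and d: "d = (\<lambda>x. s ''d'' (int x))"
    and rep: "rep n (s ''A'') m S w" "i < m"
  shows "wp n I scan s (\<lambda>t s'. t \<le> 200 * (n + 1) \<and>
    (if admissible I S w d dl v i u then s' ''fnd'' 0 = 1 \<and> s' ''fp'' 0 = off n i \<and> s' ''fu'' 0 = int u
     else s' ''fnd'' = s ''fnd'' \<and> s' ''fp'' = s ''fp'' \<and> s' ''fu'' = s ''fu''))"
proof -
  have A: "s ''A'' (off n i) = w i" "S i = {x \<in> ground n. s ''A'' (off n i + int x) \<noteq> 0}"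
    using rep by (auto simp: rep_def)
  have cost: "bcost scan_guard s \<le> 60" by (simp add: scan_guard_def)
  have guard: "bval scan_guard s \<longleftrightarrow> dl \<le> w i \<and> v \<notin> S i \<and> u \<in> insert 0 (S i) \<and> d u + 1 = d v"
    (is "_ \<longleftrightarrow> ?g")
  proof -
    have "v \<notin> S i \<longleftrightarrow> s ''A'' (off n i + int v) = 0" using A(2) v(2) by blast
    moreover have "u \<in> insert 0 (S i) \<longleftrightarrow> s ''A'' (off n i + int u) \<noteq> 0" if "dl \<le> w i"
    proof (cases "u = 0")
      case True
      then show ?thesis using that A(1) dl(2) by simp
    next
      case False
      then have "u \<in> ground n" using u(2) by (simp add: ground_def)
      then show ?thesis using A(2) False by blast
    qed
    ultimately show ?thesis unfolding scan_guard_def using p v(1) u(1) dl(1) A(1) by (auto simp: d)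
  qed
  show ?thesis
  proof (cases ?g)
    case True
    have uv: "u \<noteq> v" using True v by (auto simp: ground_def)
    have b: "bval scan_guard s" using guard True by blast
    show ?thesis unfolding scan_def wp_Cond if_P[OF b]
      by (rule wp_mono[OF wp_test_exchange[OF n p v u uv A(2)]])
        (use True cost in \<open>simp add: admissible_def\<close>)
  next
    case False
    then have b: "\<not> bval scan_guard s" using guard by blast
    have "\<not> admissible I S w d dl v i u" using False unfolding admissible_def by blast
    then show ?thesis unfolding scan_def wp_Cond if_not_P[OF b] wp_Skip using cost by simp
  qed
qed


lemma square_bounds: "n + 1 \<le> (n + 1)\<^sup>2" "1 \<le> (n + 1)\<^sup>2" for n :: nat
  by (simp_all add: power2_eq_square)

lemma wp_find:
  assumes n: "s ''n'' 0 = int n" and L: "s ''L'' 0 = off n m"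
    and v: "s ''v'' 0 = int v" "v \<in> ground n"
    and dl: "s ''dl'' 0 = dl" "0 < dl" and d: "d = (\<lambda>x. s ''d'' (int x))"
    and rep: "rep n (s ''A'') m S w"
  shows "wp n I find s (\<lambda>t s'. t \<le> (m + 1) * (400 * (n + 1)\<^sup>2) \<and>
    (s' ''fnd'' 0 = 1 \<and> (\<exists>i u. i < m \<and> u \<le> n \<and> s' ''fp'' 0 = off n i \<and> s' ''fu'' 0 = int u \<and>
        admissible I S w d dl v i u) \<or>
     s' ''fnd'' 0 = 0 \<and> (\<forall>i<m. \<forall>u. \<not> admissible I S w d dl v i u)))"
proof -
  define found where "found s1 P \<longleftrightarrow>
    s1 ''fnd'' 0 = 1 \<and> (\<exists>i u. i < m \<and> u \<le> n \<and> s1 ''fp'' 0 = off n i \<and> s1 ''fu'' 0 = int u \<and>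
        admissible I S w d dl v i u) \<or>
    s1 ''fnd'' 0 = 0 \<and> (\<forall>i u. P i u \<longrightarrow> \<not> admissible I S w d dl v i u)"
    for s1 :: state and P :: "nat \<Rightarrow> nat \<Rightarrow> bool"
  define inv where "inv k s1 \<longleftrightarrow> (\<exists>i. i + k = m \<and> s1 ''p'' 0 = off n i \<and> found s1 (\<lambda>a u. a < i))"
    for k s1
  let ?body = "For ''u'' 0 scan ;; assign ''p'' (Plus (Plus (Val ''p'') (Val ''n'')) (Const 1))"
  let ?s0 = "update ''p'' 0 0 (update ''fnd'' 0 0 s)"
  \<comment> \<open>Only \<open>u \<le> n\<close> is scanned, but membership in
    \<open>insert 0 (S i)\<close> implies this bound, so a scan without a hit excludes every
    \<open>u\<close>.\<close>
  have le_n: "u \<le> n" if "admissible I S w d dl v i u" "i < m" for i u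
    using that rep by (auto simp: admissible_def rep_def ground_def)
  have "wp n I (While (Less (Val ''p'') (Val ''L'')) ?body) ?s0
     (\<lambda>t s'. t \<le> m * (((n + 1) * (200 * (n + 1) + 20) + 40) + 5 + 1) + 5 + 1 \<and>
       (\<exists>k'\<le>m. inv k' s') \<and> \<not> bval (Less (Val ''p'') (Val ''L'')) s' \<and> frame (mods ?body) ?s0 s')"
  proof (rule wp_While)
    show "inv m ?s0" unfolding inv_def found_def by (intro exI[of _ 0]) (simp add: update_def)
    fix k s1 assume "inv k s1" and b: "bval (Less (Val ''p'') (Val ''L'')) s1"
      and fr0: "frame (mods ?body) ?s0 s1"
    then obtain i where i: "i + k = m" "s1 ''p'' 0 = off n i" "found s1 (\<lambda>a u. a < i)"
      unfolding inv_def by auto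
    have eq: "s1 z = s z" if "z \<notin> {''w'', ''Q'', ''r'', ''fnd'', ''fp'', ''fu'', ''p'', ''u''}" for z
      using fr0 that by (auto simp: frame_def update_def)
    have "i < m" using b i(2) L by (simp add: eq off_less_iff)
    show "wp n I ?body s1 (\<lambda>t s'. t \<le> (n + 1) * (200 * (n + 1) + 20) + 40 \<and> (\<exists>k'<k. inv k' s'))"
      unfolding wp_Seq
    proof (rule wp_mono[OF wp_For[where inv = "\<lambda>j s1. found s1 (\<lambda>a u. a < i \<or> a = i \<and> u < j)" and T = "200 * (n + 1)"]])
      show "s1 ''n'' 0 = int n" using n by (simp add: eq)
      show "found (update ''u'' 0 (int 0) s1) (\<lambda>a u. a < i \<or> a = i \<and> u < 0)"
        using i(3) by (simp add: found_def update_def)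
      fix j s2 assume j: "j \<le> n" "s2 ''u'' 0 = int j" and fr: "frame (insert ''u'' (mods scan)) s1 s2"
        and fd: "found s2 (\<lambda>a u. a < i \<or> a = i \<and> u < j)"
      have eq2: "s2 z = s z" if "z \<notin> {''w'', ''Q'', ''r'', ''fnd'', ''fp'', ''fu'', ''p'', ''u''}" for z
        using fr that eq by (auto simp: frame_def)
      have p2: "s2 ''p'' 0 = off n i" using fr i(2) by (simp add: frame_def)
      show "wp n I scan s2 (\<lambda>t s'. t \<le> 200 * (n + 1) \<and>
         found (update ''u'' 0 (int (j + 1)) s') (\<lambda>a u. a < i \<or> a = i \<and> u < j + 1))"
      proof (rule wp_mono[OF wp_scan[where i = i and v = v and u = j and dl = dl and d = d and m = m and S = S and w = w]])
        fix t s'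
        assume *: "t \<le> 200 * (n + 1) \<and>
          (if admissible I S w d dl v i j then s' ''fnd'' 0 = 1 \<and> s' ''fp'' 0 = off n i \<and> s' ''fu'' 0 = int j
           else s' ''fnd'' = s2 ''fnd'' \<and> s' ''fp'' = s2 ''fp'' \<and> s' ''fu'' = s2 ''fu'')"
        have "found s' (\<lambda>a u. a < i \<or> a = i \<and> u < j + 1)"
        proof (cases "admissible I S w d dl v i j")
          case True
          then show ?thesis using * \<open>i < m\<close> j unfolding found_def by auto
        next
          case False
          then have "s' ''fnd'' = s2 ''fnd''" "s' ''fp'' = s2 ''fp''" "s' ''fu'' = s2 ''fu''" using * by auto
          moreover have "a = i \<and> u < j + 1 \<longleftrightarrow> a = i \<and> u < j \<or> a = i \<and> u = j" for a u by auto
          ultimately show ?thesis using fd False unfolding found_def by auto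
        qed
        then show "t \<le> 200 * (n + 1) \<and>
          found (update ''u'' 0 (int (j + 1)) s') (\<lambda>a u. a < i \<or> a = i \<and> u < j + 1)"
          using * by (simp add: found_def update_def)
      qed (use j p2 v n dl d rep \<open>i < m\<close> in \<open>simp_all add: eq2\<close>)
    next
      fix t s2
      assume *: "t \<le> (n + 1) * (200 * (n + 1) + 20) + 20 \<and>
        found s2 (\<lambda>a u. a < i \<or> a = i \<and> u < n + 1) \<and> frame (insert ''u'' (mods scan)) s1 s2"
      have p2: "s2 ''p'' 0 = off n i" "s2 ''n'' 0 = int n"
        using * i(2) n by (auto simp: frame_def eq)
      have fd: "found s2 (\<lambda>a u. a < Suc i)"
      proof -
        have "\<not> admissible I S w d dl v a u"
          if no: "\<forall>a u. a < i \<or> a = i \<and> u < n + 1 \<longrightarrow> \<not> admissible I S w d dl v a u" and "a < Suc i" for a u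
        proof
          assume adm: "admissible I S w d dl v a u"
          then have "u < n + 1" using le_n[OF adm] that(2) \<open>i < m\<close> by simp
          then show False using no adm that(2) less_Suc_eq by blast
        qed
        then show ?thesis using * unfolding found_def by blast
      qed
      have "inv (k - 1) (update ''p'' 0 (off n (Suc i)) s2)"
        unfolding inv_def using fd i \<open>i < m\<close> by (intro exI[of _ "Suc i"]) (auto simp: found_def update_def)
      moreover have "k - 1 < k" using i \<open>i < m\<close> by simp
      ultimately have "\<exists>k'<k. inv k' (update ''p'' 0 (off n (Suc i)) s2)" by blast
      then show "wp n I (assign ''p'' (Plus (Plus (Val ''p'') (Val ''n'')) (Const 1))) s2
        (\<lambda>t2 s2. t + t2 \<le> (n + 1) * (200 * (n + 1) + 20) + 40 \<and> (\<exists>k'<k. inv k' s2))"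
        using * p2 by (simp add: wp_simps off_Suc)
    qed simp_all
  qed simp
  then have "wp n I (While (Less (Val ''p'') (Val ''L'')) ?body) ?s0
     (\<lambda>t s'. 6 + t \<le> (m + 1) * (400 * (n + 1)\<^sup>2) \<and> found s' (\<lambda>a u. a < m))"
  proof (rule wp_mono, elim conjE exE)
    fix t s' k
    assume t: "t \<le> m * (((n + 1) * (200 * (n + 1) + 20) + 40) + 5 + 1) + 5 + 1"
      and k: "k \<le> m" "inv k s'" and b: "\<not> bval (Less (Val ''p'') (Val ''L'')) s'" and fr: "frame (mods ?body) ?s0 s'"
    have "s' ''L'' = s ''L''" using fr by (auto simp: frame_def update_def)
    then have "found s' (\<lambda>a u. a < m)" using b k(2) L unfolding inv_def by (auto simp: off_less_iff)
    moreover have "((n + 1) * (200 * (n + 1) + 20) + 40) + 5 + 1 \<le> 400 * (n + 1)\<^sup>2"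
      using square_bounds[of n] by (simp add: power2_eq_square algebra_simps)
    then have "m * (((n + 1) * (200 * (n + 1) + 20) + 40) + 5 + 1) \<le> m * (400 * (n + 1)\<^sup>2)"
      by (rule mult_left_mono) simp
    then have "t \<le> m * (400 * (n + 1)\<^sup>2) + 5 + 1" using t by (meson add_le_mono1 le_trans)
    then have "6 + t \<le> (m + 1) * (400 * (n + 1)\<^sup>2)"
      unfolding add_mult_distrib using square_bounds(2)[of n] by linarith
    ultimately show "6 + t \<le> (m + 1) * (400 * (n + 1)\<^sup>2) \<and> found s' (\<lambda>a u. a < m)" by simp
  qed
  then show ?thesis unfolding find_def wp_Seq wp_Set aval.simps acost.simps
    by (rule wp_mono) (auto simp: found_def)
qed

section \<open>Pushing, relabelling and selection of an active element\<close>

lemma update_apply: "update x i k s z = (if z = x then (s x)(i := k) else s z)"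
  by (simp add: update_def)

text \<open>The order matters: for \<open>u = 0\<close> the second assignment clears the weight cell
  of block \<open>i\<close>, and the last one restores it to \<open>dl\<close>.\<close>

definition edit_blocks :: com where
  "edit_blocks =
     Set ''A'' (Val ''L'') (Minus (Get ''A'' (Val ''L'')) (Val ''dl'')) ;;
     Set ''A'' (Plus (Val ''fp'') (Val ''fu'')) (Const 0) ;;
     Set ''A'' (Plus (Val ''fp'') (Val ''v'')) (Const 1) ;;
     Set ''A'' (Val ''fp'') (Val ''dl'')"

definition push :: com where
  "push =
     For ''w'' 0 (Set ''A'' (Plus (Val ''L'') (Val ''w'')) (Get ''A'' (Plus (Val ''fp'') (Val ''w'')))) ;;
     edit_blocks ;;
     assign ''L'' (Plus (Plus (Val ''L'') (Val ''n'')) (Const 1)) ;;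
     Set ''y'' (Val ''v'') (Plus (Get ''y'' (Val ''v'')) (Val ''dl'')) ;;
     Set ''y'' (Val ''fu'') (Minus (Get ''y'' (Val ''fu'')) (Val ''dl''))"

lemma mods_edit_blocks [simp]: "mods edit_blocks = {''A''}"
  by (simp add: edit_blocks_def)

lemma wp_edit_blocks:
  "wp n I edit_blocks s (\<lambda>t s'. t \<le> 60 \<and>
     s' ''A'' = (s ''A'')(s ''L'' 0 := s ''A'' (s ''L'' 0) - s ''dl'' 0, s ''fp'' 0 + s ''fu'' 0 := 0,
       s ''fp'' 0 + s ''v'' 0 := 1, s ''fp'' 0 := s ''dl'' 0))"
  by (simp add: edit_blocks_def wp_simps update_apply)

definition relabel :: com where
  "relabel =
     Set ''d'' (Val ''v'') (Plus (Get ''d'' (Val ''v'')) (Const 1)) ;;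
     Cond (Less (Get ''d'' (Val ''v'')) (Val ''n'')) Skip
       (assign ''run'' (Const 0) ;; assign ''fail'' (Const 1))"

definition find_active :: com where
  "find_active = assign ''v'' (Const 0) ;;
     For ''w'' 1 (Cond (Less (Get ''Z'' (Val ''w'')) (Plus (Get ''y'' (Val ''w'')) (Val ''dl'')))
       Skip (assign ''v'' (Val ''w'')))"

definition iter :: com where
  "iter = find_active ;;
     Cond (Eq (Val ''v'') (Const 0)) (assign ''run'' (Const 0))
       (find ;; Cond (Eq (Val ''fnd'') (Const 0)) relabel push)"

definition saturate :: com where
  "saturate = assign ''run'' (Const 1) ;; While (Neg (Eq (Val ''run'') (Const 0))) iter"

lemma mods_push [simp]: "mods push = {''w'', ''A'', ''L'', ''y''}"
  by (auto simp: push_def)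

lemma mods_relabel [simp]: "mods relabel = {''d'', ''run'', ''fail''}"
  by (auto simp: relabel_def)

lemma mods_find_active [simp]: "mods find_active = {''v'', ''w''}"
  by (auto simp: find_active_def)

lemma mods_iter [simp]:
  "mods iter = mods find_active \<union> ({''run''} \<union> (mods find \<union> (mods relabel \<union> mods push)))"
  by (simp only: iter_def mods.simps)

lemma mods_saturate [simp]: "mods saturate = {''run''} \<union> mods iter"
  by (simp only: saturate_def mods.simps)

lemma wp_push:
  assumes n: "s ''n'' 0 = int n" and L: "s ''L'' 0 = off n m" and fp: "s ''fp'' 0 = off n i" "i < m"
    and v: "s ''v'' 0 = int v" "v \<in> ground n" and u: "s ''fu'' 0 = int u" "u \<le> n" "u \<noteq> v"
    and rep: "rep n (s ''A'') m S w" and dl: "s ''dl'' 0 = dl"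
  shows "wp n I push s (\<lambda>t s'. t \<le> 200 * (n + 1) \<and>
    rep n (s' ''A'') (Suc m) (S(i := insert v (S i - {u}), m := S i)) (w(i := dl, m := w i - dl)) \<and>
    s' ''L'' 0 = off n (Suc m) \<and>
    s' ''y'' = (let y = (s ''y'')(int v := s ''y'' (int v) + dl) in y(int u := y (int u) - dl)))"
proof -
  let ?c = "Set ''A'' (Plus (Val ''L'') (Val ''w'')) (Get ''A'' (Plus (Val ''fp'') (Val ''w'')))"
  define inv where "inv j s1 \<longleftrightarrow> (\<forall>a x. x \<le> n \<longrightarrow> a < m \<longrightarrow> s1 ''A'' (off n a + int x) = s ''A'' (off n a + int x)) \<and>
     (\<forall>x<j. s1 ''A'' (off n m + int x) = s ''A'' (off n i + int x))"
    for j :: nat and s1 :: state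
  have "wp n I (For ''w'' 0 ?c) s
    (\<lambda>t s'. t \<le> (n + 1) * (20 + 20) + 20 \<and> inv (n + 1) s' \<and> frame (insert ''w'' (mods ?c)) s s')"
  proof (rule wp_For[where inv = inv])
    fix j s1 assume j: "j \<le> n" "s1 ''w'' 0 = int j"
      and fr: "frame (insert ''w'' (mods ?c)) s s1" and inv: "inv j s1"
    have eq: "s1 ''L'' = s ''L''" "s1 ''fp'' = s ''fp''" using fr by (auto simp: frame_def)
    have "s1 ''A'' (off n i + int j) = s ''A'' (off n i + int j)" using inv j fp unfolding inv_def by auto
    moreover have "off n a + int x = off n m + int j \<longleftrightarrow> a = m \<and> x = j" if "x \<le> n" for a x
      using off_eq_iff[OF that j(1)] .
    ultimately show "wp n I ?c s1 (\<lambda>t s'. t \<le> 20 \<and> inv (j + 1) (update ''w'' 0 (int (j + 1)) s'))"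
      using inv j fp L unfolding inv_def by (auto simp: wp_simps update_def less_Suc_eq eq)
  qed (use n in \<open>auto simp: inv_def update_def\<close>)
  then show ?thesis unfolding push_def wp_Seq
  proof (rule wp_mono, elim conjE)
    fix t s1 assume t: "t \<le> (n + 1) * (20 + 20) + 20" and inv: "inv (n + 1) s1"
      and fr: "frame (insert ''w'' (mods ?c)) s s1"
    have eq: "s1 z = s z" if "z \<notin> {''w'', ''A''}" for z using fr that by (auto simp: frame_def)
    define A' where "A' = (s1 ''A'')(off n m := s1 ''A'' (off n m) - dl, off n i + int u := 0,
      off n i + int v := 1, off n i := dl)"
    have v0: "v \<le> n" "v \<noteq> 0" using v by (auto simp: ground_def)
    have old: "s1 ''A'' (off n a + int x) = s ''A'' (off n (if a = m then i else a) + int x)"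
      if "a < Suc m" "x \<le> n" for a x
    proof (cases "a = m")
      case True
      have "x < n + 1" using that by simp
      then show ?thesis using inv True unfolding inv_def by simp
    next
      case False
      then show ?thesis using inv that unfolding inv_def by simp
    qed
    have A': "A' (off n a + int x) = (if a = i \<and> x = 0 then dl else if a = i \<and> x = v then 1
        else if a = i \<and> x = u then 0 else if a = m \<and> x = 0 then s ''A'' (off n i) - dl
        else s ''A'' (off n (if a = m then i else a) + int x))" if "a < Suc m" "x \<le> n" for a x
      unfolding A'_def using old[OF that] old[of m 0] that fp v0 u
      by (simp add: off_eq_iff off_eq_iff')
    have r: "s ''A'' (off n a) = w a" "S a = {x \<in> ground n. s ''A'' (off n a + int x) \<noteq> 0}" if "a < m" for a
      using rep that unfolding rep_def by auto
    have rep': "rep n A' (Suc m) (S(i := insert v (S i - {u}), m := S i)) (w(i := dl, m := w i - dl))"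
      unfolding rep_def
    proof (intro allI impI conjI)
      fix a assume a: "a < Suc m"
      have "A' (off n a) = A' (off n a + int 0)" by simp
      also have "\<dots> = (w(i := dl, m := w i - dl)) a"
        unfolding A'[OF a le0] using fp a r(1)[of a] r(1)[OF fp(2)] by (auto simp: less_Suc_eq)
      finally show "A' (off n a) = (w(i := dl, m := w i - dl)) a" .
      have "x \<in> (S(i := insert v (S i - {u}), m := S i)) a \<longleftrightarrow> A' (off n a + int x) \<noteq> 0" if "x \<in> ground n" for x
      proof -
        have x: "x \<le> n" "x \<noteq> 0" using that by (auto simp: ground_def)
        show ?thesis unfolding A'[OF a x(1)] using x that fp a v u r(2)[of a] r(2)[OF fp(2)]
          by (cases "a = m"; cases "a = i") (auto simp: less_Suc_eq)
      qed
      moreover have "(S(i := insert v (S i - {u}), m := S i)) a \<subseteq> ground n"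
        using r(2)[of a] r(2)[OF fp(2)] a v by (auto simp: less_Suc_eq)
      ultimately show "(S(i := insert v (S i - {u}), m := S i)) a = {x \<in> ground n. A' (off n a + int x) \<noteq> 0}"
        by blast
    qed
    show "wp n I edit_blocks s1 (\<lambda>(t1::nat) s1.
       wp n I (assign ''L'' (Plus (Plus (Val ''L'') (Val ''n'')) (Const 1))) s1 (\<lambda>(t1d::nat) s1.
       wp n I (Set ''y'' (Val ''v'') (Plus (Get ''y'' (Val ''v'')) (Val ''dl''))) s1 (\<lambda>(t1e::nat) s1.
       wp n I (Set ''y'' (Val ''fu'') (Minus (Get ''y'' (Val ''fu'')) (Val ''dl''))) s1 (\<lambda>(t2::nat) s'.
         t + (t1 + (t1d + (t1e + t2))) \<le> 200 * (n + 1) \<and>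
    rep n (s' ''A'') (Suc m) (S(i := insert v (S i - {u}), m := S i)) (w(i := dl, m := w i - dl)) \<and>
    s' ''L'' 0 = off n (Suc m) \<and>
    s' ''y'' = (let y = (s ''y'')(int v := s ''y'' (int v) + dl) in y(int u := y (int u) - dl))))))"
    proof (rule wp_frame[OF wp_edit_blocks], elim conjE)
      fix t1 :: nat and s2
      assume t1: "t1 \<le> 60" and fr1: "frame (mods edit_blocks) s1 s2"
        and A2: "s2 ''A'' = (s1 ''A'')(s1 ''L'' 0 := s1 ''A'' (s1 ''L'' 0) - s1 ''dl'' 0, s1 ''fp'' 0 + s1 ''fu'' 0 := 0,
         s1 ''fp'' 0 + s1 ''v'' 0 := 1, s1 ''fp'' 0 := s1 ''dl'' 0)"
      have eq2: "s2 z = s z" if "z \<notin> {''w'', ''A''}" for z using fr1 that eq by (auto simp: frame_def)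
      have "rep n (s2 ''A'') (Suc m) (S(i := insert v (S i - {u}), m := S i)) (w(i := dl, m := w i - dl))"
        using rep' v(1) u(1) fp(1) L dl unfolding A2 A'_def by (simp add: eq)
      then show "wp n I (assign ''L'' (Plus (Plus (Val ''L'') (Val ''n'')) (Const 1))) s2 (\<lambda>(t1d::nat) s1.
       wp n I (Set ''y'' (Val ''v'') (Plus (Get ''y'' (Val ''v'')) (Val ''dl''))) s1 (\<lambda>(t1e::nat) s1.
       wp n I (Set ''y'' (Val ''fu'') (Minus (Get ''y'' (Val ''fu'')) (Val ''dl''))) s1 (\<lambda>(t2::nat) s'.
         t + (t1 + (t1d + (t1e + t2))) \<le> 200 * (n + 1) \<and>
    rep n (s' ''A'') (Suc m) (S(i := insert v (S i - {u}), m := S i)) (w(i := dl, m := w i - dl)) \<and>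
    s' ''L'' 0 = off n (Suc m) \<and>
    s' ''y'' = (let y = (s ''y'')(int v := s ''y'' (int v) + dl) in y(int u := y (int u) - dl)))))"
        using t t1 v u fp L n dl by (simp add: wp_simps update_apply eq2 off_Suc Let_def)
    qed
  qed
qed

lemma wp_find_active:
  assumes n: "s ''n'' 0 = int n"
  shows "wp n I find_active s (\<lambda>t s'. t \<le> 80 * (n + 1) \<and>
    (s' ''v'' 0 = 0 \<and> (\<forall>x\<in>ground n. s ''Z'' (int x) < s ''y'' (int x) + s ''dl'' 0) \<or>
     (\<exists>v\<in>ground n. s' ''v'' 0 = int v \<and> s ''y'' (int v) + s ''dl'' 0 \<le> s ''Z'' (int v))))"
proof -
  let ?c = "Cond (Less (Get ''Z'' (Val ''w'')) (Plus (Get ''y'' (Val ''w'')) (Val ''dl'')))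
       Skip (assign ''v'' (Val ''w''))"
  let ?s0 = "update ''v'' 0 0 s"
  define inv where "inv j s1 \<longleftrightarrow>
     s1 ''v'' 0 = 0 \<and> (\<forall>x. 1 \<le> x \<and> x < j \<longrightarrow> s ''Z'' (int x) < s ''y'' (int x) + s ''dl'' 0) \<or>
     (\<exists>v\<in>ground n. s1 ''v'' 0 = int v \<and> s ''y'' (int v) + s ''dl'' 0 \<le> s ''Z'' (int v))"
    for j :: nat and s1 :: state
  have "wp n I (For ''w'' 1 ?c) ?s0
    (\<lambda>t s'. t \<le> (n + 1) * (20 + 20) + 20 \<and> inv (n + 1) s' \<and> frame (insert ''w'' (mods ?c)) ?s0 s')"
  proof (rule wp_For[where inv = inv])
    fix j s1 assume j: "1 \<le> j" "j \<le> n" "s1 ''w'' 0 = int j"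
      and fr: "frame (insert ''w'' (mods ?c)) ?s0 s1" and inv: "inv j s1"
    have eq: "s1 ''Z'' = s ''Z''" "s1 ''y'' = s ''y''" "s1 ''dl'' = s ''dl''"
      using fr by (auto simp: frame_def update_def)
    show "wp n I ?c s1 (\<lambda>t s'. t \<le> 20 \<and> inv (j + 1) (update ''w'' 0 (int (j + 1)) s'))"
    proof (cases "s ''Z'' (int j) < s ''y'' (int j) + s ''dl'' 0")
      case True
      then show ?thesis using inv j unfolding inv_def by (auto simp: wp_simps update_def less_Suc_eq eq)
    next
      case False
      moreover have "j \<in> ground n" using j by (simp add: ground_def)
      ultimately show ?thesis using j unfolding inv_def by (auto simp: wp_simps update_def eq)
    qed
  qed (use n in \<open>auto simp: inv_def update_def\<close>)
  then show ?thesis unfolding find_active_def wp_Seq wp_Set aval.simps acost.simps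
    by (rule wp_mono) (auto simp: inv_def ground_def)
qed

section \<open>The loop of pushes and relabellings\<close>

definition running :: "nat \<Rightarrow> nat set set \<Rightarrow> state \<Rightarrow> nat \<Rightarrow> bool" where
  "running n I s m \<longleftrightarrow> (\<exists>S w. rep n (s ''A'') m S w \<and> s ''L'' 0 = off n m \<and>
     pr_inv n I (s ''dl'' 0) (\<lambda>x. s ''Z'' (int x)) m S w (\<lambda>x. s ''y'' (int x)) (\<lambda>x. s ''d'' (int x)) (s ''M'' 0) \<and>
     (\<Sum>v\<in>ground n. units (s ''dl'' 0) (\<lambda>x. s ''Z'' (int x)) (\<lambda>x. s ''y'' (int x)) v) \<le> 2 * int n)"

definition pot :: "nat \<Rightarrow> state \<Rightarrow> int" where
  "pot n s = potential n (s ''dl'' 0) (\<lambda>x. s ''Z'' (int x)) (\<lambda>x. s ''y'' (int x)) (\<lambda>x. s ''d'' (int x))"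

definition no_active :: "nat \<Rightarrow> state \<Rightarrow> bool" where
  "no_active n s \<longleftrightarrow> (\<forall>x\<in>ground n. s ''Z'' (int x) < s ''y'' (int x) + s ''dl'' 0)"

definition refuted :: "nat \<Rightarrow> nat set set \<Rightarrow> (int \<Rightarrow> int) \<Rightarrow> bool" where
  "refuted n I Z \<longleftrightarrow> (\<exists>c. valid_constraint n I c \<and> dot n c (\<lambda>x. Z (int x)) < 0)"

lemma pot_nonneg: "running n I s m \<Longrightarrow> 0 \<le> pot n s"
  unfolding running_def pot_def potential_def pr_inv_def units_def
  by (fastforce intro!: add_nonneg_nonneg mult_nonneg_nonneg sum_nonneg simp: pos_imp_zdiv_nonneg_iff)

lemma running_cong:
  assumes "running n I s m" "\<And>z. z \<in> {''A'', ''L'', ''dl'', ''Z'', ''y'', ''d'', ''M''} \<Longrightarrow> s' z = s z"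
  shows "running n I s' m" "pot n s' = pot n s"
  using assms by (simp_all add: running_def pot_def)

lemma wp_iter:
  assumes M: "matroid (ground n) I"
    and n: "s ''n'' 0 = int n" and run: "running n I s m" and rf: "s ''run'' 0 = 1" "s ''fail'' 0 = 0"
  shows "wp n I iter s (\<lambda>t s'. t \<le> (m + 1) * (1000 * (n + 1)\<^sup>2) \<and>
    (s' ''run'' 0 = 1 \<and> s' ''fail'' 0 = 0 \<and> (\<exists>m'\<le>Suc m. running n I s' m') \<and> pot n s' < pot n s \<or>
     s' ''run'' 0 = 0 \<and> s' ''fail'' 0 = 0 \<and> running n I s' m \<and> no_active n s' \<or>
     s' ''run'' 0 = 0 \<and> s' ''fail'' 0 = 1 \<and> refuted n I (s' ''Z'')))"
  unfolding iter_def wp_Seq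
proof (rule wp_frame[OF wp_find_active[where s = s, OF n]])
  fix t s1
  assume act: "t \<le> 80 * (n + 1) \<and>
    (s1 ''v'' 0 = 0 \<and> (\<forall>x\<in>ground n. s ''Z'' (int x) < s ''y'' (int x) + s ''dl'' 0) \<or>
     (\<exists>v\<in>ground n. s1 ''v'' 0 = int v \<and> s ''y'' (int v) + s ''dl'' 0 \<le> s ''Z'' (int v)))"
    and fr: "frame (mods find_active) s s1"
  have eq: "s1 z = s z" if "z \<notin> {''v'', ''w''}" for z using fr that by (auto simp: frame_def)
  have k: "n + 1 \<le> (m + 1) * (n + 1)\<^sup>2" "(n + 1)\<^sup>2 \<le> (m + 1) * (n + 1)\<^sup>2"
    using square_bounds[of n] by (simp_all add: trans_le_add1)
  define R where "R s' \<longleftrightarrow>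
    (s' ''run'' 0 = 1 \<and> s' ''fail'' 0 = 0 \<and> (\<exists>m'\<le>Suc m. running n I s' m') \<and> pot n s' < pot n s \<or>
     s' ''run'' 0 = 0 \<and> s' ''fail'' 0 = 0 \<and> running n I s' m \<and> no_active n s' \<or>
     s' ''run'' 0 = 0 \<and> s' ''fail'' 0 = 1 \<and> refuted n I (s' ''Z''))" for s'
  let ?B = "(m + 1) * (1000 * (n + 1)\<^sup>2)"
  let ?c = "find ;; Cond (Eq (Val ''fnd'') (Const 0)) relabel push"
  have "wp n I (Cond (Eq (Val ''v'') (Const 0)) (assign ''run'' (Const 0)) ?c) s1
     (\<lambda>t2 s'. t + t2 \<le> ?B \<and> R s')"
  proof (cases "s1 ''v'' 0 = 0")
    case True
    let ?s' = "update ''run'' 0 0 s1"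
    have same: "?s' z = s z" if "z \<notin> {''v'', ''w'', ''run''}" for z using eq that by (simp add: update_def)
    have "running n I ?s' m" by (rule running_cong[OF run]) (auto simp: same)
    moreover have "no_active n ?s'" using act True unfolding no_active_def by (auto simp: same ground_def)
    ultimately have "R ?s'" using rf by (simp add: R_def eq update_def)
    moreover have "t + 20 \<le> ?B" using act k by simp
    ultimately show ?thesis unfolding wp_Cond wp_Set using True by simp
  next
    case False
    then obtain v where v: "v \<in> ground n" "s1 ''v'' 0 = int v" "s ''y'' (int v) + s ''dl'' 0 \<le> s ''Z'' (int v)"
      using act by auto
    obtain S w where rep: "rep n (s ''A'') m S w" and L: "s ''L'' 0 = off n m"
      and inv: "pr_inv n I (s ''dl'' 0) (\<lambda>x. s ''Z'' (int x)) m S w (\<lambda>x. s ''y'' (int x)) (\<lambda>x. s ''d'' (int x)) (s ''M'' 0)"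
      and few: "(\<Sum>v\<in>ground n. units (s ''dl'' 0) (\<lambda>x. s ''Z'' (int x)) (\<lambda>x. s ''y'' (int x)) v) \<le> 2 * int n"
      using run unfolding running_def by blast
    define dl Z y d where "dl = s ''dl'' 0" and "Z = (\<lambda>x. s ''Z'' (int x))" and "y = (\<lambda>x. s ''y'' (int x))"
      and "d = (\<lambda>x. s ''d'' (int x))"
    note defs = dl_def Z_def y_def d_def
    note inv = inv[folded defs] and few = few[folded defs]
    have dl: "0 < dl" using inv by (simp add: pr_inv_def)
    have "wp n I ?c s1 (\<lambda>t2 s'. t + (50 + t2) \<le> ?B \<and> R s')"
      unfolding wp_Seq
    proof (rule wp_frame[OF wp_find[where m = m and v = v and dl = dl and d = d and S = S and w = w]])
      fix t2 s2
      assume A: "t2 \<le> (m + 1) * (400 * (n + 1)\<^sup>2) \<and>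
        (s2 ''fnd'' 0 = 1 \<and> (\<exists>i u. i < m \<and> u \<le> n \<and> s2 ''fp'' 0 = off n i \<and> s2 ''fu'' 0 = int u \<and>
          admissible I S w d dl v i u) \<or>
        s2 ''fnd'' 0 = 0 \<and> (\<forall>i<m. \<forall>u. \<not> admissible I S w d dl v i u))"
        and fr2: "frame (mods find) s1 s2"
      have eq2: "s2 z = s z" if "z \<notin> {''v'', ''w'', ''Q'', ''r'', ''fnd'', ''fp'', ''fu'', ''p'', ''u''}" for z
        using fr2 that by (auto simp: frame_def eq)
      have v2: "s2 ''v'' 0 = int v" using fr2 v by (simp add: frame_def)
      have tm: "t + (50 + (t2 + (100 + t3))) \<le> ?B" if "t3 \<le> 200 * (n + 1)" for t3
        using act A k that square_bounds[of n] by simp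
      show "wp n I (Cond (Eq (Val ''fnd'') (Const 0)) relabel push) s2 (\<lambda>t3 s'. t + (50 + (t2 + t3)) \<le> ?B \<and> R s')"
      proof (cases "s2 ''fnd'' 0 = 0")
        case True
        then have no: "\<And>i u. i < m \<Longrightarrow> \<not> admissible I S w d dl v i u" using A by auto
        have no': "insert v (S i - {u}) \<notin> I" if "i < m" "dl \<le> w i" "v \<notin> S i" "u \<in> insert 0 (S i)" "d u + 1 = d v" for i u
          using no[OF that(1), of u] that unfolding admissible_def by blast
        have rl1: "valid_labels (ground n) I (d(v := d v + 1)) (S j)" if "j < m" "0 < w j" for j
          by (rule pr_inv_relabel(1)[OF M inv v(1) _ few that]) (rule no')
        have rl2: "potential n dl Z y (d(v := d v + 1)) < potential n dl Z y d"
          by (rule pr_inv_relabel(2)[OF M inv v(1) _ few]) (rule no')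
        have rl3: "pr_inv n I dl Z m S w y (d(v := d v + 1)) (s ''M'' 0)" if "d v + 1 < int n"
          by (rule pr_inv_relabel(3)[OF M inv v(1) _ few that]) (rule no')
        let ?s3 = "update ''d'' (int v) (d v + 1) s2"
        let ?s4 = "update ''fail'' 0 1 (update ''run'' 0 0 ?s3)"
        have same: "?s3 z = s z" if "z \<in> {''n'', ''A'', ''L'', ''dl'', ''Z'', ''y'', ''M'', ''run'', ''fail''}" for z
          using eq2[of z] that by (auto simp: update_def)
        have d3: "(\<lambda>x. ?s3 ''d'' (int x)) = d(v := d v + 1)"
          by (rule ext) (simp add: update_def eq2 d_def)
        have "wp n I relabel s2 (\<lambda>t3 s'. t3 \<le> 40 \<and> R s')"
        proof (cases "d v + 1 < int n")
          case lt: True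
          have "running n I ?s3 m"
            unfolding running_def d3 using rep L rl3[OF lt] few
            by (intro exI[of _ S] exI[of _ w]) (simp add: same defs[symmetric])
          moreover have "pot n ?s3 < pot n s"
            unfolding pot_def d3 using rl2 by (simp add: same defs[symmetric])
          moreover have "m \<le> Suc m" by simp
          moreover have "?s3 ''run'' 0 = 1" "?s3 ''fail'' 0 = 0" using rf by (simp_all add: same)
          ultimately have "R ?s3" unfolding R_def by blast
          then show ?thesis unfolding wp_Cond relabel_def wp_Seq wp_Set using lt v2 n
            by (simp add: wp_Skip eq2 d_def[symmetric]) (simp add: update_def eq2 d_def)
        next
          case ge: False
          have yv: "y v < Z v" using v(3) dl by (simp add: defs)
          \<comment> \<open>The raised label has reached \<open>n\<close>, so \<open>pr_inv\<close>
            no longer holds. Validity of the new labels still does, and \<open>pr_inv_fail\<close>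
            builds on that and on the packing alone.\<close>
          have "\<exists>c. valid_constraint n I c \<and> dot n c Z < 0"
          proof (rule pr_inv_fail[OF M, where d = "d(v := d v + 1)" and v = v])
            show "packing n I m S w y (s ''M'' 0)" "Z 0 \<le> s ''M'' 0" using inv by (simp_all add: pr_inv_def)
            show "\<And>j. j < m \<Longrightarrow> 0 < w j \<Longrightarrow> valid_labels (ground n) I (d(v := d v + 1)) (S j)"
              by (rule rl1)
          qed (use inv v(1) ge yv in \<open>auto simp: pr_inv_def ground_def\<close>)
          then have "refuted n I (?s4 ''Z'')" using eq2[of "''Z''"] by (simp add: refuted_def update_def Z_def)
          then have "R ?s4" unfolding R_def by (simp add: update_def)
          then show ?thesis unfolding wp_Cond relabel_def wp_Seq wp_Set using ge v2 n
            by (simp add: wp_Skip eq2 d_def[symmetric]) (simp add: update_def eq2 d_def)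
        qed
        then show ?thesis unfolding wp_Cond using True tm[of 0]
          by simp (erule wp_mono, simp)
      next
        case False
        then obtain i u where iu: "i < m" "u \<le> n" "s2 ''fp'' 0 = off n i" "s2 ''fu'' 0 = int u"
          and adm: "admissible I S w d dl v i u" using A by auto
        have a: "dl \<le> w i" "v \<notin> S i" "u \<in> insert 0 (S i)" "d u + 1 = d v" "insert v (S i - {u}) \<in> I"
          using adm by (simp_all add: admissible_def)
        have yv: "y v + dl \<le> Z v" using v(3) by (simp add: defs)
        have uv: "u \<noteq> v" using a v by (auto simp: ground_def)
        note pu = pr_inv_push[OF M inv v(1) yv iu(1) a few]
        have "wp n I push s2 (\<lambda>t3 s'. t3 \<le> 200 * (n + 1) \<and> R s')"
        proof (rule wp_frame[OF wp_push[where i = i and m = m and v = v and u = u and S = S and w = w and dl = dl]])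
          fix t3 s3
          assume P: "t3 \<le> 200 * (n + 1) \<and>
            rep n (s3 ''A'') (Suc m) (S(i := insert v (S i - {u}), m := S i)) (w(i := dl, m := w i - dl)) \<and>
            s3 ''L'' 0 = off n (Suc m) \<and>
            s3 ''y'' = (let y = (s2 ''y'')(int v := s2 ''y'' (int v) + dl) in y(int u := y (int u) - dl))"
            and fr3: "frame (mods push) s2 s3"
          have same: "s3 z = s z" if "z \<in> {''dl'', ''Z'', ''d'', ''M'', ''run'', ''fail''}" for z
          proof -
            have z: "z \<notin> mods push" "z \<notin> {''v'', ''w'', ''Q'', ''r'', ''fnd'', ''fp'', ''fu'', ''p'', ''u''}"
              using that by auto
            show ?thesis using frameD[OF fr3 z(1)] eq2[OF z(2)] by (rule trans)
          qed
          have y3: "(\<lambda>x. s3 ''y'' (int x)) = (y(v := y v + dl))(u := (y(v := y v + dl)) u - dl)"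
            using P eq2[of "''y''"] by (auto simp: Let_def y_def fun_eq_iff)
          have "running n I s3 (Suc m)"
            unfolding running_def y3 using P pu(1,2)
            by (intro exI[of _ "S(i := insert v (S i - {u}), m := S i)"] exI[of _ "w(i := dl, m := w i - dl)"])
              (simp add: same defs[symmetric])
          moreover have "pot n s3 < pot n s"
            unfolding pot_def y3 using pu(3) by (simp add: same defs[symmetric])
          moreover have "s3 ''run'' 0 = 1" "s3 ''fail'' 0 = 0" using rf by (simp_all add: same)
          ultimately show "t3 \<le> 200 * (n + 1) \<and> R s3" using P unfolding R_def by blast
        qed (use n L iu v2 v(1) uv rep in \<open>simp_all add: eq2 defs\<close>)
        then show ?thesis unfolding wp_Cond using False tm
          by simp (erule wp_mono, fastforce)
      qed
    qed (use n v dl L rep in \<open>simp_all add: eq defs\<close>)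
    then show ?thesis unfolding wp_Cond using False
      by simp (erule wp_mono, simp)
  qed
  then show "wp n I (Cond (Eq (Val ''v'') (Const 0)) (assign ''run'' (Const 0)) ?c) s1
     (\<lambda>t2 s'. t + t2 \<le> ?B \<and>
    (s' ''run'' 0 = 1 \<and> s' ''fail'' 0 = 0 \<and> (\<exists>m'\<le>Suc m. running n I s' m') \<and> pot n s' < pot n s \<or>
     s' ''run'' 0 = 0 \<and> s' ''fail'' 0 = 0 \<and> running n I s' m \<and> no_active n s' \<or>
     s' ''run'' 0 = 0 \<and> s' ''fail'' 0 = 1 \<and> refuted n I (s' ''Z'')))"
    unfolding R_def .
qed


lemma wp_saturate:
  assumes M: "matroid (ground n) I"
    and n: "s ''n'' 0 = int n" and run: "running n I s m" and pot: "pot n s \<le> int W"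
    and f: "s ''fail'' 0 = 0"
  shows "wp n I saturate s (\<lambda>t s'. t \<le> (W + 2) * ((m + W + 1) * (1000 * (n + 1)\<^sup>2) + 20) \<and>
    (s' ''fail'' 0 = 0 \<and> (\<exists>m'\<le>m + W. running n I s' m') \<and> no_active n s' \<or>
     s' ''fail'' 0 = 1 \<and> refuted n I (s' ''Z'')))"
proof -
  define R where "R s' \<longleftrightarrow> s' ''fail'' 0 = 0 \<and> (\<exists>m'\<le>m + W. running n I s' m') \<and> no_active n s' \<or>
     s' ''fail'' 0 = 1 \<and> refuted n I (s' ''Z'')" for s'
  \<comment> \<open>The sum of \<open>m'\<close> and the potential never increases, because an
    iteration adds at most one block and costs at least one unit of potential. This limits the
    blocks to be scanned and with them the cost of every iteration.\<close>
  define inv where "inv k s1 \<longleftrightarrow>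
    s1 ''run'' 0 = 1 \<and> s1 ''fail'' 0 = 0 \<and>
      (\<exists>m'. running n I s1 m' \<and> int m' + pot n s1 \<le> int (m + W) \<and> pot n s1 < int k) \<or>
    s1 ''run'' 0 = 0 \<and> R s1" for k :: nat and s1
  let ?T = "(m + W + 1) * (1000 * (n + 1)\<^sup>2)"
  let ?b = "Neg (Eq (Val ''run'') (Const 0))"
  let ?s0 = "update ''run'' 0 1 s"
  have "wp n I (While ?b iter) ?s0
    (\<lambda>t s'. t \<le> (W + 1) * (?T + 6 + 1) + 6 + 1 \<and> (\<exists>k'\<le>W + 1. inv k' s') \<and> \<not> bval ?b s' \<and> frame (mods iter) ?s0 s')"
  proof (rule wp_While)
    have "running n I ?s0 m" "pot n ?s0 = pot n s"
      by (rule running_cong[OF run], auto simp: update_apply)+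
    then show "inv (W + 1) ?s0" using pot f unfolding inv_def by (auto simp: update_apply)
    fix k s1 assume k: "inv k s1" and b: "bval ?b s1" and fr: "frame (mods iter) ?s0 s1"
    then obtain m' where m': "running n I s1 m'" "int m' + pot n s1 \<le> int (m + W)" "pot n s1 < int k"
      and rf: "s1 ''run'' 0 = 1" "s1 ''fail'' 0 = 0" unfolding inv_def by auto
    have n1: "s1 ''n'' 0 = int n" using fr n by (simp add: frame_def update_apply)
    have k0: "0 < k" and mm: "m' \<le> m + W" using m' pot_nonneg[OF m'(1)] by auto
    show "wp n I iter s1 (\<lambda>t s'. t \<le> ?T \<and> (\<exists>k'<k. inv k' s'))"
    proof (rule wp_mono[OF wp_iter[OF M n1 m'(1) rf]], elim conjE)
      fix t s2
      assume t: "t \<le> (m' + 1) * (1000 * (n + 1)\<^sup>2)" and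
        A: "s2 ''run'' 0 = 1 \<and> s2 ''fail'' 0 = 0 \<and> (\<exists>m''\<le>Suc m'. running n I s2 m'') \<and> pot n s2 < pot n s1 \<or>
         s2 ''run'' 0 = 0 \<and> s2 ''fail'' 0 = 0 \<and> running n I s2 m' \<and> no_active n s2 \<or>
         s2 ''run'' 0 = 0 \<and> s2 ''fail'' 0 = 1 \<and> refuted n I (s2 ''Z'')"
      have "(m' + 1) * (1000 * (n + 1)\<^sup>2) \<le> ?T" using mm by (intro mult_right_mono) auto
      moreover have "inv (k - 1) s2"
      proof (cases "s2 ''run'' 0 = 1")
        case True
        then obtain m'' where m'': "m'' \<le> Suc m'" "running n I s2 m''" "pot n s2 < pot n s1" "s2 ''fail'' 0 = 0"
          using A by auto
        then have "int m'' + pot n s2 \<le> int (m + W)" "pot n s2 < int (k - 1)" using m' k0 by auto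
        then show ?thesis using True m'' unfolding inv_def by blast
      next
        case False
        then have "s2 ''run'' 0 = 0" "R s2" using A mm unfolding R_def by auto
        then show ?thesis unfolding inv_def by blast
      qed
      moreover have "k - 1 < k" using k0 by simp
      ultimately show "t \<le> ?T \<and> (\<exists>k'<k. inv k' s2)" using t by (meson le_trans)
    qed
  qed simp
  then have "wp n I (While ?b iter) ?s0 (\<lambda>t s'. 3 + t \<le> (W + 2) * (?T + 20) \<and> R s')"
  proof (rule wp_mono, elim conjE exE)
    fix t s' k'
    assume "t \<le> (W + 1) * (?T + 6 + 1) + 6 + 1" and k: "inv k' s'" "\<not> bval ?b s'"
    moreover have "(W + 1) * (?T + 6 + 1) \<le> (W + 1) * (?T + 20)" by (intro mult_left_mono) auto
    moreover have "(W + 2) * (?T + 20) = (W + 1) * (?T + 20) + (?T + 20)" by simp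
    ultimately have "3 + t \<le> (W + 2) * (?T + 20)" by linarith
    then show "3 + t \<le> (W + 2) * (?T + 20) \<and> R s'" using k unfolding inv_def by auto
  qed
  then show ?thesis unfolding saturate_def wp_Seq wp_Set aval.simps acost.simps
    by (rule wp_mono) (auto simp: R_def)
qed

section \<open>One scaling phase\<close>

definition drop_block :: com where
  "drop_block = assign ''M'' (Minus (Val ''M'') (Val ''dl'')) ;;
     For ''w'' 1 (Cond (Eq (Get ''A'' (Val ''w'')) (Const 0)) Skip
       (Set ''y'' (Val ''w'') (Minus (Get ''y'' (Val ''w'')) (Val ''dl'')))) ;;
     Set ''A'' (Const 0) (Minus (Get ''A'' (Const 0)) (Val ''dl''))"

text \<open>After halving the step, the mass may exceed \<open>Z 0\<close> by a full new step.
  Dropping \<open>dl\<close> from block 0 repairs this, at the price of raising deficits below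
  \<open>2 * dl\<close> to below \<open>3 * dl\<close>. Hence at most two units are missing at each
  element, and \<open>2 * n\<close> in total.\<close>

definition trim :: com where
  "trim = Cond (Less (Val ''M'') (Plus (Get ''Z'' (Const 0)) (Val ''dl''))) Skip drop_block"

definition reset :: com where
  "reset = For ''w'' 0 (Set ''d'' (Val ''w'') (Const 0)) ;; Set ''d'' (Const 0) (Const (-1))"

definition phase :: com where
  "phase = assign ''kk'' (Minus (Val ''kk'') (Const 1)) ;; assign ''dl'' (Get ''P'' (Val ''kk'')) ;;
     trim ;; reset ;; saturate"

lemma mods_trim [simp]: "mods trim = {''M''} \<union> ({''w'', ''y''} \<union> {''A''})"
  by (simp add: trim_def drop_block_def)

lemma mods_reset [simp]: "mods reset = {''w'', ''d''}"
  by (auto simp: reset_def)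

lemma mods_phase [simp]:
  "mods phase = {''kk''} \<union> ({''dl''} \<union> (mods trim \<union> (mods reset \<union> mods saturate)))"
  by (simp only: phase_def mods.simps)

text \<open>
  \<open>D\<close> is the granularity of the weights, \<open>D1\<close> bounds the excess mass and \<open>D2\<close> the amount missing at
  an element. The three bounds agree except between the halving of the step length and the end of
  the phase.
\<close>

definition approx :: "nat \<Rightarrow> nat set set \<Rightarrow> state \<Rightarrow> nat \<Rightarrow> int \<Rightarrow> int \<Rightarrow> int \<Rightarrow> bool" where
  "approx n I s m D D1 D2 \<longleftrightarrow> (\<exists>S w. rep n (s ''A'') m S w \<and> s ''L'' 0 = off n m \<and>
     packing n I m S w (\<lambda>x. s ''y'' (int x)) (s ''M'' 0) \<and> 0 < D \<and> (\<forall>i<m. D dvd w i) \<and>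
     (\<forall>v\<in>ground n. s ''y'' (int v) \<le> s ''Z'' (int v) \<and> s ''Z'' (int v) < s ''y'' (int v) + D2) \<and>
     0 \<le> s ''Z'' 0 \<and> s ''Z'' 0 \<le> s ''M'' 0 \<and> s ''M'' 0 < s ''Z'' 0 + D1 \<and>
     (0 < s ''Z'' 0 \<longrightarrow> 0 < m \<and> D \<le> w 0))"

lemma wp_trim:
  assumes M: "matroid (ground n) I" and n: "s ''n'' 0 = int n"
    and ap: "approx n I s m (2 * dl) (2 * dl) (2 * dl)" and dl: "s ''dl'' 0 = dl"
  shows "wp n I trim s (\<lambda>t s'. t \<le> 200 * (n + 1) \<and> approx n I s' m dl dl (3 * dl))"
proof -
  obtain S w where rep: "rep n (s ''A'') m S w" and L: "s ''L'' 0 = off n m" and m: "0 < s ''Z'' 0 \<Longrightarrow> 0 < m"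
    and pack: "packing n I m S w (\<lambda>x. s ''y'' (int x)) (s ''M'' 0)" and dl0: "0 < dl"
    and dvd: "\<And>i. i < m \<Longrightarrow> 2 * dl dvd w i"
    and y: "\<And>v. v \<in> ground n \<Longrightarrow> s ''y'' (int v) \<le> s ''Z'' (int v) \<and> s ''Z'' (int v) < s ''y'' (int v) + 2 * dl"
    and Z0: "0 \<le> s ''Z'' 0" "s ''Z'' 0 \<le> s ''M'' 0" "s ''M'' 0 < s ''Z'' 0 + 2 * dl"
    and w0: "0 < s ''Z'' 0 \<Longrightarrow> 2 * dl \<le> w 0"
    using ap unfolding approx_def by auto
  have dvd': "dl dvd w i" if "i < m" for i using dvd[OF that] by (rule dvd_mult_right)
  show ?thesis
  proof (cases "s ''M'' 0 < s ''Z'' 0 + dl")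
    case True
    have "approx n I s m dl dl (3 * dl)"
      unfolding approx_def using rep L m pack dl0 dvd' y Z0 w0 True
      by (intro exI[of _ S] exI[of _ w]) fastforce
    then show ?thesis unfolding trim_def wp_Cond using True dl by (simp add: wp_Skip)
  next
    case False
    have Zpos: "0 < s ''Z'' 0"
    proof (rule ccontr)
      assume "\<not> ?thesis"
      then have "s ''M'' 0 < 2 * dl" "dl \<le> s ''M'' 0" using False Z0 by auto
      moreover have "2 * dl dvd s ''M'' 0"
        using pack dvd unfolding packing_def by (metis (no_types, lifting) dvd_sum lessThan_iff)
      ultimately show False using dl0 zdvd_imp_le[of "2 * dl" "s ''M'' 0"] by simp
    qed
    note m = m[OF Zpos]
    let ?c = "Cond (Eq (Get ''A'' (Val ''w'')) (Const 0)) Skip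
       (Set ''y'' (Val ''w'') (Minus (Get ''y'' (Val ''w'')) (Val ''dl'')))"
    let ?s0 = "update ''M'' 0 (s ''M'' 0 - dl) s"
    have A0: "x \<in> S 0 \<longleftrightarrow> s ''A'' (int x) \<noteq> 0" if "x \<in> ground n" for x
      using rep m that by (auto simp: rep_def)
    define y' where "y' x = s ''y'' (int x) - dl * ivec (S 0) x" for x
    define inv where "inv j s1 \<longleftrightarrow> (\<forall>x\<in>ground n. s1 ''y'' (int x) = (if x < j then y' x else s ''y'' (int x)))"
      for j :: nat and s1 :: state
    have "wp n I (For ''w'' 1 ?c) ?s0
      (\<lambda>t s'. t \<le> (n + 1) * (40 + 20) + 20 \<and> inv (n + 1) s' \<and> frame (insert ''w'' (mods ?c)) ?s0 s')"
    proof (rule wp_For[where inv = inv])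
      fix j s1 assume j: "1 \<le> j" "j \<le> n" "s1 ''w'' 0 = int j"
        and fr: "frame (insert ''w'' (mods ?c)) ?s0 s1" and inv: "inv j s1"
      have eq: "s1 ''A'' = s ''A''" "s1 ''dl'' = s ''dl''"
        using fr by (auto simp: frame_def update_apply)
      have jg: "j \<in> ground n" "j \<noteq> 0" using j by (auto simp: ground_def)
      have yj: "s1 ''y'' (int j) = s ''y'' (int j)" using inv jg by (simp add: inv_def)
      show "wp n I ?c s1 (\<lambda>t s'. t \<le> 40 \<and> inv (j + 1) (update ''w'' 0 (int (j + 1)) s'))"
      proof (cases "j \<in> S 0")
        case True
        then have "s ''A'' (int j) \<noteq> 0" using A0 jg by blast
        moreover have "inv (j + 1) (update ''w'' 0 (int (j + 1)) (update ''y'' (int j) (s ''y'' (int j) - dl) s1))"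
          using inv True jg by (auto simp: inv_def update_apply y'_def ivec_def less_Suc_eq)
        ultimately show ?thesis using j dl yj by (simp add: wp_simps eq)
      next
        case False
        then have "s ''A'' (int j) = 0" using A0 jg by blast
        moreover have "inv (j + 1) (update ''w'' 0 (int (j + 1)) s1)"
          using inv False jg by (auto simp: inv_def update_apply y'_def ivec_def less_Suc_eq)
        ultimately show ?thesis using j dl by (simp add: wp_simps eq)
      qed
    next
      show "inv 1 (update ''w'' 0 (int 1) ?s0)" by (auto simp: inv_def update_apply ground_def)
    qed (use n in \<open>simp_all add: update_apply\<close>)
    then have "wp n I (For ''w'' 1 ?c) ?s0 (\<lambda>t s1.
      wp n I (Set ''A'' (Const 0) (Minus (Get ''A'' (Const 0)) (Val ''dl''))) s1
       (\<lambda>t2 s'. 20 + (t + t2) \<le> 200 * (n + 1) \<and> approx n I s' m dl dl (3 * dl)))"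
    proof (rule wp_mono, elim conjE)
      fix t s1 assume t: "t \<le> (n + 1) * (40 + 20) + 20" and inv: "inv (n + 1) s1"
        and fr: "frame (insert ''w'' (mods ?c)) ?s0 s1"
      have eq: "s1 z = s z" if "z \<notin> {''w'', ''y'', ''M''}" for z using fr that by (auto simp: frame_def update_apply)
      have M1: "s1 ''M'' 0 = s ''M'' 0 - dl" using fr by (simp add: frame_def update_apply)
      let ?s2 = "update ''A'' 0 (s ''A'' 0 - dl) s1"
      let ?w = "w(0 := w 0 - dl)"
      have y2: "?s2 ''y'' (int x) = y' x" if "x \<in> ground n" for x
        using inv that by (auto simp: inv_def update_apply ground_def)
      have A2: "?s2 ''A'' = (s ''A'')(0 := s ''A'' 0 - dl)" by (simp add: update_apply eq)
      have ne: "off n a + int x = 0 \<longleftrightarrow> a = 0 \<and> x = 0" if "x \<le> n" for a x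
        using off_eq_iff[OF that, of 0 a 0] by simp
      have rep2: "rep n (?s2 ''A'') m S ?w"
        unfolding rep_def A2
      proof (intro allI impI conjI)
        fix a assume a: "a < m"
        then have r: "s ''A'' (off n a) = w a" "S a = {x \<in> ground n. s ''A'' (off n a + int x) \<noteq> 0}"
          using rep by (auto simp: rep_def)
        show "((s ''A'')(0 := s ''A'' 0 - dl)) (off n a) = ?w a"
          using r(1) ne[of 0 a] by auto
        have "off n a + int x \<noteq> 0" if "x \<in> ground n" for x
          using ne[of x a] that by (auto simp: ground_def)
        then show "S a = {x \<in> ground n. ((s ''A'')(0 := s ''A'' 0 - dl)) (off n a + int x) \<noteq> 0}"
          unfolding r(2) by auto
      qed
      have w0': "2 * dl \<le> w 0" by (rule w0[OF Zpos])
      have sumw: "(\<Sum>i<m. ?w i * f i) = (\<Sum>i<m. w i * f i) - dl * f 0" for f :: "nat \<Rightarrow> int"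
      proof -
        have "(\<lambda>i. ?w i * f i) = (\<lambda>i. w i * f i)(0 := (w 0 - dl) * f 0)" by auto
        then show ?thesis using m by (simp only: sum_fun_upd finite_lessThan) (simp add: algebra_simps)
      qed
      have P: "\<And>j. j < m \<Longrightarrow> S j \<in> I \<and> 0 \<le> w j" "(\<Sum>j<m. w j) = s ''M'' 0"
        "\<And>x. x \<in> ground n \<Longrightarrow> s ''y'' (int x) = (\<Sum>j<m. w j * ivec (S j) x)"
        using pack unfolding packing_def by auto
      have "(\<Sum>i<m. ?w i) = s ''M'' 0 - dl" using sumw[of "\<lambda>_. 1"] P(2) by simp
      then have pack2: "packing n I m S ?w (\<lambda>x. ?s2 ''y'' (int x)) (?s2 ''M'' 0)"
        unfolding packing_def using P(1) w0' dl0 y2 sumw P(3) M1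
        by (auto simp: y'_def update_apply)
      have dvd2: "dl dvd ?w i" if "i < m" for i using dvd'[OF that] dvd'[OF m] by auto
      have y3: "y' v \<le> s ''Z'' (int v) \<and> s ''Z'' (int v) < y' v + 3 * dl" if "v \<in> ground n" for v
        using y[OF that] dl0 by (auto simp: y'_def ivec_def)
      have "approx n I ?s2 m dl dl (3 * dl)"
        unfolding approx_def
      proof (intro exI[of _ S] exI[of _ ?w] conjI)
        show "rep n (?s2 ''A'') m S ?w" by (rule rep2)
        show "packing n I m S ?w (\<lambda>x. ?s2 ''y'' (int x)) (?s2 ''M'' 0)" by (rule pack2)
        show "\<forall>v\<in>ground n. ?s2 ''y'' (int v) \<le> ?s2 ''Z'' (int v) \<and> ?s2 ''Z'' (int v) < ?s2 ''y'' (int v) + 3 * dl"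
          using y3 y2 by (auto simp: update_apply eq)
      qed (use L m dl0 dvd2 Z0 False w0' M1 in \<open>auto simp: update_apply eq\<close>)
      then show "wp n I (Set ''A'' (Const 0) (Minus (Get ''A'' (Const 0)) (Val ''dl''))) s1
       (\<lambda>t2 s'. 20 + (t + t2) \<le> 200 * (n + 1) \<and> approx n I s' m dl dl (3 * dl))"
        using t dl by (simp add: wp_Set eq)
    qed
    then show ?thesis unfolding trim_def wp_Cond drop_block_def wp_Seq wp_Set using False dl
      by simp (elim wp_mono, fastforce)
  qed
qed


text \<open>The potential when all labels on the ground set are 0 and \<open>2 * n\<close> units are
  missing.\<close>

definition pot_bound :: "nat \<Rightarrow> nat" where
  "pot_bound n = 2 * n + (2 * n + 1) * (n * n)"

lemma wp_reset:
  assumes n: "s ''n'' 0 = int n" and ap: "approx n I s m dl dl (3 * dl)" and dl: "s ''dl'' 0 = dl"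
  shows "wp n I reset s (\<lambda>t s'. t \<le> 100 * (n + 1) \<and> running n I s' m \<and> pot n s' \<le> int (pot_bound n))"
proof -
  obtain S w where rep: "rep n (s ''A'') m S w" and L: "s ''L'' 0 = off n m" and m: "0 < s ''Z'' 0 \<Longrightarrow> 0 < m"
    and pack: "packing n I m S w (\<lambda>x. s ''y'' (int x)) (s ''M'' 0)" and dl0: "0 < dl"
    and dvd: "\<And>i. i < m \<Longrightarrow> dl dvd w i"
    and y: "\<And>v. v \<in> ground n \<Longrightarrow> s ''y'' (int v) \<le> s ''Z'' (int v) \<and> s ''Z'' (int v) < s ''y'' (int v) + 3 * dl"
    and Z0: "s ''Z'' 0 \<le> s ''M'' 0"
    and w0: "0 < s ''Z'' 0 \<Longrightarrow> dl \<le> w 0"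
    using ap unfolding approx_def by auto
  let ?c = "Set ''d'' (Val ''w'') (Const 0)"
  define inv where "inv j s1 \<longleftrightarrow> (\<forall>x<j. s1 ''d'' (int x) = 0)" for j :: nat and s1 :: state
  have "wp n I (For ''w'' 0 ?c) s
    (\<lambda>t s'. t \<le> (n + 1) * (10 + 20) + 20 \<and> inv (n + 1) s' \<and> frame (insert ''w'' (mods ?c)) s s')"
  proof (rule wp_For[where inv = inv])
    fix j s1 assume "s1 ''w'' 0 = int j" "inv j s1"
    then show "wp n I ?c s1 (\<lambda>t s'. t \<le> 10 \<and> inv (j + 1) (update ''w'' 0 (int (j + 1)) s'))"
      by (simp add: wp_simps inv_def update_apply less_Suc_eq)
  qed (use n in \<open>auto simp: inv_def\<close>)
  then show ?thesis unfolding reset_def wp_Seq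
  proof (rule wp_mono, elim conjE)
    fix t s1 assume t: "t \<le> (n + 1) * (10 + 20) + 20" and inv: "inv (n + 1) s1"
      and fr: "frame (insert ''w'' (mods ?c)) s s1"
    let ?s2 = "update ''d'' 0 (-1) s1"
    have eq: "?s2 z = s z" if "z \<notin> {''w'', ''d''}" for z using fr that by (auto simp: frame_def update_apply)
    define d where "d x = (if x = 0 then -1 else 0 :: int)" for x :: nat
    have d2: "?s2 ''d'' (int x) = d x" if "x \<le> n" for x
      using inv that by (simp add: inv_def update_apply d_def)
    define d' where "d' = (\<lambda>x. ?s2 ''d'' (int x))"
    have d': "d' 0 = -1" "\<And>x. x \<in> ground n \<Longrightarrow> d' x = 0"
      using d2[of 0] d2 by (auto simp: d'_def d_def ground_def)
    define y Z where "y = (\<lambda>x. s ''y'' (int x))" and "Z = (\<lambda>x. s ''Z'' (int x))"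
    have SI: "S i \<subseteq> ground n" if "i < m" for i using rep that by (auto simp: rep_def)
    \<comment> \<open>The sink has label -1, so an arc to it demands just
      \<open>0 \<le> -1 + 1\<close>, while all other arcs join elements of label 0.\<close>
    have lab: "valid_labels (ground n) I d' (S i)" if "i < m" for i
      unfolding valid_labels_def using d' SI[OF that] by auto
    have un: "units dl Z y v \<le> 2" if "v \<in> ground n" for v
    proof -
      have "(Z v - y v) div dl * dl \<le> Z v - y v"
        using pos_mod_sign[OF dl0, of "Z v - y v"] div_mult_mod_eq[of "Z v - y v" dl] by linarith
      also have "\<dots> < 3 * dl" using y[OF that] by (simp add: y_def Z_def)
      finally have "(Z v - y v) div dl < 3" using dl0 by (simp only: mult_less_cancel_right_pos)
      then show ?thesis by (simp add: units_def)
    qed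
    have few: "(\<Sum>v\<in>ground n. units dl Z y v) \<le> 2 * int n"
      using sum_bounded_above[of "ground n" "units dl Z y" 2] un by simp
    have pr: "pr_inv n I dl Z m S w y d' (s ''M'' 0)"
      unfolding pr_inv_def using pack dl0 dvd y Z0 w0 lab d' m
      by (auto simp: y_def Z_def ground_def)
    have run: "running n I ?s2 m"
      unfolding running_def using rep L dl pr few
      by (intro exI[of _ S] exI[of _ w]) (simp add: eq y_def Z_def d'_def)
    have "pot n ?s2 = (\<Sum>v\<in>ground n. units dl Z y v * (d' v + 1)) + (2 * int n + 1) * (\<Sum>v\<in>ground n. int n - d' v)"
      unfolding pot_def potential_def using dl by (simp add: eq y_def Z_def d'_def)
    also have "\<dots> = (\<Sum>v\<in>ground n. units dl Z y v) + (2 * int n + 1) * (int n * int n)"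
      using d' by simp
    finally have "pot n ?s2 \<le> int (pot_bound n)" using few by (simp add: pot_bound_def algebra_simps)
    then show "wp n I (Set ''d'' (Const 0) (Const (-1))) s1 (\<lambda>t2 s'. t + t2 \<le> 100 * (n + 1) \<and>
      running n I s' m \<and> pot n s' \<le> int (pot_bound n))"
      using t run by (simp add: wp_Set)
  qed
qed

definition phase_time :: "nat \<Rightarrow> nat \<Rightarrow> nat" where
  "phase_time n m =
     (pot_bound n + 2) * ((m + pot_bound n + 1) * (1000 * (n + 1)\<^sup>2) + 20) + 1000 * (n + 1)"

text \<open>A phase adds at most \<open>pot_bound n\<close> blocks, however large the numbers are;
  this is what scaling achieves.\<close>

lemma wp_phase:
  assumes M: "matroid (ground n) I" and n: "s ''n'' 0 = int n"
    and ap: "approx n I s m (2 * dl) (2 * dl) (2 * dl)"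
    and k: "s ''kk'' 0 = int k + 1" and P: "s ''P'' (int k) = dl" and f: "s ''fail'' 0 = 0"
  shows "wp n I phase s (\<lambda>t s'. t \<le> phase_time n m \<and> s' ''kk'' 0 = int k \<and>
    (s' ''fail'' 0 = 0 \<and> (\<exists>m'\<le>m + pot_bound n. approx n I s' m' dl dl dl) \<or>
     s' ''fail'' 0 = 1 \<and> refuted n I (s' ''Z'')))"
proof -
  let ?s1 = "update ''dl'' 0 dl (update ''kk'' 0 (int k) s)"
  have ap1: "approx n I ?s1 m (2 * dl) (2 * dl) (2 * dl)" using ap by (simp add: approx_def update_apply)
  have "wp n I trim ?s1 (\<lambda>t s'. wp n I reset s' (\<lambda>t2 s'. wp n I saturate s' (\<lambda>t3 s'.
    20 + (t + (t2 + t3)) \<le> phase_time n m \<and> s' ''kk'' 0 = int k \<and>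
    (s' ''fail'' 0 = 0 \<and> (\<exists>m'\<le>m + pot_bound n. approx n I s' m' dl dl dl) \<or>
     s' ''fail'' 0 = 1 \<and> refuted n I (s' ''Z'')))))"
  proof (rule wp_frame[OF wp_trim[OF M _ ap1]], simp_all add: update_apply n del: mods_trim, elim conjE)
    fix t s2 assume t: "t \<le> 200 + 200 * n" and ap2: "approx n I s2 m dl dl (3 * dl)"
      and fr: "frame (mods trim) ?s1 s2"
    have eq: "s2 z = ?s1 z" if "z \<in> {''n'', ''dl'', ''kk'', ''fail'', ''Z''}" for z
      using frameD[OF fr, of z] that by auto
    have n2: "s2 ''n'' 0 = int n" and dl2: "s2 ''dl'' 0 = dl" and k2: "s2 ''kk'' 0 = int k" and f2: "s2 ''fail'' 0 = 0"
      using n f by (simp_all add: eq update_apply)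
    show "wp n I reset s2 (\<lambda>t2 s'. wp n I saturate s' (\<lambda>t3 s'.
      20 + (t + (t2 + t3)) \<le> phase_time n m \<and> s' ''kk'' 0 = int k \<and>
      (s' ''fail'' 0 = 0 \<and> (\<exists>m'\<le>m + pot_bound n. approx n I s' m' dl dl dl) \<or>
       s' ''fail'' 0 = 1 \<and> refuted n I (s' ''Z''))))"
    proof (rule wp_frame[OF wp_reset[OF n2 ap2 dl2]], elim conjE)
      fix t2 s3 assume t2: "t2 \<le> 100 * (n + 1)" and run: "running n I s3 m"
        and pot: "pot n s3 \<le> int (pot_bound n)" and fr3: "frame (mods reset) s2 s3"
      have eq3: "s3 z = s2 z" if "z \<in> {''n'', ''dl'', ''kk'', ''fail'', ''Z'', ''M''}" for z
        using frameD[OF fr3, of z] that by auto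
      have n3: "s3 ''n'' 0 = int n" and f3: "s3 ''fail'' 0 = 0" and dl3: "s3 ''dl'' 0 = dl" and k3: "s3 ''kk'' 0 = int k"
        using n2 f2 dl2 k2 by (simp_all add: eq3)
      show "wp n I saturate s3 (\<lambda>t3 s'.
        20 + (t + (t2 + t3)) \<le> phase_time n m \<and> s' ''kk'' 0 = int k \<and>
        (s' ''fail'' 0 = 0 \<and> (\<exists>m'\<le>m + pot_bound n. approx n I s' m' dl dl dl) \<or>
         s' ''fail'' 0 = 1 \<and> refuted n I (s' ''Z'')))"
      proof (rule wp_frame[OF wp_saturate[OF M n3 run pot f3]], elim conjE)
        fix t3 s4
        assume t3: "t3 \<le> (pot_bound n + 2) * ((m + pot_bound n + 1) * (1000 * (n + 1)\<^sup>2) + 20)"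
          and A: "s4 ''fail'' 0 = 0 \<and> (\<exists>m'\<le>m + pot_bound n. running n I s4 m') \<and> no_active n s4 \<or>
             s4 ''fail'' 0 = 1 \<and> refuted n I (s4 ''Z'')"
          and fr4: "frame (mods saturate) s3 s4"
        have eq4: "s4 z = s3 z" if "z \<in> {''n'', ''dl'', ''kk'', ''Z'', ''M''}" for z
          using frameD[OF fr4, of z] that by auto
        have dl4: "s4 ''dl'' 0 = dl" and k4: "s4 ''kk'' 0 = int k" using dl3 k3 by (simp_all add: eq4)
        have T: "20 + (t + (t2 + t3)) \<le> phase_time n m"
          unfolding phase_time_def using t t2 t3 by simp
        have "approx n I s4 m' dl dl dl" if run4: "running n I s4 m'" and na: "no_active n s4" for m'
        proof -
          obtain S w where R: "rep n (s4 ''A'') m' S w" "s4 ''L'' 0 = off n m'"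
            "pr_inv n I dl (\<lambda>x. s4 ''Z'' (int x)) m' S w (\<lambda>x. s4 ''y'' (int x)) (\<lambda>x. s4 ''d'' (int x)) (s4 ''M'' 0)"
            using run4 unfolding running_def dl4 by blast
          have MZ: "0 \<le> s4 ''Z'' 0" "s4 ''M'' 0 < s4 ''Z'' 0 + dl"
            using ap2 unfolding approx_def by (auto simp: eq4 eq3)
          show ?thesis
            unfolding approx_def using R MZ na dl4
            by (intro exI[of _ S] exI[of _ w]) (auto simp: pr_inv_def no_active_def)
        qed
        then have "s4 ''fail'' 0 = 0 \<and> (\<exists>m'\<le>m + pot_bound n. approx n I s4 m' dl dl dl) \<or>
           s4 ''fail'' 0 = 1 \<and> refuted n I (s4 ''Z'')" using A by blast
        then show "20 + (t + (t2 + t3)) \<le> phase_time n m \<and> s4 ''kk'' 0 = int k \<and>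
          (s4 ''fail'' 0 = 0 \<and> (\<exists>m'\<le>m + pot_bound n. approx n I s4 m' dl dl dl) \<or>
           s4 ''fail'' 0 = 1 \<and> refuted n I (s4 ''Z''))" using T k4 by blast
      qed
    qed
  qed
  then show ?thesis unfolding phase_def wp_Seq wp_Set using k P
    by (simp add: update_apply) (elim wp_mono, fastforce)
qed

text \<open>Feasibility means lying in a cone given by inequalities, which makes it easy to follow
  under scaling and subtraction. Its agreement with decomposability comes from the algorithm: a
  packing proves it, a failure yields a violated constraint.\<close>

definition feasible :: "nat \<Rightarrow> nat set set \<Rightarrow> (nat \<Rightarrow> int) \<Rightarrow> bool" where
  "feasible n I z \<longleftrightarrow> (\<forall>c. valid_constraint n I c \<longrightarrow> 0 \<le> dot n c z)"

lemma refuted_iff: "refuted n I Z \<longleftrightarrow> \<not> feasible n I (\<lambda>x. Z (int x))"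
  by (auto simp: refuted_def feasible_def not_le)

text \<open>Hence \<open>T\<close> lies in the minimal face of \<open>z\<close>.\<close>

definition supports :: "nat \<Rightarrow> nat set set \<Rightarrow> nat set \<Rightarrow> (nat \<Rightarrow> int) \<Rightarrow> bool" where
  "supports n I T z \<longleftrightarrow> T \<in> I \<and> (\<forall>c. valid_constraint n I c \<longrightarrow> dot n c (ivec T) \<le> dot n c z)"

lemma dot_packing:
  assumes "packing n I m S w y M" "\<And>v. v \<in> ground n \<Longrightarrow> z v = y v" "z 0 = M"
  shows "dot n c z = (\<Sum>i<m. w i * dot n c (ivec (S i)))"
proof -
  have z: "z v = (\<Sum>i<m. w i * ivec (S i) v)" if "v \<le> n" for v
  proof (cases "v = 0")
    case True
    then show ?thesis using assms by (simp add: packing_def ivec_def)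
  next
    case False
    then have "v \<in> ground n" using that by (simp add: ground_def)
    then show ?thesis using assms by (simp add: packing_def)
  qed
  have "dot n c z = (\<Sum>v\<le>n. \<Sum>i<m. c v * (w i * ivec (S i) v))"
    unfolding dot_def by (rule sum.cong) (simp_all add: z sum_distrib_left)
  also have "\<dots> = (\<Sum>i<m. \<Sum>v\<le>n. c v * (w i * ivec (S i) v))" by (rule sum.swap)
  also have "\<dots> = (\<Sum>i<m. w i * dot n c (ivec (S i)))"
    unfolding dot_def sum_distrib_left by (intro sum.cong refl) (simp add: mult.left_commute)
  finally show ?thesis .
qed

lemma packing_feasible:
  assumes "packing n I m S w y M" "\<And>v. v \<in> ground n \<Longrightarrow> z v = y v" "z 0 = M"
  shows "feasible n I z"
  unfolding feasible_def
proof (intro allI impI)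
  fix c assume "valid_constraint n I c"
  then have "0 \<le> (\<Sum>i<m. w i * dot n c (ivec (S i)))"
    using assms(1) by (intro sum_nonneg mult_nonneg_nonneg) (auto simp: packing_def valid_constraint_def)
  also have "\<dots> = dot n c z" by (rule dot_packing[OF assms(1), symmetric]) (use assms in auto)
  finally show "0 \<le> dot n c z" .
qed

text \<open>\<open>dot n c z\<close> is a sum of nonnegative contributions, so a single set of
  weight at least 1 contributes no more than the total.\<close>

lemma packing_supports:
  assumes "packing n I m S w y M" "\<And>v. v \<in> ground n \<Longrightarrow> z v = y v" "z 0 = M" and i: "i < m" "1 \<le> w i"
  shows "supports n I (S i) z"
  unfolding supports_def
proof (intro allI impI conjI)
  have S: "\<And>j. j < m \<Longrightarrow> S j \<in> I \<and> 0 \<le> w j" using assms(1) by (simp add: packing_def)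
  then show "S i \<in> I" using i by blast
  fix c assume c: "valid_constraint n I c"
  then have nn: "0 \<le> dot n c (ivec (S j))" if "j < m" for j
    using S that by (simp add: valid_constraint_def)
  have "dot n c (ivec (S i)) \<le> w i * dot n c (ivec (S i))"
    using mult_right_mono[OF i(2) nn[OF i(1)]] by simp
  also have "\<dots> \<le> (\<Sum>j<m. w j * dot n c (ivec (S j)))"
    by (rule member_le_sum[of i "{..<m}" "\<lambda>j. w j * dot n c (ivec (S j))"]) (use i S nn in auto)
  also have "\<dots> = dot n c z" by (rule dot_packing[OF assms(1), symmetric]) (use assms in auto)
  finally show "dot n c (ivec (S i)) \<le> dot n c z" .
qed

section \<open>The feasibility test\<close>

definition check_sign :: com where
  "check_sign = assign ''fail'' (Const 0) ;;
     For ''w'' 0 (Cond (Less (Get ''Z'' (Val ''w'')) (Const 0)) (assign ''fail'' (Const 1)) Skip)"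

definition clear :: com where
  "clear = For ''w'' 0 (Set ''A'' (Val ''w'') (Const 0) ;; Set ''y'' (Val ''w'') (Const 0))"

text \<open>The empty set with weight \<open>2 ^ J\<close> exceeds a positive mass below
  \<open>2 ^ J\<close> by less than one step. For mass 0 the excess would be a full step, so the
  weight is 0 then.\<close>

definition start :: com where
  "start = Cond (Less (Const 0) (Get ''Z'' (Const 0))) (Set ''A'' (Const 0) (Get ''P'' (Val ''J''))) Skip ;;
     assign ''M'' (Get ''A'' (Const 0)) ;; assign ''L'' (Plus (Val ''n'') (Const 1)) ;; assign ''kk'' (Val ''J'')"

definition decompose :: com where
  "decompose = check_sign ;; clear ;; start ;;
     While (Conj (Less (Const 0) (Val ''kk'')) (Eq (Val ''fail'') (Const 0))) phase"

lemma mods_check_sign [simp]: "mods check_sign = {''fail'', ''w''}"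
  by (auto simp: check_sign_def)

lemma mods_clear [simp]: "mods clear = {''w'', ''A'', ''y''}"
  by (auto simp: clear_def)

lemma mods_start [simp]: "mods start = {''A''} \<union> ({''M''} \<union> ({''L''} \<union> {''kk''}))"
  by (simp add: start_def)

lemma mods_decompose [simp]:
  "mods decompose = mods check_sign \<union> (mods clear \<union> (mods start \<union> mods phase))"
  by (simp only: decompose_def mods.simps)

lemma wp_check_sign:
  assumes n: "s ''n'' 0 = int n"
  shows "wp n I check_sign s (\<lambda>t s'. t \<le> 60 * (n + 1) \<and>
    s' ''fail'' 0 = (if \<forall>x\<le>n. 0 \<le> s ''Z'' (int x) then 0 else 1))"
proof -
  let ?c = "Cond (Less (Get ''Z'' (Val ''w'')) (Const 0)) (assign ''fail'' (Const 1)) Skip"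
  let ?s0 = "update ''fail'' 0 0 s"
  define inv where "inv j s1 \<longleftrightarrow> s1 ''fail'' 0 = (if \<forall>x<j. 0 \<le> s ''Z'' (int x) then 0 else 1)"
    for j :: nat and s1 :: state
  have "wp n I (For ''w'' 0 ?c) ?s0
    (\<lambda>t s'. t \<le> (n + 1) * (15 + 20) + 20 \<and> inv (n + 1) s' \<and> frame (insert ''w'' (mods ?c)) ?s0 s')"
  proof (rule wp_For[where inv = inv])
    fix j s1 assume j: "s1 ''w'' 0 = int j" and inv: "inv j s1"
      and fr: "frame (insert ''w'' (mods ?c)) ?s0 s1"
    have "s1 ''Z'' = s ''Z''" using fr by (auto simp: frame_def update_apply)
    then show "wp n I ?c s1 (\<lambda>t s'. t \<le> 15 \<and> inv (j + 1) (update ''w'' 0 (int (j + 1)) s'))"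
      using j inv by (auto simp: wp_simps inv_def update_apply less_Suc_eq)
  qed (use n in \<open>auto simp: inv_def update_apply\<close>)
  then show ?thesis unfolding check_sign_def wp_Seq wp_Set aval.simps acost.simps
    by (rule wp_mono) (auto simp: inv_def less_Suc_eq_le)
qed

lemma wp_clear:
  assumes n: "s ''n'' 0 = int n"
  shows "wp n I clear s (\<lambda>t s'. t \<le> 60 * (n + 1) \<and> (\<forall>x\<le>n. s' ''A'' (int x) = 0 \<and> s' ''y'' (int x) = 0))"
proof -
  let ?c = "Set ''A'' (Val ''w'') (Const 0) ;; Set ''y'' (Val ''w'') (Const 0)"
  define inv where "inv j s1 \<longleftrightarrow> (\<forall>x<j. s1 ''A'' (int x) = 0 \<and> s1 ''y'' (int x) = 0)"
    for j :: nat and s1 :: state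
  have "wp n I (For ''w'' 0 ?c) s
    (\<lambda>t s'. t \<le> (n + 1) * (15 + 20) + 20 \<and> inv (n + 1) s' \<and> frame (insert ''w'' (mods ?c)) s s')"
  proof (rule wp_For[where inv = inv])
    fix j s1 assume "s1 ''w'' 0 = int j" "inv j s1"
    then show "wp n I ?c s1 (\<lambda>t s'. t \<le> 15 \<and> inv (j + 1) (update ''w'' 0 (int (j + 1)) s'))"
      by (auto simp: wp_simps inv_def update_apply less_Suc_eq)
  qed (use n in \<open>auto simp: inv_def update_apply\<close>)
  then show ?thesis unfolding clear_def by (rule wp_mono) (auto simp: inv_def less_Suc_eq_le)
qed

lemma wp_start:
  "wp n I start s (\<lambda>t s'. t \<le> 40 \<and>
     s' ''A'' = (s ''A'')(0 := (if 0 < s ''Z'' 0 then s ''P'' (s ''J'' 0) else s ''A'' 0)) \<and>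
     s' ''M'' 0 = s' ''A'' 0 \<and> s' ''L'' 0 = s ''n'' 0 + 1 \<and> s' ''kk'' 0 = s ''J'' 0)"
  unfolding start_def by (auto simp: wp_simps update_apply)

definition decompose_time :: "nat \<Rightarrow> nat \<Rightarrow> nat" where
  "decompose_time n J = J * (phase_time n (1 + J * pot_bound n) + 20) + 300 * (n + 1)"

lemma wp_decompose:
  assumes M: "matroid (ground n) I" and n: "s ''n'' 0 = int n"
    and J: "s ''J'' 0 = int J" "\<And>i. i \<le> J \<Longrightarrow> s ''P'' (int i) = 2 ^ i"
    and Z: "\<And>x. x \<le> n \<Longrightarrow> s ''Z'' (int x) < 2 ^ J"
  shows "wp n I decompose s (\<lambda>t s'. t \<le> decompose_time n J \<and>
    s' ''fail'' 0 = (if feasible n I (\<lambda>x. s ''Z'' (int x)) then 0 else 1) \<and>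
    (feasible n I (\<lambda>x. s ''Z'' (int x)) \<and> 0 < s ''Z'' 0 \<longrightarrow>
      supports n I {x \<in> ground n. s' ''A'' (int x) \<noteq> 0} (\<lambda>x. s ''Z'' (int x))))"
proof -
  define Z where "Z = (\<lambda>x. s ''Z'' (int x))"
  let ?b = "Conj (Less (Const 0) (Val ''kk'')) (Eq (Val ''fail'') (Const 0))"
  \<comment> \<open>After \<open>J - k\<close> phases, each has contributed at most
    \<open>pot_bound n\<close> blocks to the single initial one.\<close>
  define inv where "inv k s1 \<longleftrightarrow>
    s1 ''fail'' 0 = 0 \<and> s1 ''kk'' 0 = int k \<and> k \<le> J \<and>
      (\<exists>m. m \<le> 1 + (J - k) * pot_bound n \<and> approx n I s1 m (2 ^ k) (2 ^ k) (2 ^ k)) \<or>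
    s1 ''fail'' 0 = 1 \<and> \<not> feasible n I Z" for k :: nat and s1
  let ?T = "phase_time n (1 + J * pot_bound n)"
  have loop: "wp n I (While ?b phase) s1
     (\<lambda>t s'. t \<le> J * (?T + 9 + 1) + 9 + 1 \<and> (\<exists>k'\<le>J. inv k' s') \<and> \<not> bval ?b s' \<and> frame (mods phase) s1 s')"
    if inv1: "inv J s1" and eq: "\<forall>z\<in>{''n'', ''Z'', ''P''}. s1 z = s z" for s1
  proof (rule wp_While)
    show "inv J s1" by (rule inv1)
    fix k s2 assume k: "inv k s2" and b: "bval ?b s2" and fr: "frame (mods phase) s1 s2"
    have eq2: "s2 z = s z" if "z \<in> {''n'', ''Z'', ''P''}" for z
    proof -
      have "z \<notin> mods phase" using that by auto
      then show ?thesis using frameD[OF fr, of z] bspec[OF eq that] by simp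
    qed
    from k b obtain m where m: "m \<le> 1 + (J - k) * pot_bound n" "approx n I s2 m (2 ^ k) (2 ^ k) (2 ^ k)"
      and kk: "s2 ''kk'' 0 = int k" "k \<le> J" "s2 ''fail'' 0 = 0" "0 < k" unfolding inv_def by auto
    obtain k' where k': "k = Suc k'" using kk by (cases k) auto
    have n2: "s2 ''n'' 0 = int n" using n by (simp add: eq2)
    have P2: "s2 ''P'' (int k') = 2 ^ k'" using J(2)[of k'] kk(2) k' by (simp add: eq2)
    have ap: "approx n I s2 m (2 * 2 ^ k') (2 * 2 ^ k') (2 * 2 ^ k')" using m(2) unfolding k' by simp
    have kk2: "s2 ''kk'' 0 = int k' + 1" using kk k' by simp
    show "wp n I phase s2 (\<lambda>t s'. t \<le> ?T \<and> (\<exists>k'<k. inv k' s'))"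
    proof (rule wp_frame[OF wp_phase[OF M n2 ap kk2 P2 kk(3)]], elim conjE)
      fix t s3
      assume t: "t \<le> phase_time n m" and kk3: "s3 ''kk'' 0 = int k'"
        and A: "s3 ''fail'' 0 = 0 \<and> (\<exists>m'\<le>m + pot_bound n. approx n I s3 m' (2 ^ k') (2 ^ k') (2 ^ k')) \<or>
          s3 ''fail'' 0 = 1 \<and> refuted n I (s3 ''Z'')"
        and fr3: "frame (mods phase) s2 s3"
      have "(J - k) * pot_bound n \<le> J * pot_bound n" by (rule mult_right_mono) simp_all
      then have mJ: "m \<le> 1 + J * pot_bound n" using m(1) by linarith
      then have "phase_time n m \<le> ?T"
        unfolding phase_time_def by (intro add_right_mono mult_left_mono mult_right_mono) simp_all
      moreover have "s3 ''Z'' = s ''Z''" using frameD[OF fr3, of "''Z''"] eq2[of "''Z''"] by simp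
      then have "inv k' s3"
        using A
      proof (elim disjE conjE exE)
        fix m' assume m': "s3 ''fail'' 0 = 0" "m' \<le> m + pot_bound n" "approx n I s3 m' (2 ^ k') (2 ^ k') (2 ^ k')"
        have "(J - k') * pot_bound n = (J - k) * pot_bound n + pot_bound n"
        proof -
          have "J - k' = Suc (J - k)" using kk k' by simp
          then show ?thesis by simp
        qed
        then have "m' \<le> 1 + (J - k') * pot_bound n" using m'(2) m(1) by linarith
        then show "inv k' s3" unfolding inv_def using m' kk3 kk(2) k' by auto
      next
        assume "s3 ''fail'' 0 = 1" "refuted n I (s3 ''Z'')" "s3 ''Z'' = s ''Z''"
        then show "inv k' s3" unfolding inv_def refuted_iff Z_def by auto
      qed
      ultimately show "t \<le> ?T \<and> (\<exists>k'<k. inv k' s3)" using t k' by (meson le_trans lessI)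
    qed
  qed simp
  \<comment> \<open>A negative entry violates a unit constraint. It has to be caught beforehand,
    because the initial cover \<open>y = 0\<close> must not exceed the target.\<close>
  have neg: "\<not> feasible n I Z" if "x \<le> n" "Z x < 0" for x
    using valid_constraint_unit[OF that(1), of I] that unfolding feasible_def by (metis dot_unit not_le)
  show ?thesis unfolding decompose_def wp_Seq
  proof (rule wp_frame[OF wp_check_sign[where s = s, OF n]], elim conjE)
    fix t s1 assume t: "t \<le> 60 * (n + 1)" and fail: "s1 ''fail'' 0 = (if \<forall>x\<le>n. 0 \<le> s ''Z'' (int x) then 0 else 1)"
      and fr: "frame (mods check_sign) s s1"
    have eq1: "s1 z = s z" if "z \<in> {''n'', ''Z'', ''P'', ''J''}" for z using frameD[OF fr, of z] that by auto
    have n1: "s1 ''n'' 0 = int n" using n by (simp add: eq1)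
    show "wp n I clear s1 (\<lambda>t1 s1. wp n I start s1 (\<lambda>t1a s1. wp n I (While ?b phase) s1 (\<lambda>t2 s2.
      t + (t1 + (t1a + t2)) \<le> decompose_time n J \<and>
      s2 ''fail'' 0 = (if feasible n I (\<lambda>x. s ''Z'' (int x)) then 0 else 1) \<and>
      (feasible n I (\<lambda>x. s ''Z'' (int x)) \<and> 0 < s ''Z'' 0 \<longrightarrow>
        supports n I {x \<in> ground n. s2 ''A'' (int x) \<noteq> 0} (\<lambda>x. s ''Z'' (int x))))))"
    proof (rule wp_frame[OF wp_clear[where s = s1, OF n1]], elim conjE)
      fix t1 :: nat and s2 assume t1: "t1 \<le> 60 * (n + 1)"
        and cl: "\<forall>x\<le>n. s2 ''A'' (int x) = 0 \<and> s2 ''y'' (int x) = 0" and fr1: "frame (mods clear) s1 s2"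
      have eq2: "s2 z = s1 z" if "z \<in> {''n'', ''Z'', ''P'', ''J'', ''fail''}" for z
        using frameD[OF fr1, of z] that by auto
      show "wp n I start s2 (\<lambda>t1a s1. wp n I (While ?b phase) s1 (\<lambda>t2 s2.
      t + (t1 + (t1a + t2)) \<le> decompose_time n J \<and>
      s2 ''fail'' 0 = (if feasible n I (\<lambda>x. s ''Z'' (int x)) then 0 else 1) \<and>
      (feasible n I (\<lambda>x. s ''Z'' (int x)) \<and> 0 < s ''Z'' 0 \<longrightarrow>
        supports n I {x \<in> ground n. s2 ''A'' (int x) \<noteq> 0} (\<lambda>x. s ''Z'' (int x)))))"
      proof (rule wp_frame[OF wp_start], elim conjE)
        fix t2 :: nat and s3 assume t2: "t2 \<le> 40"
          and A3: "s3 ''A'' = (s2 ''A'')(0 := (if 0 < s2 ''Z'' 0 then s2 ''P'' (s2 ''J'' 0) else s2 ''A'' 0))"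
          and M3: "s3 ''M'' 0 = s3 ''A'' 0" and L3: "s3 ''L'' 0 = s2 ''n'' 0 + 1" and k3: "s3 ''kk'' 0 = s2 ''J'' 0"
          and fr2: "frame (mods start) s2 s3"
        have eq3: "s3 z = s2 z" if "z \<in> {''n'', ''Z'', ''P'', ''J'', ''fail'', ''y''}" for z
          using frameD[OF fr2, of z] that by auto
        have inv3: "inv J s3"
        proof (cases "\<forall>x\<le>n. 0 \<le> Z x")
          case False
          then have "\<not> feasible n I Z" using neg by (meson not_le)
          moreover have "s3 ''fail'' 0 = 1" using False fail by (simp add: eq3 eq2 Z_def)
          ultimately show ?thesis unfolding inv_def by blast
        next
          case True
          define a :: int where "a = (if 0 < Z 0 then 2 ^ J else 0)"
          have A0: "s3 ''A'' 0 = a" using A3 cl[rule_format, of 0] J by (simp add: a_def Z_def eq2 eq1)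
          have Ax: "s3 ''A'' (int x) = 0" if "x \<in> ground n" for x using A3 cl that by (simp add: ground_def)
          have y3: "s3 ''y'' (int x) = 0" if "x \<le> n" for x using cl that by (simp add: eq3)
          have Z3: "s3 ''Z'' (int x) = Z x" "s3 ''Z'' 0 = Z 0" for x by (simp_all add: eq3 eq2 eq1 Z_def)
          have Zlt: "Z x < 2 ^ J" if "x \<le> n" for x using Z[OF that] by (simp add: Z_def)
          have "packing n I 1 (\<lambda>_. {}) (\<lambda>_. a) (\<lambda>x. s3 ''y'' (int x)) (s3 ''M'' 0)"
            using matroid_empty[OF M] y3 A0 M3 by (auto simp: packing_def a_def ivec_def ground_def)
          moreover have "rep n (s3 ''A'') 1 (\<lambda>_. {}) (\<lambda>_. a)" using A0 Ax by (auto simp: rep_def)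
          moreover have "s3 ''L'' 0 = off n 1" using L3 n by (simp add: off_def eq2 eq1)
          ultimately have "approx n I s3 1 (2 ^ J) (2 ^ J) (2 ^ J)"
            unfolding approx_def using A0 M3 y3 True Zlt
            by (intro exI[of _ "\<lambda>_. {}"] exI[of _ "\<lambda>_. a"]) (auto simp: Z3 a_def ground_def intro: less_imp_le)
          moreover have "s3 ''fail'' 0 = 0" using True fail by (simp add: eq3 eq2 Z_def)
          moreover have "s3 ''kk'' 0 = int J" using k3 J by (simp add: eq2 eq1)
          ultimately show ?thesis unfolding inv_def by auto
        qed
        have eq: "\<forall>z\<in>{''n'', ''Z'', ''P''}. s3 z = s z" by (simp add: eq1 eq2 eq3)
        show "wp n I (While ?b phase) s3 (\<lambda>t3 s2.
          t + (t1 + (t2 + t3)) \<le> decompose_time n J \<and>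
          s2 ''fail'' 0 = (if feasible n I (\<lambda>x. s ''Z'' (int x)) then 0 else 1) \<and>
          (feasible n I (\<lambda>x. s ''Z'' (int x)) \<and> 0 < s ''Z'' 0 \<longrightarrow>
            supports n I {x \<in> ground n. s2 ''A'' (int x) \<noteq> 0} (\<lambda>x. s ''Z'' (int x))))"
        proof (rule wp_mono[OF loop[OF inv3 eq]], elim conjE exE)
          fix t3 s4 k
          assume t3: "t3 \<le> J * (?T + 9 + 1) + 9 + 1" and k: "inv k s4" and nb: "\<not> bval ?b s4"
            and fr4: "frame (mods phase) s3 s4"
          have "J * (?T + 9 + 1) \<le> J * (?T + 20)" by (rule mult_left_mono) simp_all
          then have "t3 \<le> J * (?T + 20) + 10" using t3 by linarith
          then have T: "t + (t1 + (t2 + t3)) \<le> decompose_time n J"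
            unfolding decompose_time_def
          proof -
            have "t3 \<le> E + 10 \<Longrightarrow> t + (t1 + (t2 + t3)) \<le> E + 300 * (n + 1)" for E
              using t t1 t2 by simp
            then show "t3 \<le> J * (?T + 20) + 10 \<Longrightarrow> t + (t1 + (t2 + t3)) \<le> J * (?T + 20) + 300 * (n + 1)" .
          qed
          have Z4: "s4 ''Z'' = s ''Z''" using frameD[OF fr4, of "''Z''"] eq by simp
          from k have "s4 ''fail'' 0 = (if feasible n I Z then 0 else 1) \<and>
            (feasible n I Z \<and> 0 < Z 0 \<longrightarrow> supports n I {x \<in> ground n. s4 ''A'' (int x) \<noteq> 0} Z)"
            unfolding inv_def
          proof (elim disjE conjE exE)
            fix m assume f: "s4 ''fail'' 0 = 0" and kk: "s4 ''kk'' 0 = int k"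
              and ap: "approx n I s4 m (2 ^ k) (2 ^ k) (2 ^ k)"
            have k0: "k = 0" using nb f kk by simp
            obtain S w where rep: "rep n (s4 ''A'') m S w"
              and pack: "packing n I m S w (\<lambda>x. s4 ''y'' (int x)) (s4 ''M'' 0)"
              and y: "\<forall>v\<in>ground n. s4 ''y'' (int v) \<le> s4 ''Z'' (int v) \<and> s4 ''Z'' (int v) < s4 ''y'' (int v) + 2 ^ k"
              and Z0': "s4 ''Z'' 0 \<le> s4 ''M'' 0" "s4 ''M'' 0 < s4 ''Z'' 0 + 2 ^ k"
              and w0': "0 < s4 ''Z'' 0 \<longrightarrow> 0 < m \<and> 2 ^ k \<le> w 0"
              using ap unfolding approx_def by blast
            \<comment> \<open>With step 1 the bounds leave no gap: the cover equals the target, and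
              the total weight equals the mass.\<close>
            have yv: "Z v = s4 ''y'' (int v)" if "v \<in> ground n" for v
              using bspec[OF y that] unfolding k0 Z4 by (simp add: Z_def)
            have Z0: "Z 0 = s4 ''M'' 0" using Z0' unfolding k0 Z4 by (simp add: Z_def)
            have w0: "0 < Z 0 \<Longrightarrow> 0 < m \<and> 1 \<le> w 0" using w0' unfolding k0 Z4 by (simp add: Z_def)
            have "supports n I (S 0) Z" if "0 < Z 0"
              by (rule packing_supports[OF pack]) (use yv Z0 w0[OF that] in auto)
            moreover have "S 0 = {x \<in> ground n. s4 ''A'' (int x) \<noteq> 0}" if "0 < Z 0"
              using rep w0[OF that] by (simp add: rep_def)
            moreover have "feasible n I Z" by (rule packing_feasible[OF pack]) (use yv Z0 in auto)
            ultimately show ?thesis using f by auto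
          qed auto
          then show "t + (t1 + (t2 + t3)) \<le> decompose_time n J \<and>
            s4 ''fail'' 0 = (if feasible n I (\<lambda>x. s ''Z'' (int x)) then 0 else 1) \<and>
            (feasible n I (\<lambda>x. s ''Z'' (int x)) \<and> 0 < s ''Z'' 0 \<longrightarrow>
              supports n I {x \<in> ground n. s4 ''A'' (int x) \<noteq> 0} (\<lambda>x. s ''Z'' (int x)))"
            using T by (simp add: Z_def)
        qed
      qed
    qed
  qed
qed

section \<open>Peeling off the sets one by one\<close>

lemma bit_length_le: "\<bar>x\<bar> < 2 ^ L \<Longrightarrow> bit_length x \<le> L"
  unfolding bit_length_def by (rule floorlog_leI) (simp_all add: nat_less_iff)

text \<open>Numerators and common denominator grow by the same factor, so the vector
  \<open>X / D\<close> is unchanged.\<close>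

definition scale_up :: com where
  "scale_up = For ''w'' 0 (Set ''X'' (Val ''w'') (Times (Get ''X'' (Val ''w'')) (Val ''F''))) ;;
     assign ''D'' (Times (Val ''D'') (Val ''F''))"

text \<open>The powers of two are tabulated by doubling. The table supplies the step lengths of the
  scaling phases and of the bisection, so neither of them multiplies or divides.\<close>

definition powers :: com where
  "powers = assign ''J'' (Const 0) ;; Set ''P'' (Const 0) (Const 1) ;;
     While (Neg (Less (Get ''X'' (Const 0)) (Get ''P'' (Val ''J''))))
       (Set ''P'' (Plus (Val ''J'') (Const 1)) (Plus (Get ''P'' (Val ''J'')) (Get ''P'' (Val ''J''))) ;;
        assign ''J'' (Plus (Val ''J'') (Const 1)))"

definition copy_target :: com where
  "copy_target = For ''w'' 0 (Set ''Z'' (Val ''w'') (Get ''X'' (Val ''w'')))"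

text \<open>The set is saved because every later probe overwrites \<open>A\<close>. Cell 0 of
  \<open>S\<close> is 1, as in \<open>ivec\<close>, so that a subtraction lowers the mass as
  well.\<close>

definition store :: com where
  "store = For ''w'' 1 (Set ''S'' (Val ''w'') (Get ''A'' (Val ''w'')) ;;
       Set ''out_set'' (Plus (Val ''ko'') (Val ''w'')) (Get ''A'' (Val ''w''))) ;;
     Set ''S'' (Const 0) (Const 1)"

definition subtract :: com where
  "subtract = For ''w'' 0 (Cond (Eq (Get ''S'' (Val ''w'')) (Const 0))
     (Set ''Z'' (Val ''w'') (Get ''X'' (Val ''w'')))
     (Set ''Z'' (Val ''w'') (Minus (Get ''X'' (Val ''w'')) (Get ''P'' (Val ''j'')))))"

definition accept :: com where
  "accept = For ''w'' 0 (Set ''X'' (Val ''w'') (Get ''Z'' (Val ''w''))) ;;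
     assign ''l'' (Plus (Val ''l'') (Get ''P'' (Val ''j'')))"

definition probe :: com where
  "probe = assign ''j'' (Minus (Val ''j'') (Const 1)) ;; subtract ;; decompose ;;
     Cond (Eq (Val ''fail'') (Const 0)) accept Skip"

definition search :: com where
  "search = assign ''l'' (Const 0) ;; assign ''j'' (Val ''J'') ;;
     While (Less (Const 0) (Val ''j'')) probe"

definition emit :: com where
  "emit = Set ''out_num'' (Val ''k'') (Val ''l'') ;; Set ''out_den'' (Val ''k'') (Val ''D'') ;;
     assign ''k'' (Plus (Val ''k'') (Const 1)) ;; assign ''ko'' (Plus (Val ''ko'') (Val ''n''))"

definition step :: com where
  "step = scale_up ;; powers ;; copy_target ;; decompose ;; store ;; search ;; emit"

lemma mods_blocks [simp]:
  "mods scale_up = {''w'', ''X''} \<union> {''D''}" "mods powers = {''J''} \<union> ({''P''} \<union> ({''P''} \<union> {''J''}))"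
  "mods copy_target = {''w'', ''Z''}" "mods store = {''w'', ''S'', ''out_set''} \<union> {''S''}"
  "mods subtract = {''w'', ''Z''} \<union> {''Z''}" "mods accept = {''w'', ''X''} \<union> {''l''}"
  "mods emit = {''out_num''} \<union> ({''out_den''} \<union> ({''k''} \<union> {''ko''}))"
  by (auto simp: scale_up_def powers_def copy_target_def store_def subtract_def accept_def emit_def)

lemma mods_probe [simp]:
  "mods probe = {''j''} \<union> (mods subtract \<union> (mods decompose \<union> (mods accept \<union> {})))"
  by (simp only: probe_def mods.simps)

lemma mods_search [simp]: "mods search = {''l''} \<union> ({''j''} \<union> mods probe)"
  by (simp only: search_def mods.simps)

section \<open>Specifications of the building blocks\<close>

lemma wp_scale_up:
  assumes n: "s ''n'' 0 = int n" and F: "bit_length (s ''F'' 0) \<le> L"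
    and X: "\<And>x. x \<le> n \<Longrightarrow> bit_length (s ''X'' (int x)) \<le> L" and D: "bit_length (s ''D'' 0) \<le> L"
  shows "wp n I scale_up s (\<lambda>t s'. t \<le> (n + 1) * (4 * L + 100) \<and>
    (\<forall>x\<le>n. s' ''X'' (int x) = s ''X'' (int x) * s ''F'' 0) \<and> s' ''D'' 0 = s ''D'' 0 * s ''F'' 0)"
proof -
  let ?c = "Set ''X'' (Val ''w'') (Times (Get ''X'' (Val ''w'')) (Val ''F''))"
  define inv where "inv j s1 \<longleftrightarrow>
      (\<forall>x\<le>n. s1 ''X'' (int x) = (if x < j then s ''X'' (int x) * s ''F'' 0 else s ''X'' (int x)))"
    for j :: nat and s1 :: state
  have "wp n I (For ''w'' 0 ?c) s
    (\<lambda>t s'. t \<le> (n + 1) * ((2 * L + 20) + 20) + 20 \<and> inv (n + 1) s' \<and> frame (insert ''w'' (mods ?c)) s s')"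
  proof (rule wp_For[where inv = inv])
    fix j s1 assume j: "j \<le> n" "s1 ''w'' 0 = int j" and inv: "inv j s1"
      and fr: "frame (insert ''w'' (mods ?c)) s s1"
    have F1: "s1 ''F'' = s ''F''" using fr by (simp add: frame_def)
    have Xj: "s1 ''X'' (int j) = s ''X'' (int j)" using inv j by (simp add: inv_def)
    have "inv (j + 1) (update ''w'' 0 (int (j + 1)) (update ''X'' (int j) (s ''X'' (int j) * s ''F'' 0) s1))"
      using inv j by (auto simp: inv_def update_apply less_Suc_eq)
    then show "wp n I ?c s1 (\<lambda>t s'. t \<le> 2 * L + 20 \<and> inv (j + 1) (update ''w'' 0 (int (j + 1)) s'))"
      using j F X[OF j(1)] by (simp add: wp_Set F1 Xj)
  qed (use n in \<open>auto simp: inv_def update_apply\<close>)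
  then show ?thesis unfolding scale_up_def wp_Seq
  proof (rule wp_mono, elim conjE)
    fix t s1 assume t: "t \<le> (n + 1) * ((2 * L + 20) + 20) + 20" and inv: "inv (n + 1) s1"
      and fr: "frame (insert ''w'' (mods ?c)) s s1"
    have eq: "s1 ''F'' = s ''F''" "s1 ''D'' = s ''D''" using fr by (simp_all add: frame_def)
    have "t + (2 * L + 30) \<le> (n + 1) * (4 * L + 100)" using t by (simp add: algebra_simps)
    then show "wp n I (assign ''D'' (Times (Val ''D'') (Val ''F''))) s1 (\<lambda>t2 s'.
      t + t2 \<le> (n + 1) * (4 * L + 100) \<and>
      (\<forall>x\<le>n. s' ''X'' (int x) = s ''X'' (int x) * s ''F'' 0) \<and> s' ''D'' 0 = s ''D'' 0 * s ''F'' 0)"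
      using inv F D by (auto simp: wp_Set update_apply eq inv_def)
  qed
qed

lemma wp_powers:
  assumes X: "0 \<le> s ''X'' 0" "s ''X'' 0 < 2 ^ L"
  shows "wp n I powers s (\<lambda>t s'. t \<le> L * 60 + 40 \<and>
    (\<exists>J\<le>L. s' ''J'' 0 = int J \<and> s ''X'' 0 < 2 ^ J \<and> (\<forall>i\<le>J. s' ''P'' (int i) = 2 ^ i)))"
proof -
  let ?b = "Neg (Less (Get ''X'' (Const 0)) (Get ''P'' (Val ''J'')))"
  let ?c = "Set ''P'' (Plus (Val ''J'') (Const 1)) (Plus (Get ''P'' (Val ''J'')) (Get ''P'' (Val ''J''))) ;;
        assign ''J'' (Plus (Val ''J'') (Const 1))"
  let ?s0 = "update ''P'' 0 1 (update ''J'' 0 0 s)"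
  define inv where "inv k s1 \<longleftrightarrow> (\<exists>J. J + k = L \<and> s1 ''J'' 0 = int J \<and> (\<forall>i\<le>J. s1 ''P'' (int i) = 2 ^ i))"
    for k :: nat and s1 :: state
  have "wp n I (While ?b ?c) ?s0
    (\<lambda>t s'. t \<le> L * (40 + 10 + 1) + 10 + 1 \<and> (\<exists>k'\<le>L. inv k' s') \<and> \<not> bval ?b s' \<and> frame (mods ?c) ?s0 s')"
  proof (rule wp_While)
    show "inv L ?s0" unfolding inv_def by (auto simp: update_apply)
    fix k s1 assume k: "inv k s1" and b: "bval ?b s1" and fr: "frame (mods ?c) ?s0 s1"
    then obtain J where J: "J + k = L" "s1 ''J'' 0 = int J" "\<forall>i\<le>J. s1 ''P'' (int i) = 2 ^ i"
      unfolding inv_def by auto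
    have "s1 ''X'' = s ''X''" using fr by (simp add: frame_def update_apply)
    then have "2 ^ J \<le> s ''X'' 0" using b J by simp
    then have "J < L" using X by (metis leD le_less_trans not_less power_increasing one_le_numeral order_trans)
    have "inv (k - 1) (update ''J'' 0 (int J + 1) (update ''P'' (int J + 1) (2 ^ J + 2 ^ J) s1))"
      unfolding inv_def using J \<open>J < L\<close>
      by (intro exI[of _ "Suc J"]) (auto simp: update_apply le_Suc_eq)
    moreover have "k - 1 < k" using J \<open>J < L\<close> by simp
    ultimately have "\<exists>k'<k. inv k' (update ''J'' 0 (int J + 1) (update ''P'' (int J + 1) (2 ^ J + 2 ^ J) s1))"
      by blast
    then show "wp n I ?c s1 (\<lambda>t s'. t \<le> 40 \<and> (\<exists>k'<k. inv k' s'))"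
      using J by (simp add: wp_simps) (simp add: update_apply)
  qed simp
  then show ?thesis unfolding powers_def wp_Seq wp_Set aval.simps acost.simps
  proof (rule wp_mono, elim conjE exE)
    fix t s' k assume t: "t \<le> L * (40 + 10 + 1) + 10 + 1" and k: "inv k s'" and b: "\<not> bval ?b s'"
      and fr: "frame (mods ?c) ?s0 s'"
    have "s' ''X'' = s ''X''" using fr by (simp add: frame_def update_apply)
    then show "1 + 1 + 1 + (1 + 1 + 1 + t) \<le> L * 60 + 40 \<and>
      (\<exists>J\<le>L. s' ''J'' 0 = int J \<and> s ''X'' 0 < 2 ^ J \<and> (\<forall>i\<le>J. s' ''P'' (int i) = 2 ^ i))"
      using t k b unfolding inv_def by auto
  qed
qed

lemma wp_copy_target:
  assumes n: "s ''n'' 0 = int n"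
  shows "wp n I copy_target s (\<lambda>t s'. t \<le> 60 * (n + 1) \<and> (\<forall>x\<le>n. s' ''Z'' (int x) = s ''X'' (int x)))"
proof -
  let ?c = "Set ''Z'' (Val ''w'') (Get ''X'' (Val ''w''))"
  define inv where "inv j s1 \<longleftrightarrow> (\<forall>x<j. s1 ''Z'' (int x) = s ''X'' (int x))" for j :: nat and s1 :: state
  have "wp n I (For ''w'' 0 ?c) s
    (\<lambda>t s'. t \<le> (n + 1) * (10 + 20) + 20 \<and> inv (n + 1) s' \<and> frame (insert ''w'' (mods ?c)) s s')"
  proof (rule wp_For[where inv = inv])
    fix j s1 assume j: "s1 ''w'' 0 = int j" and inv: "inv j s1" and fr: "frame (insert ''w'' (mods ?c)) s s1"
    have "s1 ''X'' = s ''X''" using fr by (simp add: frame_def)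
    then show "wp n I ?c s1 (\<lambda>t s'. t \<le> 10 \<and> inv (j + 1) (update ''w'' 0 (int (j + 1)) s'))"
      using inv j by (auto simp: wp_Set inv_def update_apply less_Suc_eq)
  qed (use n in \<open>auto simp: inv_def update_apply\<close>)
  then show ?thesis unfolding copy_target_def by (rule wp_mono) (auto simp: inv_def less_Suc_eq_le)
qed

lemma wp_subtract:
  assumes n: "s ''n'' 0 = int n" and S: "s ''S'' 0 \<noteq> 0"
    "\<And>x. x \<in> ground n \<Longrightarrow> s ''S'' (int x) \<noteq> 0 \<longleftrightarrow> x \<in> T"
  shows "wp n I subtract s (\<lambda>t s'. t \<le> 60 * (n + 1) \<and>
    (\<forall>x\<le>n. s' ''Z'' (int x) = s ''X'' (int x) - s ''P'' (s ''j'' 0) * ivec T x))"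
proof -
  let ?c = "Cond (Eq (Get ''S'' (Val ''w'')) (Const 0))
     (Set ''Z'' (Val ''w'') (Get ''X'' (Val ''w'')))
     (Set ''Z'' (Val ''w'') (Minus (Get ''X'' (Val ''w'')) (Get ''P'' (Val ''j''))))"
  define z where "z x = s ''X'' (int x) - s ''P'' (s ''j'' 0) * ivec T x" for x
  define inv where "inv j s1 \<longleftrightarrow> (\<forall>x<j. s1 ''Z'' (int x) = z x)" for j :: nat and s1 :: state
  have "wp n I (For ''w'' 0 ?c) s
    (\<lambda>t s'. t \<le> (n + 1) * (20 + 20) + 20 \<and> inv (n + 1) s' \<and> frame (insert ''w'' (mods ?c)) s s')"
  proof (rule wp_For[where inv = inv])
    fix j s1 assume j: "j \<le> n" "s1 ''w'' 0 = int j" and inv: "inv j s1"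
      and fr: "frame (insert ''w'' (mods ?c)) s s1"
    have eq: "s1 ''X'' = s ''X''" "s1 ''S'' = s ''S''" "s1 ''P'' = s ''P''" "s1 ''j'' = s ''j''"
      using fr by (simp_all add: frame_def)
    have iv: "ivec T j = (if s ''S'' (int j) = 0 then 0 else 1)"
    proof (cases "j = 0")
      case True
      then show ?thesis using S(1) by (simp add: ivec_def)
    next
      case False
      then show ?thesis using S(2)[of j] j by (simp add: ivec_def ground_def)
    qed
    show "wp n I ?c s1 (\<lambda>t s'. t \<le> 20 \<and> inv (j + 1) (update ''w'' 0 (int (j + 1)) s'))"
      using inv j iv by (auto simp: wp_simps inv_def update_apply less_Suc_eq eq z_def)
  qed (use n in \<open>auto simp: inv_def update_apply\<close>)
  then show ?thesis unfolding subtract_def by (rule wp_mono) (auto simp: inv_def z_def less_Suc_eq_le)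
qed

lemma wp_accept:
  assumes n: "s ''n'' 0 = int n"
  shows "wp n I accept s (\<lambda>t s'. t \<le> 60 * (n + 1) \<and>
    (\<forall>x\<le>n. s' ''X'' (int x) = s ''Z'' (int x)) \<and> s' ''l'' 0 = s ''l'' 0 + s ''P'' (s ''j'' 0))"
proof -
  let ?c = "Set ''X'' (Val ''w'') (Get ''Z'' (Val ''w''))"
  define inv where "inv j s1 \<longleftrightarrow> (\<forall>x<j. s1 ''X'' (int x) = s ''Z'' (int x))" for j :: nat and s1 :: state
  have "wp n I (For ''w'' 0 ?c) s
    (\<lambda>t s'. t \<le> (n + 1) * (10 + 20) + 20 \<and> inv (n + 1) s' \<and> frame (insert ''w'' (mods ?c)) s s')"
  proof (rule wp_For[where inv = inv])
    fix j s1 assume j: "s1 ''w'' 0 = int j" and inv: "inv j s1" and fr: "frame (insert ''w'' (mods ?c)) s s1"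
    have "s1 ''Z'' = s ''Z''" using fr by (simp add: frame_def)
    then show "wp n I ?c s1 (\<lambda>t s'. t \<le> 10 \<and> inv (j + 1) (update ''w'' 0 (int (j + 1)) s'))"
      using inv j by (auto simp: wp_Set inv_def update_apply less_Suc_eq)
  qed (use n in \<open>auto simp: inv_def update_apply\<close>)
  then show ?thesis unfolding accept_def wp_Seq wp_Set
  proof (rule wp_mono, elim conjE)
    fix t s1 assume t: "t \<le> (n + 1) * (10 + 20) + 20" and inv: "inv (n + 1) s1"
      and fr: "frame (insert ''w'' (mods ?c)) s s1"
    have eq: "s1 ''l'' = s ''l''" "s1 ''P'' = s ''P''" "s1 ''j'' = s ''j''" using fr by (simp_all add: frame_def)
    show "t + (1 + acost (Const 0) s1 + acost (Plus (Val ''l'') (Get ''P'' (Val ''j''))) s1) \<le> 60 * (n + 1) \<and>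
      (\<forall>x\<le>n. update ''l'' (aval (Const 0) s1) (aval (Plus (Val ''l'') (Get ''P'' (Val ''j''))) s1) s1 ''X'' (int x) = s ''Z'' (int x)) \<and>
      update ''l'' (aval (Const 0) s1) (aval (Plus (Val ''l'') (Get ''P'' (Val ''j''))) s1) s1 ''l'' 0 = s ''l'' 0 + s ''P'' (s ''j'' 0)"
      using t inv by (simp add: update_apply eq inv_def)
  qed
qed

lemma wp_store:
  assumes n: "s ''n'' 0 = int n" and ko: "s ''ko'' 0 = int ko"
  shows "wp n I store s (\<lambda>t s'. t \<le> 80 * (n + 1) \<and> s' ''S'' 0 \<noteq> 0 \<and>
    (\<forall>x\<in>ground n. s' ''S'' (int x) = s ''A'' (int x) \<and> s' ''out_set'' (int (ko + x)) = s ''A'' (int x)) \<and>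
    (\<forall>x\<le>ko. s' ''out_set'' (int x) = s ''out_set'' (int x)))"
proof -
  let ?c = "Set ''S'' (Val ''w'') (Get ''A'' (Val ''w'')) ;;
       Set ''out_set'' (Plus (Val ''ko'') (Val ''w'')) (Get ''A'' (Val ''w''))"
  define inv where "inv j s1 \<longleftrightarrow>
    (\<forall>x. 1 \<le> x \<and> x < j \<longrightarrow> s1 ''S'' (int x) = s ''A'' (int x) \<and> s1 ''out_set'' (int (ko + x)) = s ''A'' (int x)) \<and>
    (\<forall>x\<le>ko. s1 ''out_set'' (int x) = s ''out_set'' (int x))" for j :: nat and s1 :: state
  have "wp n I (For ''w'' 1 ?c) s
    (\<lambda>t s'. t \<le> (n + 1) * (25 + 20) + 20 \<and> inv (n + 1) s' \<and> frame (insert ''w'' (mods ?c)) s s')"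
  proof (rule wp_For[where inv = inv])
    fix j s1 assume j: "1 \<le> j" "s1 ''w'' 0 = int j" and inv: "inv j s1" and fr: "frame (insert ''w'' (mods ?c)) s s1"
    have eq: "s1 ''A'' = s ''A''" "s1 ''ko'' = s ''ko''" using fr by (simp_all add: frame_def)
    show "wp n I ?c s1 (\<lambda>t s'. t \<le> 25 \<and> inv (j + 1) (update ''w'' 0 (int (j + 1)) s'))"
      using inv j ko by (auto simp: wp_simps inv_def update_apply less_Suc_eq eq)
  qed (use n in \<open>auto simp: inv_def update_apply\<close>)
  then show ?thesis unfolding store_def wp_Seq wp_Set
    by (rule wp_mono) (auto simp: inv_def ground_def update_apply)
qed

lemma wp_emit:
  assumes "s ''k'' 0 = int k" "s ''l'' 0 = l" "s ''D'' 0 = D" "s ''n'' 0 = int n" "s ''ko'' 0 = int ko"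
  shows "wp n I emit s (\<lambda>t s'. t \<le> 60 \<and> s' ''out_num'' = (s ''out_num'')(int k := l) \<and>
    s' ''out_den'' = (s ''out_den'')(int k := D) \<and> s' ''k'' 0 = int (k + 1) \<and> s' ''ko'' 0 = int (ko + n))"
  unfolding emit_def using assms by (simp add: wp_simps update_apply)

section \<open>Slacks under scaling and subtraction\<close>

lemma dot_diff_ivec: "(\<And>v. v \<le> n \<Longrightarrow> z' v = z v - l * ivec S v) \<Longrightarrow> dot n c z' = dot n c z - l * dot n c (ivec S)"
proof -
  assume "\<And>v. v \<le> n \<Longrightarrow> z' v = z v - l * ivec S v"
  then have "dot n c z' = (\<Sum>v\<le>n. c v * (z v - l * ivec S v))" unfolding dot_def by (intro sum.cong) auto
  then show ?thesis
    unfolding dot_def by (simp add: right_diff_distrib sum_subtractf sum_distrib_left mult.left_commute)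
qed

lemma dot_scale: "(\<And>v. v \<le> n \<Longrightarrow> z' v = l * z v) \<Longrightarrow> dot n c z' = l * dot n c z"
  unfolding dot_def by (simp add: algebra_simps sum_distrib_left)

lemma dot_cong: "(\<And>v. v \<le> n \<Longrightarrow> z' v = z v) \<Longrightarrow> dot n c z' = dot n c z"
  unfolding dot_def by simp

lemma feasible_cong: "(\<And>v. v \<le> n \<Longrightarrow> z' v = z v) \<Longrightarrow> feasible n I z' \<longleftrightarrow> feasible n I z"
  unfolding feasible_def using dot_cong[of n z' z] by simp

lemma feasible_scale:
  assumes "feasible n I z" "0 \<le> l" "\<And>v. v \<le> n \<Longrightarrow> z' v = l * z v"
  shows "feasible n I z'"
  unfolding feasible_def using assms(1,2) dot_scale[of n z' l z, OF assms(3)] by (simp add: feasible_def)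

lemma feasible_nonneg: "feasible n I z \<Longrightarrow> v \<le> n \<Longrightarrow> 0 \<le> z v"
  using valid_constraint_unit[of v n I] unfolding feasible_def by (metis dot_unit)

lemma dot_mass_minus_unit:
  assumes "v \<in> ground n"
  shows "dot n (\<lambda>x. if x = 0 then 1 else if x = v then -1 else 0) z = z 0 - z v"
proof -
  have "(\<Sum>x\<in>ground n. (if x = 0 then 1 else if x = v then -1 else 0) * z x) =
      (\<Sum>x\<in>ground n. if x = v then - z v else 0)"
    by (rule sum.cong) (auto simp: ground_def)
  then show ?thesis unfolding dot_ground using assms by simp
qed

text \<open>An element occurs at most once in each set, so mass minus entry takes only the values 0
  and 1 on independent sets and is a valid constraint. Hence a bound on the mass bounds all
  entries.\<close>

lemma feasible_le_mass:
  assumes "feasible n I z" "v \<le> n" shows "z v \<le> z 0"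
proof (cases "v = 0")
  case False
  then have v: "v \<in> ground n" using assms by (simp add: ground_def)
  have "valid_constraint n I (\<lambda>x. if x = 0 then 1 else if x = v then -1 else 0)"
    unfolding valid_constraint_def dot_mass_minus_unit[OF v] by (auto simp: ivec_def)
  then show ?thesis using assms(1) unfolding feasible_def by (metis (no_types, lifting) dot_mass_minus_unit[OF v] diff_ge_0_iff_ge)
qed simp

text \<open>
  After scaling by \<open>fact n\<close>, the largest step \<open>l\<close> along \<open>S\<close> that keeps \<open>z\<close> feasible makes a constraint
  tight that is not tight for \<open>S\<close>: the ratio of the slacks of \<open>z\<close> and \<open>S\<close> is an integer for every
  valid constraint.
\<close>

lemma maximal_step:
  assumes sup: "supports n I S z" and div: "\<And>c. fact n dvd dot n c z"
    and z': "\<And>v. v \<le> n \<Longrightarrow> z' v = z v - l * ivec S v" and feas: "feasible n I z'"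
    and z'': "\<And>v. v \<le> n \<Longrightarrow> z'' v = z' v - ivec S v" and infeas: "\<not> feasible n I z''"
    and l: "0 \<le> l"
  shows "0 < l" and "\<exists>c. valid_constraint n I c \<and> dot n c (ivec S) \<noteq> 0 \<and> dot n c z' = 0"
proof -
  have eq': "dot n c z' = dot n c z - l * dot n c (ivec S)" for c by (rule dot_diff_ivec[OF z'])
  have eq'': "dot n c z'' = dot n c z' - dot n c (ivec S)" for c
    using dot_diff_ivec[of n z'' z' 1 S c] z'' by simp
  \<comment> \<open>The constraint that one further step would violate is the one that turns out to
    be tight at \<open>z'\<close>.\<close>
  obtain c where c: "valid_constraint n I c" "dot n c z'' < 0" using infeas by (auto simp: feasible_def not_le)
  have S: "S \<in> I" "dot n c (ivec S) \<le> dot n c z" using sup c(1) by (auto simp: supports_def)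
  have "0 \<le> dot n c z'" using feas c(1) by (simp add: feasible_def)
  have a: "0 \<le> dot n c (ivec S)" "dot n c (ivec S) = 0 \<or> dot n c (ivec S) dvd fact n"
    using c(1) S(1) by (auto simp: valid_constraint_def)
  then have pos: "0 < dot n c (ivec S)" using c(2) eq''[of c] \<open>0 \<le> dot n c z'\<close> by simp
  show "0 < l"
  proof (rule ccontr)
    assume "\<not> 0 < l"
    then have "l = 0" using l by simp
    then show False using c(2) eq''[of c] eq'[of c] S(2) by simp
  qed
  \<comment> \<open>The slack of \<open>S\<close> divides \<open>fact n\<close>, hence the slack of
    \<open>z\<close>, hence that of \<open>z'\<close>. The latter is nonnegative and smaller than
    the slack of \<open>S\<close>, so it is 0.\<close>
  have "dot n c (ivec S) dvd dot n c z" using a(2) pos div[of c] dvd_trans by auto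
  then have "dot n c (ivec S) dvd dot n c z'" unfolding eq' by (simp add: dvd_diff)
  moreover have "dot n c z' < dot n c (ivec S)" using c(2) eq'' by simp
  ultimately have "dot n c z' = 0" using \<open>0 \<le> dot n c z'\<close> zdvd_not_zless by (metis order_le_less)
  then show "\<exists>c. valid_constraint n I c \<and> dot n c (ivec S) \<noteq> 0 \<and> dot n c z' = 0" using c(1) pos by auto
qed

section \<open>Bisection for the step length\<close>

definition probe_time :: "nat \<Rightarrow> nat \<Rightarrow> nat" where
  "probe_time n J = decompose_time n J + 200 * (n + 1)"

lemma wp_search:
  assumes M: "matroid (ground n) I" and n: "s ''n'' 0 = int n"
    and J: "s ''J'' 0 = int J" "\<And>i. i \<le> J \<Longrightarrow> s ''P'' (int i) = 2 ^ i"
    and S: "s ''S'' 0 \<noteq> 0" "\<And>x. x \<in> ground n \<Longrightarrow> s ''S'' (int x) \<noteq> 0 \<longleftrightarrow> x \<in> T"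
    and z: "\<And>v. v \<le> n \<Longrightarrow> s ''X'' (int v) = z v" and feas: "feasible n I z" and zJ: "z 0 < 2 ^ J"
  shows "wp n I search s (\<lambda>t s'. t \<le> J * (probe_time n J + 20) + 40 \<and>
    0 \<le> s' ''l'' 0 \<and> feasible n I (\<lambda>v. z v - s' ''l'' 0 * ivec T v) \<and>
    \<not> feasible n I (\<lambda>v. z v - s' ''l'' 0 * ivec T v - ivec T v) \<and>
    (\<forall>v\<le>n. s' ''X'' (int v) = z v - s' ''l'' 0 * ivec T v))"
proof -
  \<comment> \<open>The step \<open>l\<close> is feasible and \<open>l + 2 ^ k\<close> is not: at
    the start because \<open>2 ^ J\<close> exceeds the mass, at the end with a gap of 1, which is
    the form that \<open>maximal_step\<close> expects.\<close>
  define inv where "inv k s1 \<longleftrightarrow> s1 ''j'' 0 = int k \<and> k \<le> J \<and> 0 \<le> s1 ''l'' 0 \<and>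
    feasible n I (\<lambda>v. z v - s1 ''l'' 0 * ivec T v) \<and>
    \<not> feasible n I (\<lambda>v. z v - s1 ''l'' 0 * ivec T v - 2 ^ k * ivec T v) \<and>
    (\<forall>v\<le>n. s1 ''X'' (int v) = z v - s1 ''l'' 0 * ivec T v)" for k :: nat and s1 :: state
  let ?s0 = "update ''j'' 0 (int J) (update ''l'' 0 0 s)"
  let ?b = "Less (Const 0) (Val ''j'')"
  have "wp n I (While ?b probe) ?s0 (\<lambda>t s'. t \<le> J * (probe_time n J + 5 + 1) + 5 + 1 \<and>
    (\<exists>k'\<le>J. inv k' s') \<and> \<not> bval ?b s' \<and> frame (mods probe) ?s0 s')"
  proof (rule wp_While)
    have "\<not> feasible n I (\<lambda>v. z v - 0 * ivec T v - 2 ^ J * ivec T v)"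
      using feasible_nonneg[of n I "\<lambda>v. z v - 0 * ivec T v - 2 ^ J * ivec T v" 0] zJ by (auto simp: ivec_def)
    then show "inv J ?s0" unfolding inv_def using feas z by (simp add: update_apply)
    fix k s1 assume k: "inv k s1" and b: "bval ?b s1" and fr: "frame (mods probe) ?s0 s1"
    then obtain k' where k': "k = Suc k'" unfolding inv_def by (cases k) auto
    have eq: "s1 z = s z" if "z \<in> {''n'', ''J'', ''P'', ''S''}" for z
      using frameD[OF fr, of z] that by (auto simp: update_apply)
    define l where "l = s1 ''l'' 0"
    have I: "k' < J" "0 \<le> l" "feasible n I (\<lambda>v. z v - l * ivec T v)"
      "\<not> feasible n I (\<lambda>v. z v - l * ivec T v - 2 ^ k * ivec T v)"
      "\<And>v. v \<le> n \<Longrightarrow> s1 ''X'' (int v) = z v - l * ivec T v" "s1 ''j'' 0 = int k' + 1"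
      using k k' unfolding inv_def l_def by auto
    let ?s2 = "update ''j'' 0 (int k') s1"
    have P2: "?s2 ''P'' (int k') = 2 ^ k'" using J(2)[of k'] I(1) by (simp add: update_apply eq)
    define z1 where "z1 = (\<lambda>v. z v - l * ivec T v - 2 ^ k' * ivec T v)"
    have "wp n I subtract ?s2 (\<lambda>t s'. t \<le> 60 * (n + 1) \<and>
        (\<forall>x\<le>n. s' ''Z'' (int x) = ?s2 ''X'' (int x) - ?s2 ''P'' (?s2 ''j'' 0) * ivec T x))"
      by (rule wp_subtract) (use n S in \<open>simp_all add: update_apply eq\<close>)
    then have "wp n I subtract ?s2 (\<lambda>t s'. wp n I decompose s' (\<lambda>t1 s'.
        wp n I (Cond (Eq (Val ''fail'') (Const 0)) accept Skip) s' (\<lambda>t2 s'.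
        10 + (t + (t1 + t2)) \<le> probe_time n J \<and> inv k' s')))"
    proof (rule wp_frame, elim conjE)
      fix t s3 assume t: "t \<le> 60 * (n + 1)" and Z3: "\<forall>x\<le>n. s3 ''Z'' (int x) = ?s2 ''X'' (int x) - ?s2 ''P'' (?s2 ''j'' 0) * ivec T x"
        and fr3: "frame (mods subtract) ?s2 s3"
      have eq3: "s3 z = ?s2 z" if "z \<noteq> ''w''" "z \<noteq> ''Z''" for z using frameD[OF fr3, of z] that by simp
      have Z3: "s3 ''Z'' (int x) = z1 x" if "x \<le> n" for x
        using Z3 that P2 I(5) by (simp add: update_apply z1_def)
      have "s3 ''Z'' (int x) < 2 ^ J" if x: "x \<le> n" for x
      proof -
        have "0 \<le> l * ivec T x" "0 \<le> 2 ^ k' * ivec T x" using I(2) by (simp_all add: ivec_def)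
        then have "s3 ''Z'' (int x) \<le> z x" using Z3[OF x] by (simp add: z1_def)
        also have "\<dots> \<le> z 0" by (rule feasible_le_mass[OF feas x])
        finally show ?thesis using zJ by simp
      qed
      moreover have "s3 ''n'' 0 = int n" "s3 ''J'' 0 = int J" "\<And>i. i \<le> J \<Longrightarrow> s3 ''P'' (int i) = 2 ^ i"
        using n J by (simp_all add: eq3 update_apply eq)
      ultimately have "wp n I decompose s3 (\<lambda>t s'. t \<le> decompose_time n J \<and>
        s' ''fail'' 0 = (if feasible n I (\<lambda>x. s3 ''Z'' (int x)) then 0 else 1) \<and>
        (feasible n I (\<lambda>x. s3 ''Z'' (int x)) \<and> 0 < s3 ''Z'' 0 \<longrightarrow>
          supports n I {x \<in> ground n. s' ''A'' (int x) \<noteq> 0} (\<lambda>x. s3 ''Z'' (int x))))"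
        by (intro wp_decompose[OF M])
      then show "wp n I decompose s3 (\<lambda>t1 s'.
        wp n I (Cond (Eq (Val ''fail'') (Const 0)) accept Skip) s' (\<lambda>t2 s'.
        10 + (t + (t1 + t2)) \<le> probe_time n J \<and> inv k' s'))"
      proof (rule wp_frame, elim conjE)
        fix t1 s4 assume t1: "t1 \<le> decompose_time n J"
          and f: "s4 ''fail'' 0 = (if feasible n I (\<lambda>x. s3 ''Z'' (int x)) then 0 else 1)"
          and fr4: "frame (mods decompose) s3 s4"
        have eq4: "s4 z = ?s2 z" if "z \<in> {''n'', ''P'', ''j'', ''X'', ''l''}" for z
          using frameD[OF fr4, of z] eq3[of z] that by auto
        have Z4: "s4 ''Z'' (int x) = z1 x" if "x \<le> n" for x
          using frameD[OF fr4, of "''Z''"] Z3[OF that] by simp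
        have f': "s4 ''fail'' 0 = (if feasible n I z1 then 0 else 1)"
          using f feasible_cong[of n "\<lambda>x. s3 ''Z'' (int x)" z1] Z3 by simp
        have n4: "s4 ''n'' 0 = int n" and j4: "s4 ''j'' 0 = int k'" and P4: "s4 ''P'' (int k') = 2 ^ k'" and l4: "s4 ''l'' 0 = l"
          using n P2 by (simp_all add: eq4 update_apply eq l_def)
        have T: "10 + (t + (t1 + (10 + t2))) \<le> probe_time n J" if "t2 \<le> 60 * (n + 1)" for t2
          unfolding probe_time_def using t t1 that by simp
        have Suc: "z v - l * ivec T v - 2 ^ k' * ivec T v - 2 ^ k' * ivec T v = z v - l * ivec T v - 2 ^ k * ivec T v" for v
          unfolding k' by (simp add: algebra_simps)
        show "wp n I (Cond (Eq (Val ''fail'') (Const 0)) accept Skip) s4 (\<lambda>t2 s'.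
          10 + (t + (t1 + t2)) \<le> probe_time n J \<and> inv k' s')"
        proof (cases "feasible n I z1")
          case False
          have "inv k' s4" unfolding inv_def l4 using False I j4 by (simp add: z1_def eq4 update_apply)
          then show ?thesis unfolding wp_Cond using f' False T[of 0] by (simp add: wp_Skip)
        next
          case True
          have "wp n I accept s4 (\<lambda>t2 s'. t2 \<le> 60 * (n + 1) \<and> inv k' s')"
          proof (rule wp_frame[OF wp_accept[where s = s4, OF n4]], elim conjE)
            fix t2 s5 assume t2: "t2 \<le> 60 * (n + 1)" and X5: "\<forall>x\<le>n. s5 ''X'' (int x) = s4 ''Z'' (int x)"
              and l5: "s5 ''l'' 0 = s4 ''l'' 0 + s4 ''P'' (s4 ''j'' 0)" and fr5: "frame (mods accept) s4 s5"
            have j5: "s5 ''j'' 0 = int k'" using frameD[OF fr5, of "''j''"] j4 by simp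
            have l5: "s5 ''l'' 0 = l + 2 ^ k'" using l5 l4 j4 P4 by simp
            have e: "z v - (l + 2 ^ k') * ivec T v = z1 v" for v by (simp add: z1_def algebra_simps)
            have "inv k' s5" unfolding inv_def l5 e using True I(1,2,4) j5 X5 Z4 unfolding z1_def Suc by simp
            then show "t2 \<le> 60 * (n + 1) \<and> inv k' s5" using t2 by simp
          qed
          then show ?thesis unfolding wp_Cond using f' True T
            by simp (erule wp_mono, fastforce)
        qed
      qed
    qed
    then have "wp n I probe s1 (\<lambda>t s'. t \<le> probe_time n J \<and> inv k' s')"
      unfolding probe_def wp_Seq wp_Set using I(6)
      by (simp add: algebra_simps) (elim wp_mono, simp)
    then show "wp n I probe s1 (\<lambda>t s'. t \<le> probe_time n J \<and> (\<exists>k'<k. inv k' s'))"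
      by (rule wp_mono) (use k' in auto)
  qed simp
  then have "wp n I (While ?b probe) ?s0 (\<lambda>t s'. 20 + t \<le> J * (probe_time n J + 20) + 40 \<and> inv 0 s')"
  proof (rule wp_mono, elim conjE exE)
    fix t s' k assume t: "t \<le> J * (probe_time n J + 5 + 1) + 5 + 1" and k: "inv k s'" and b: "\<not> bval ?b s'"
    have "J * (probe_time n J + 5 + 1) \<le> J * (probe_time n J + 20)" by (rule mult_left_mono) simp_all
    then have "t \<le> J * (probe_time n J + 20) + 5 + 1" using t by (meson add_le_mono1 le_trans)
    moreover have "a \<le> b + 5 + 1 \<Longrightarrow> 20 + a \<le> b + 40" for a b :: nat by simp
    ultimately have "20 + t \<le> J * (probe_time n J + 20) + 40" by blast
    moreover have "k = 0" using k b by (auto simp: inv_def)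
    ultimately show "20 + t \<le> J * (probe_time n J + 20) + 40 \<and> inv 0 s'" using k by simp
  qed
  then show ?thesis unfolding search_def wp_Seq wp_Set using J(1)
    by (simp add: update_apply) (elim wp_mono, simp add: inv_def)
qed

section \<open>One complete peeling step\<close>

lemma wp_SeqI:
  assumes "wp n I c1 s (\<lambda>t s'. t \<le> T1 \<and> P s')"
    and "\<And>s1. P s1 \<Longrightarrow> frame (mods c1) s s1 \<Longrightarrow> wp n I c2 s1 (\<lambda>t s'. t \<le> T2 \<and> R s')"
  shows "wp n I (c1 ;; c2) s (\<lambda>t s'. t \<le> T1 + T2 \<and> R s')"
  unfolding wp_Seq
  by (rule wp_frame[OF assms(1)], rule wp_mono[OF assms(2)]) (auto intro: add_mono)

lemma wp_time_mono: "wp n I c s (\<lambda>t s'. t \<le> T \<and> R s') \<Longrightarrow> T \<le> T' \<Longrightarrow> wp n I c s (\<lambda>t s'. t \<le> T' \<and> R s')"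
  by (erule wp_mono) auto

lemma decompose_time_mono: "J \<le> L \<Longrightarrow> decompose_time n J \<le> decompose_time n L"
  unfolding decompose_time_def phase_time_def by (intro add_mono mult_mono) simp_all

definition search_time :: "nat \<Rightarrow> nat \<Rightarrow> nat" where
  "search_time n J = J * (probe_time n J + 20) + 40"

lemma search_time_mono: "J \<le> L \<Longrightarrow> search_time n J \<le> search_time n L"
  unfolding search_time_def probe_time_def by (intro add_mono mult_mono decompose_time_mono) simp_all

definition step_time :: "nat \<Rightarrow> nat \<Rightarrow> nat" where
  "step_time n L = (n + 1) * (4 * L + 100) + (L * 60 + 40 + (60 * (n + 1) +
     (decompose_time n L + (80 * (n + 1) + (search_time n L + 60)))))"

definition step_result ::
  "nat \<Rightarrow> nat set set \<Rightarrow> (nat \<Rightarrow> int) \<Rightarrow> int \<Rightarrow> nat \<Rightarrow> state \<Rightarrow> nat set \<Rightarrow> int \<Rightarrow> state \<Rightarrow> bool" where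
  "step_result n I z D k s T l s' \<longleftrightarrow>
     0 < l \<and> supports n I T (\<lambda>v. fact n * z v) \<and>
     (\<forall>v\<le>n. s' ''X'' (int v) = fact n * z v - l * ivec T v) \<and>
     feasible n I (\<lambda>v. s' ''X'' (int v)) \<and>
     (\<exists>c. valid_constraint n I c \<and> dot n c (ivec T) \<noteq> 0 \<and> dot n c (\<lambda>v. s' ''X'' (int v)) = 0) \<and>
     s' ''D'' 0 = D * fact n \<and>
     s' ''out_num'' = (s ''out_num'')(int k := l) \<and> s' ''out_den'' = (s ''out_den'')(int k := D * fact n) \<and>
     s' ''k'' 0 = int (k + 1) \<and> s' ''ko'' 0 = int ((k + 1) * n) \<and>
     (\<forall>x\<in>ground n. s' ''out_set'' (int (k * n + x)) \<noteq> 0 \<longleftrightarrow> x \<in> T) \<and>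
     (\<forall>x\<le>k * n. s' ''out_set'' (int x) = s ''out_set'' (int x))"

lemma wp_step:
  assumes M: "matroid (ground n) I" and n: "s ''n'' 0 = int n" and F: "s ''F'' 0 = fact n"
    and z: "\<And>v. v \<le> n \<Longrightarrow> s ''X'' (int v) = z v" and feas: "feasible n I z" and z0: "0 < z 0"
    and D: "s ''D'' 0 = D" "z 0 \<le> D" "D * fact n < 2 ^ L"
    and k: "s ''k'' 0 = int k" "s ''ko'' 0 = int (k * n)"
  shows "wp n I step s (\<lambda>t s'. t \<le> step_time n L \<and> (\<exists>T l. step_result n I z D k s T l s'))"
proof -
  let ?R = "\<lambda>s'. \<exists>T l. step_result n I z D k s T l s'"
  have pos: "(1::int) \<le> fact n" by simp
  have zle: "0 \<le> z v" "z v \<le> D" if "v \<le> n" for v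
    using feasible_nonneg[OF feas that] feasible_le_mass[OF feas that] D by auto
  have D0: "0 < D" using z0 D by simp
  have small: "x < 2 ^ L" if "x \<le> D" for x
  proof -
    have "D * 1 \<le> D * fact n" by (rule mult_left_mono[OF pos]) (use D0 in simp)
    then show ?thesis using that D(3) by linarith
  qed
  have "1 * fact n \<le> D * fact n" by (rule mult_right_mono) (use D0 in simp_all)
  then have "fact n \<le> D * fact n" by simp
  then have "fact n < (2::int) ^ L" using D(3) by linarith
  then have F2: "bit_length (s ''F'' 0) \<le> L" using F by (intro bit_length_le) simp
  have X2: "bit_length (s ''X'' (int x)) \<le> L" if "x \<le> n" for x
    using z[OF that] zle[OF that] small by (intro bit_length_le) simp
  have D2: "bit_length (s ''D'' 0) \<le> L" using D D0 small by (intro bit_length_le) simp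
  define z1 where "z1 = (\<lambda>v. fact n * z v)"
  have feas1: "feasible n I z1" by (rule feasible_scale[OF feas, of "fact n"]) (simp_all add: z1_def)
  have z10: "0 < z1 0" using z0 by (simp add: z1_def)
  have z1L: "z1 0 < 2 ^ L"
  proof -
    have "z1 0 \<le> D * fact n" using mult_right_mono[OF D(2), of "fact n"] by (simp add: z1_def mult.commute)
    then show ?thesis using D(3) by linarith
  qed
  show ?thesis unfolding step_def step_time_def
  proof (rule wp_SeqI[OF wp_scale_up[OF n F2 X2 D2]])
    fix s1 assume A1: "(\<forall>x\<le>n. s1 ''X'' (int x) = s ''X'' (int x) * s ''F'' 0) \<and> s1 ''D'' 0 = s ''D'' 0 * s ''F'' 0"
      and fr1: "frame (mods scale_up) s s1"
    have eq1: "s1 z = s z" if "z \<in> {''n'', ''k'', ''ko'', ''out_num'', ''out_den'', ''out_set''}" for z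
      using frameD[OF fr1, of z] that by auto
    have X1: "s1 ''X'' (int x) = z1 x" if "x \<le> n" for x using A1 that z F by (simp add: z1_def mult.commute)
    have D1: "s1 ''D'' 0 = D * fact n" using A1 D F by simp
    have X10: "s1 ''X'' 0 = z1 0" using X1[of 0] by simp
    show "wp n I (powers ;; copy_target ;; decompose ;; store ;; search ;; emit) s1
      (\<lambda>t s'. t \<le> L * 60 + 40 + (60 * (n + 1) + (decompose_time n L + (80 * (n + 1) + (search_time n L + 60)))) \<and> ?R s')"
    proof (rule wp_SeqI[OF wp_powers[where s = s1]])
      show "0 \<le> s1 ''X'' 0" "s1 ''X'' 0 < 2 ^ L" using X10 z10 z1L by simp_all
      fix s2 assume "\<exists>J\<le>L. s2 ''J'' 0 = int J \<and> s1 ''X'' 0 < 2 ^ J \<and> (\<forall>i\<le>J. s2 ''P'' (int i) = 2 ^ i)"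
        and fr2: "frame (mods powers) s1 s2"
      then obtain J where J: "J \<le> L" "s2 ''J'' 0 = int J" "z1 0 < 2 ^ J" "\<And>i. i \<le> J \<Longrightarrow> s2 ''P'' (int i) = 2 ^ i"
        using X10 by auto
      have eq2: "s2 z = s1 z" if "z \<in> {''n'', ''k'', ''ko'', ''out_num'', ''out_den'', ''out_set'', ''X'', ''D''}" for z
        using frameD[OF fr2, of z] that by auto
      have n2: "s2 ''n'' 0 = int n" using n by (simp add: eq2 eq1)
      show "wp n I (copy_target ;; decompose ;; store ;; search ;; emit) s2
        (\<lambda>t s'. t \<le> 60 * (n + 1) + (decompose_time n L + (80 * (n + 1) + (search_time n L + 60))) \<and> ?R s')"
      proof (rule wp_SeqI[OF wp_copy_target[where s = s2, OF n2]])
        fix s3 assume A3: "\<forall>x\<le>n. s3 ''Z'' (int x) = s2 ''X'' (int x)" and fr3: "frame (mods copy_target) s2 s3"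
        have eq3: "s3 z = s2 z" if "z \<noteq> ''w''" "z \<noteq> ''Z''" for z using frameD[OF fr3, of z] that by simp
        have Z3: "s3 ''Z'' (int x) = z1 x" if "x \<le> n" for x using A3 that X1 by (simp add: eq2)
        have Zlt: "s3 ''Z'' (int x) < 2 ^ J" if "x \<le> n" for x
          using Z3[OF that] feasible_le_mass[OF feas1 that] J(3) by simp
        have n3: "s3 ''n'' 0 = int n" and J3: "s3 ''J'' 0 = int J" and P3: "\<And>i. i \<le> J \<Longrightarrow> s3 ''P'' (int i) = 2 ^ i"
          using n2 J by (simp_all add: eq3)
        have c3: "feasible n I (\<lambda>x. s3 ''Z'' (int x))" using feasible_cong[of n "\<lambda>x. s3 ''Z'' (int x)" z1] Z3 feas1 by simp
        have dec: "wp n I decompose s3 (\<lambda>t s'. t \<le> decompose_time n L \<and>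
            supports n I {x \<in> ground n. s' ''A'' (int x) \<noteq> 0} z1)"
        proof (rule wp_mono[OF wp_decompose[where s = s3, OF M n3 J3]])
          fix t s'
          assume "t \<le> decompose_time n J \<and> s' ''fail'' 0 = (if feasible n I (\<lambda>x. s3 ''Z'' (int x)) then 0 else 1) \<and>
            (feasible n I (\<lambda>x. s3 ''Z'' (int x)) \<and> 0 < s3 ''Z'' 0 \<longrightarrow>
              supports n I {x \<in> ground n. s' ''A'' (int x) \<noteq> 0} (\<lambda>x. s3 ''Z'' (int x)))"
          moreover have "0 < s3 ''Z'' 0" using Z3[of 0] z10 by simp
          ultimately show "t \<le> decompose_time n L \<and> supports n I {x \<in> ground n. s' ''A'' (int x) \<noteq> 0} z1"
            using c3 decompose_time_mono[OF J(1), of n] dot_cong[of n "\<lambda>x. s3 ''Z'' (int x)" z1] Z3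
            unfolding supports_def by simp
        qed (use P3 Zlt in simp_all)
        show "wp n I (decompose ;; store ;; search ;; emit) s3
          (\<lambda>t s'. t \<le> decompose_time n L + (80 * (n + 1) + (search_time n L + 60)) \<and> ?R s')"
        proof (rule wp_SeqI[OF dec])
          fix s4 assume sup: "supports n I {x \<in> ground n. s4 ''A'' (int x) \<noteq> 0} z1"
            and fr4: "frame (mods decompose) s3 s4"
          define T where "T = {x \<in> ground n. s4 ''A'' (int x) \<noteq> 0}"
          have eq4: "s4 z = s1 z" if "z \<in> {''n'', ''k'', ''ko'', ''out_num'', ''out_den'', ''out_set'', ''X'', ''D''}" for z
            using frameD[OF fr4, of z] eq3[of z] eq2[of z] that by auto
          have eq4': "s4 z = s2 z" if "z \<in> {''P'', ''J''}" for z
            using frameD[OF fr4, of z] eq3[of z] that by auto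
          have n4: "s4 ''n'' 0 = int n" and ko4: "s4 ''ko'' 0 = int (k * n)" using n k by (simp_all add: eq4 eq1)
          show "wp n I (store ;; search ;; emit) s4 (\<lambda>t s'. t \<le> 80 * (n + 1) + (search_time n L + 60) \<and> ?R s')"
          proof (rule wp_SeqI[OF wp_store[where s = s4, OF n4 ko4]], elim conjE)
            fix s5 assume S5: "s5 ''S'' 0 \<noteq> 0"
              "\<forall>x\<in>ground n. s5 ''S'' (int x) = s4 ''A'' (int x) \<and> s5 ''out_set'' (int (k * n + x)) = s4 ''A'' (int x)"
              "\<forall>x\<le>k * n. s5 ''out_set'' (int x) = s4 ''out_set'' (int x)"
              and fr5: "frame (mods store) s4 s5"
            have eq5: "s5 z = s1 z" if "z \<in> {''n'', ''k'', ''ko'', ''out_num'', ''out_den'', ''X'', ''D''}" for z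
              using frameD[OF fr5, of z] eq4[of z] that by auto
            have eq5': "s5 z = s2 z" if "z \<in> {''P'', ''J''}" for z
              using frameD[OF fr5, of z] eq4'[of z] that by auto
            have sea: "wp n I search s5 (\<lambda>t s'. t \<le> search_time n L \<and>
              (0 \<le> s' ''l'' 0 \<and> feasible n I (\<lambda>v. z1 v - s' ''l'' 0 * ivec T v) \<and>
              \<not> feasible n I (\<lambda>v. z1 v - s' ''l'' 0 * ivec T v - ivec T v) \<and>
              (\<forall>v\<le>n. s' ''X'' (int v) = z1 v - s' ''l'' 0 * ivec T v)))"
            proof (rule wp_time_mono[OF _ search_time_mono[OF J(1)]], unfold search_time_def,
                rule wp_search[OF M])
              show "s5 ''S'' (int x) \<noteq> 0 \<longleftrightarrow> x \<in> T" if "x \<in> ground n" for x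
                using S5(2) that by (simp add: T_def)
            qed (use n J S5(1) X1 feas1 in \<open>simp_all add: eq5 eq5' eq1\<close>)
            show "wp n I (search ;; emit) s5 (\<lambda>t s'. t \<le> search_time n L + 60 \<and> ?R s')"
            proof (rule wp_SeqI[OF sea], elim conjE)
              fix s6 assume l0: "0 \<le> s6 ''l'' 0" and feas6: "feasible n I (\<lambda>v. z1 v - s6 ''l'' 0 * ivec T v)"
                and inf6: "\<not> feasible n I (\<lambda>v. z1 v - s6 ''l'' 0 * ivec T v - ivec T v)"
                and X6: "\<forall>v\<le>n. s6 ''X'' (int v) = z1 v - s6 ''l'' 0 * ivec T v"
                and fr6: "frame (mods search) s5 s6"
              define l where "l = s6 ''l'' 0"
              have eq6: "s6 z = s1 z" if "z \<in> {''n'', ''k'', ''ko'', ''out_num'', ''out_den'', ''D''}" for z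
                using frameD[OF fr6, of z] eq5[of z] that by auto
              have os6: "s6 ''out_set'' = s5 ''out_set''" using frameD[OF fr6, of "''out_set''"] by simp
              \<comment> \<open>Every entry of \<open>z1\<close> carries the factor
                \<open>fact n\<close>, so every slack does.\<close>
              have div: "fact n dvd dot n c z1" for c
                using dot_scale[of n z1 "fact n" z c] by (simp add: z1_def)
              note ms = maximal_step[OF sup[folded T_def] div refl feas6 refl inf6 l0]
              have X6': "s6 ''X'' (int v) = z1 v - l * ivec T v" if "v \<le> n" for v using X6 that by (simp add: l_def)
              have "wp n I emit s6 (\<lambda>t s'. t \<le> 60 \<and> s' ''out_num'' = (s6 ''out_num'')(int k := l) \<and>
                s' ''out_den'' = (s6 ''out_den'')(int k := D * fact n) \<and> s' ''k'' 0 = int (k + 1) \<and>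
                s' ''ko'' 0 = int (k * n + n))"
                by (rule wp_emit) (use n k D1 in \<open>simp_all add: eq6 eq1 l_def\<close>)
              then show "wp n I emit s6 (\<lambda>t s'. t \<le> 60 \<and> ?R s')"
              proof (rule wp_frame, elim conjE)
                fix t s7 assume t: "t \<le> 60" and o: "s7 ''out_num'' = (s6 ''out_num'')(int k := l)"
                  "s7 ''out_den'' = (s6 ''out_den'')(int k := D * fact n)" "s7 ''k'' 0 = int (k + 1)" "s7 ''ko'' 0 = int (k * n + n)"
                  and fr7: "frame (mods emit) s6 s7"
                have eq7: "s7 z = s6 z" if "z \<in> {''X'', ''D'', ''out_set''}" for z
                  using frameD[OF fr7, of z] that by auto
                have dX: "dot n c (\<lambda>v. s7 ''X'' (int v)) = dot n c (\<lambda>v. z1 v - l * ivec T v)" for c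
                  by (rule dot_cong) (simp add: X6' eq7)
                have fX: "feasible n I (\<lambda>v. s7 ''X'' (int v))"
                  using feasible_cong[of n "\<lambda>v. s7 ''X'' (int v)" "\<lambda>v. z1 v - l * ivec T v"] X6' feas6
                  by (simp add: eq7 l_def)
                have "step_result n I z D k s T l s7"
                  unfolding step_result_def
                proof (intro conjI)
                  show "0 < l" using ms(1) by (simp add: l_def)
                  show "supports n I T (\<lambda>v. fact n * z v)" using sup by (simp add: T_def z1_def)
                  show "\<forall>v\<le>n. s7 ''X'' (int v) = fact n * z v - l * ivec T v" using X6' by (simp add: eq7 z1_def)
                  show "feasible n I (\<lambda>v. s7 ''X'' (int v))" by (rule fX)
                  show "\<exists>c. valid_constraint n I c \<and> dot n c (ivec T) \<noteq> 0 \<and> dot n c (\<lambda>v. s7 ''X'' (int v)) = 0"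
                    unfolding dX l_def by (rule ms(2))
                  show "\<forall>x\<in>ground n. s7 ''out_set'' (int (k * n + x)) \<noteq> 0 \<longleftrightarrow> x \<in> T"
                    using S5(2) by (simp add: eq7 os6 T_def)
                  show "\<forall>x\<le>k * n. s7 ''out_set'' (int x) = s ''out_set'' (int x)"
                    using S5(3) by (simp add: eq7 os6 eq4 eq1)
                qed (use o D1 in \<open>simp_all add: eq6 eq7 eq1 algebra_simps\<close>)
                then show "t \<le> 60 \<and> ?R s7" using t by blast
              qed
            qed
          qed
        qed
      qed
    qed
  qed
qed

text \<open>\<open>c\<close> is the constraint that became tight when \<open>T j\<close> was peeled
  off. All later sets lie in the face where it is tight, which gives the triangular pattern; its
  vanishing on the remainder \<open>z\<close> is what allows the chain to be continued.\<close>

definition chain :: "nat \<Rightarrow> nat set set \<Rightarrow> (nat \<Rightarrow> nat set) \<Rightarrow> nat \<Rightarrow> (nat \<Rightarrow> int) \<Rightarrow> bool" where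
  "chain n I T k z \<longleftrightarrow> (\<forall>j<k. \<exists>c. valid_constraint n I c \<and> dot n c (ivec (T j)) \<noteq> 0 \<and>
     (\<forall>i. j < i \<and> i < k \<longrightarrow> dot n c (ivec (T i)) = 0) \<and> dot n c z = 0)"

text \<open>The constraints of a chain make its incidence vectors triangular, hence linearly independent.\<close>

lemma chain_length:
  assumes "chain n I T k z" shows "k \<le> n + 1"
proof -
  define e where "e j = (\<lambda>v. if v \<le> n then real_of_int (ivec (T j) v) else 0)" for j
  \<comment> \<open>Induction from the last set backwards: the constraint of \<open>j\<close>
    vanishes on the span of the later vectors but not on \<open>e j\<close>.\<close>
  have "independent (e ` {j..<k}) \<and> card (e ` {j..<k}) = k - j" if "j \<le> k" for j
    using that
  proof (induction rule: inc_induct)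
    case base
    show ?case by (simp add: real_vector.independent_empty)
  next
    case (step j)
    obtain c where c: "dot n c (ivec (T j)) \<noteq> 0" "\<And>i. j < i \<Longrightarrow> i < k \<Longrightarrow> dot n c (ivec (T i)) = 0"
      using assms step.hyps unfolding chain_def by blast
    define f where "f x = (\<Sum>v\<le>n. real_of_int (c v) * x v)" for x :: "nat \<Rightarrow> real"
    have fe: "f (e i) = real_of_int (dot n c (ivec (T i)))" for i
      by (simp add: f_def e_def dot_def)
    have "f 0 = 0" "\<And>x y. f (x + y) = f x + f y"
      by (simp_all add: f_def distrib_left sum.distrib)
    moreover have "\<And>r x. f (r *\<^sub>R x) = r * f x"
      by (simp add: f_def scaleR_fun_def sum_distrib_left mult.left_commute)
    ultimately have "subspace {x. f x = 0}" unfolding subspace_def by simp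
    moreover have "e ` {Suc j..<k} \<subseteq> {x. f x = 0}" using c(2) fe by auto
    ultimately have "span (e ` {Suc j..<k}) \<subseteq> {x. f x = 0}" by (intro span_minimal)
    moreover have "f (e j) \<noteq> 0" using fe[of j] c(1) by simp
    ultimately have ns: "e j \<notin> span (e ` {Suc j..<k})" by blast
    have nin: "e j \<notin> e ` {Suc j..<k}" by (rule notI, drule span_base) (use ns in blast)
    have "{j..<k} = insert j {Suc j..<k}" using step.hyps by auto
    then have eq: "e ` {j..<k} = insert (e j) (e ` {Suc j..<k})" by simp
    have "independent (insert (e j) (e ` {Suc j..<k}))" using ns step.IH by (simp add: independent_insertI)
    moreover have "card (insert (e j) (e ` {Suc j..<k})) = k - j" using nin step by simp
    ultimately show ?case unfolding eq by blast
  qed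
  from this[of 0] have ind: "independent (e ` {0..<k})" "card (e ` {0..<k}) = k" by simp_all
  \<comment> \<open>The vectors live on the indices \<open>0, ..., n\<close>; with the mass
    coordinate the dimension is \<open>n + 1\<close>, and this bounds the number of sets.\<close>
  define b where "b w = (\<lambda>v. if v = w then 1 else 0 :: real)" for w :: nat
  have "e j \<in> span (b ` {..n})" for j
  proof -
    have "e j = (\<Sum>w\<le>n. e j w *\<^sub>R b w)"
    proof
      fix v
      have "(\<Sum>w\<le>n. e j w *\<^sub>R b w) v = (\<Sum>w\<le>n. (e j w *\<^sub>R b w) v)"
        by (induction n) simp_all
      also have "\<dots> = (\<Sum>w\<le>n. if w = v then e j v else 0)"
        by (rule sum.cong) (auto simp: scaleR_fun_def b_def)
      also have "\<dots> = e j v" by (simp add: e_def)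
      finally show "e j v = (\<Sum>w\<le>n. e j w *\<^sub>R b w) v" by simp
    qed
    also have "\<dots> \<in> span (b ` {..n})" by (intro span_sum span_scale span_base) auto
    finally show ?thesis .
  qed
  then have "e ` {0..<k} \<subseteq> span (b ` {..n})" by auto
  from independent_span_bound[OF _ ind(1) this] have "k \<le> card (b ` {..n})" using ind(2) by simp
  also have "\<dots> \<le> n + 1" using card_image_le[of "{..n}" b] by simp
  finally show ?thesis .
qed

text \<open>The constraint belonging to \<open>i\<close> separates the two sets: it is nonzero on
  \<open>T i\<close> and zero on \<open>T j\<close>. The output list therefore has no
  repetitions.\<close>

lemma chain_distinct:
  assumes "chain n I T k z" "i < j" "j < k" shows "T i \<noteq> T j"
  using assms unfolding chain_def by (metis order.strict_trans)

text \<open>A constraint tight for \<open>z\<close> is tight for \<open>T k\<close>, whose slack is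
  nonnegative and at most that of the scaled \<open>z\<close>. Hence it stays tight after the
  subtraction.\<close>

lemma chain_extend:
  assumes ch: "chain n I T k z" and sup: "supports n I (T k) (\<lambda>v. a * z v)"
    and z': "\<And>v. v \<le> n \<Longrightarrow> z' v = a * z v - l * ivec (T k) v"
    and c: "\<exists>c. valid_constraint n I c \<and> dot n c (ivec (T k)) \<noteq> 0 \<and> dot n c z' = 0"
  shows "chain n I T (Suc k) z'"
  unfolding chain_def
proof (intro allI impI)
  fix j assume "j < Suc k"
  then consider "j = k" | "j < k" by linarith
  then show "\<exists>c. valid_constraint n I c \<and> dot n c (ivec (T j)) \<noteq> 0 \<and>
     (\<forall>i. j < i \<and> i < Suc k \<longrightarrow> dot n c (ivec (T i)) = 0) \<and> dot n c z' = 0"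
  proof cases
    case 1
    then show ?thesis using c by auto
  next
    case 2
    then obtain c where c: "valid_constraint n I c" "dot n c (ivec (T j)) \<noteq> 0"
       "\<And>i. j < i \<Longrightarrow> i < k \<Longrightarrow> dot n c (ivec (T i)) = 0" "dot n c z = 0"
      using ch unfolding chain_def by blast
    have az: "dot n c (\<lambda>v. a * z v) = 0" using dot_scale[of n "\<lambda>v. a * z v" a z c] c(4) by simp
    have Tk: "dot n c (ivec (T k)) = 0"
      using sup c(1) az unfolding supports_def valid_constraint_def by (metis order_antisym)
    have "dot n c z' = 0" using dot_diff_ivec[of n z' "\<lambda>v. a * z v" l "T k" c] z' az Tk by simp
    then show ?thesis using c Tk by (intro exI[of _ c]) (auto simp: less_Suc_eq)
  qed
qed

section \<open>The outer loop and its invariant\<close>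

definition out_block :: "nat \<Rightarrow> state \<Rightarrow> nat \<Rightarrow> nat set" where
  "out_block n s j = {x \<in> ground n. s ''out_set'' (int (j * n + x)) \<noteq> 0}"

definition out_weight :: "state \<Rightarrow> nat \<Rightarrow> rat" where
  "out_weight s j = of_int (s ''out_num'' (int j)) / of_int (s ''out_den'' (int j))"

text \<open>The emitted part and the remainder \<open>X / D\<close> add up to \<open>q\<close>,
  which will be the homogenised input with value 1 at 0. An output keeps the denominator that was
  current when it was emitted, so later scalings do not affect it.\<close>

definition outer_inv :: "nat \<Rightarrow> nat set set \<Rightarrow> int \<Rightarrow> (nat \<Rightarrow> rat) \<Rightarrow> nat \<Rightarrow> state \<Rightarrow> bool" where
  "outer_inv n I D0 q k s \<longleftrightarrow>
     s ''F'' 0 = fact n \<and> feasible n I (\<lambda>v. s ''X'' (int v)) \<and> 0 < s ''D'' 0 \<and>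
     s ''D'' 0 = D0 * fact n ^ k \<and> s ''X'' 0 \<le> s ''D'' 0 \<and> s ''k'' 0 = int k \<and> s ''ko'' 0 = int (k * n) \<and>
     (\<forall>j<k. out_block n s j \<in> I \<and> 0 < out_weight s j) \<and>
     (\<forall>v\<le>n. (\<Sum>j<k. out_weight s j * of_int (ivec (out_block n s j) v)) +
        of_int (s ''X'' (int v)) / of_int (s ''D'' 0) = q v) \<and>
     chain n I (out_block n s) k (\<lambda>v. s ''X'' (int v))"

lemma chain_cong:
  "(\<And>j. j < k \<Longrightarrow> T' j = T j) \<Longrightarrow> chain n I T' k z = chain n I T k z"
  unfolding chain_def by (metis (no_types, lifting))

lemma outer_inv_step:
  assumes M: "matroid (ground n) I" and inv: "outer_inv n I D0 q k s"
    and res: "step_result n I (\<lambda>v. s ''X'' (int v)) (s ''D'' 0) k s T l s'" and F: "s' ''F'' = s ''F''"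
  shows "outer_inv n I D0 q (Suc k) s'"
proof -
  define z where "z = (\<lambda>v. s ''X'' (int v))"
  define D where "D = s ''D'' 0"
  have R: "0 < l" "supports n I T (\<lambda>v. fact n * z v)"
     "\<And>v. v \<le> n \<Longrightarrow> s' ''X'' (int v) = fact n * z v - l * ivec T v"
     "feasible n I (\<lambda>v. s' ''X'' (int v))"
     "\<exists>c. valid_constraint n I c \<and> dot n c (ivec T) \<noteq> 0 \<and> dot n c (\<lambda>v. s' ''X'' (int v)) = 0"
     "s' ''D'' 0 = D * fact n"
     "s' ''out_num'' = (s ''out_num'')(int k := l)" "s' ''out_den'' = (s ''out_den'')(int k := D * fact n)"
     "s' ''k'' 0 = int (k + 1)" "s' ''ko'' 0 = int ((k + 1) * n)"
     "\<And>x. x \<in> ground n \<Longrightarrow> s' ''out_set'' (int (k * n + x)) \<noteq> 0 \<longleftrightarrow> x \<in> T"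
     "\<And>x. x \<le> k * n \<Longrightarrow> s' ''out_set'' (int x) = s ''out_set'' (int x)"
    using res unfolding step_result_def z_def D_def by auto
  have V: "s ''F'' 0 = fact n" "0 < D" "D = D0 * fact n ^ k" "z 0 \<le> D"
    "\<And>j. j < k \<Longrightarrow> out_block n s j \<in> I \<and> 0 < out_weight s j"
    "\<And>v. v \<le> n \<Longrightarrow> (\<Sum>j<k. out_weight s j * of_int (ivec (out_block n s j) v)) + of_int (z v) / of_int D = q v"
    "chain n I (out_block n s) k z"
    using inv unfolding outer_inv_def z_def D_def by auto
  have TI: "T \<in> I" using R(2) by (simp add: supports_def)
  have Tg: "T \<subseteq> ground n" by (rule matroid_ground[OF M TI])
  have Bk: "out_block n s' k = T" using R(11) Tg by (auto simp: out_block_def)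
  \<comment> \<open>Earlier blocks end at cell \<open>k * n\<close> or before, and the new set is
    written beyond that cell.\<close>
  have Bj: "out_block n s' j = out_block n s j" if "j < k" for j
  proof -
    have "j * n + x \<le> k * n" if "x \<in> ground n" for x
    proof -
      have "(j + 1) * n \<le> k * n" using \<open>j < k\<close> by (intro mult_right_mono) auto
      then show ?thesis using that by (simp add: ground_def)
    qed
    then show ?thesis by (auto simp: out_block_def R(12) simp del: of_nat_add of_nat_mult)
  qed
  have Wk: "out_weight s' k = of_int l / of_int (D * fact n)" by (simp add: out_weight_def R(7,8))
  have Wj: "out_weight s' j = out_weight s j" if "j < k" for j using that by (simp add: out_weight_def R(7,8))
  have "chain n I (out_block n s') (Suc k) (\<lambda>v. s' ''X'' (int v))"
  proof (rule chain_extend[where z = z and a = "fact n" and l = l])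
    show "chain n I (out_block n s') k z" using V(7) chain_cong[of k "out_block n s'" "out_block n s"] Bj by simp
  qed (use R(2,3,5) Bk in auto)
  moreover have "(\<Sum>j<Suc k. out_weight s' j * of_int (ivec (out_block n s' j) v)) +
      of_int (s' ''X'' (int v)) / of_int (s' ''D'' 0) = q v" if v: "v \<le> n" for v
  proof -
    have "(\<Sum>j<k. out_weight s' j * of_int (ivec (out_block n s' j) v)) =
        (\<Sum>j<k. out_weight s j * of_int (ivec (out_block n s j) v))"
      by (rule sum.cong) (simp_all add: Wj Bj)
    moreover have "of_int l / of_int (D * fact n) * of_int (ivec T v) +
        of_int (fact n * z v - l * ivec T v) / of_int (D * fact n) = (of_int (z v) / of_int D :: rat)"
      using V(2) by (simp add: field_simps)
    ultimately show ?thesis using V(6)[OF v] unfolding R(3)[OF v] R(6) by (simp add: Wk Bk)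
  qed
  moreover have "s' ''X'' 0 \<le> s' ''D'' 0"
  proof -
    have "z 0 * fact n \<le> D * fact n" using V(4) by (intro mult_right_mono) auto
    moreover have "s' ''X'' 0 = z 0 * fact n - l" using R(3)[of 0] by (simp add: ivec_def mult.commute)
    ultimately show ?thesis using R(1) R(6) by linarith
  qed
  moreover have "out_block n s' j \<in> I \<and> 0 < out_weight s' j" if "j < Suc k" for j
    using that V(5) Bj Wj Bk Wk TI R(1) V(2) by (cases "j = k") auto
  ultimately show ?thesis
    unfolding outer_inv_def using R V F by (simp add: mult.commute)
qed

definition outer :: com where
  "outer = While (Less (Const 0) (Get ''X'' (Const 0))) step"

lemma mods_step: "''n'' \<notin> mods step" "''F'' \<notin> mods step"
  by (simp_all add: step_def)

text \<open>The bound on the length of a chain is also the termination argument: after each step the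
  new chain still has length at most \<open>n + 1\<close>, so the variant \<open>n + 1 - k\<close>
  can always decrease while mass is left.\<close>

lemma wp_outer:
  assumes M: "matroid (ground n) I" and n: "s ''n'' 0 = int n" and inv: "outer_inv n I D0 q 0 s"
    and L: "D0 * fact n ^ (n + 2) < 2 ^ L"
  shows "wp n I outer s (\<lambda>t s'. t \<le> (n + 1) * (step_time n L + 20) + 20 \<and>
    (\<exists>k\<le>n + 1. outer_inv n I D0 q k s' \<and> s' ''X'' 0 = 0))"
proof -
  define inv' where "inv' m s1 \<longleftrightarrow> (\<exists>k. k + m = n + 1 \<and> outer_inv n I D0 q k s1)" for m :: nat and s1
  let ?b = "Less (Const 0) (Get ''X'' (Const 0))"
  have "wp n I (While ?b step) s (\<lambda>t s'. t \<le> (n + 1) * (step_time n L + 5 + 1) + 5 + 1 \<and>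
    (\<exists>k'\<le>n + 1. inv' k' s') \<and> \<not> bval ?b s' \<and> frame (mods step) s s')"
  proof (rule wp_While)
    show "inv' (n + 1) s" using inv by (simp add: inv'_def)
    fix m s1 assume "inv' m s1" and b: "bval ?b s1" and fr: "frame (mods step) s s1"
    then obtain k where k: "k + m = n + 1" "outer_inv n I D0 q k s1" unfolding inv'_def by auto
    have n1: "s1 ''n'' 0 = int n" using frameD[OF fr mods_step(1)] n by simp
    have z0: "0 < s1 ''X'' (int 0)" using b by simp
    have o: "s1 ''F'' 0 = fact n" "feasible n I (\<lambda>v. s1 ''X'' (int v))" "0 < s1 ''D'' 0"
      "s1 ''D'' 0 = D0 * fact n ^ k" "s1 ''X'' (int 0) \<le> s1 ''D'' 0" "s1 ''k'' 0 = int k" "s1 ''ko'' 0 = int (k * n)"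
      using k(2) unfolding outer_inv_def by auto
    have "0 < D0" using o(3,4) by (simp add: zero_less_mult_iff)
    \<comment> \<open>The step with index \<open>k\<close> scales the denominator to
      \<open>D0 * fact n ^ (k + 1)\<close>, and \<open>k\<close> is at most \<open>n + 1\<close>;
      hence the exponent \<open>n + 2\<close>.\<close>
    then have "D0 * fact n ^ (k + 1) \<le> D0 * fact n ^ (n + 2)"
      using k(1) by (intro mult_left_mono power_increasing) auto
    then have DL: "s1 ''D'' 0 * fact n < 2 ^ L" using L unfolding o(4) by (simp add: mult.assoc mult.commute mult.left_commute)
    show "wp n I step s1 (\<lambda>t s'. t \<le> step_time n L \<and> (\<exists>k'<m. inv' k' s'))"
    proof (rule wp_frame[OF wp_step[OF M n1 o(1) refl o(2) z0 refl o(5) DL o(6,7)]], elim conjE exE)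
      fix t s2 T l assume t: "t \<le> step_time n L"
        and res: "step_result n I (\<lambda>v. s1 ''X'' (int v)) (s1 ''D'' 0) k s1 T l s2"
        and fr2: "frame (mods step) s1 s2"
      have o2: "outer_inv n I D0 q (Suc k) s2"
        by (rule outer_inv_step[OF M k(2) res frameD[OF fr2 mods_step(2)]])
      then have "Suc k \<le> n + 1" using chain_length unfolding outer_inv_def by blast
      then have "inv' (m - 1) s2" "m - 1 < m" using o2 k(1) by (auto simp: inv'_def intro!: exI[of _ "Suc k"])
      then show "t \<le> step_time n L \<and> (\<exists>k'<m. inv' k' s2)" using t by blast
    qed
  qed simp
  then show ?thesis unfolding outer_def
  proof (rule wp_mono, elim conjE exE)
    fix t s' m assume t: "t \<le> (n + 1) * (step_time n L + 5 + 1) + 5 + 1" and m: "inv' m s'" and b: "\<not> bval ?b s'"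
    have "(n + 1) * (step_time n L + 5 + 1) \<le> (n + 1) * (step_time n L + 20)" by (rule mult_left_mono) simp_all
    then have "t \<le> (n + 1) * (step_time n L + 20) + 20" using t by linarith
    moreover obtain k where k: "k + m = n + 1" "outer_inv n I D0 q k s'" using m by (auto simp: inv'_def)
    moreover have "s' ''X'' 0 = 0" using b feasible_nonneg[of n I "\<lambda>v. s' ''X'' (int v)" 0] k(2)
      by (auto simp: outer_inv_def)
    ultimately show "t \<le> (n + 1) * (step_time n L + 20) + 20 \<and>
      (\<exists>k\<le>n + 1. outer_inv n I D0 q k s' \<and> s' ''X'' 0 = 0)" by (auto intro!: exI[of _ k])
  qed
qed

section \<open>Initialisation and correctness of the whole program\<close>

text \<open>Entry \<open>v\<close> becomes the numerator of \<open>q v\<close> over the product of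
  all denominators. Index 0 matches no \<open>j\<close>, so entry 0 collects that common
  denominator, which is the initial mass.\<close>

definition numerators :: com where
  "numerators = For ''w'' 0 (Set ''X'' (Val ''w'') (Const 1)) ;;
     For ''j'' 1 (For ''w'' 0 (Cond (Eq (Val ''w'') (Val ''j''))
       (Set ''X'' (Val ''w'') (Times (Get ''X'' (Val ''w'')) (Get ''num'' (Val ''j''))))
       (Set ''X'' (Val ''w'') (Times (Get ''X'' (Val ''w'')) (Get ''den'' (Val ''j''))))))"

definition factorial :: com where
  "factorial = assign ''F'' (Const 1) ;; For ''j'' 1 (assign ''F'' (Times (Val ''F'') (Val ''j'')))"

definition init :: com where
  "init = numerators ;; factorial ;;
     (assign ''D'' (Get ''X'' (Const 0)) ;; assign ''k'' (Const 0) ;; assign ''ko'' (Const 0))"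

definition partial_prod :: "(int \<Rightarrow> int) \<Rightarrow> (int \<Rightarrow> int) \<Rightarrow> nat \<Rightarrow> nat \<Rightarrow> int" where
  "partial_prod a b i v = (\<Prod>j\<in>{1..<i}. if v = j then a (int j) else b (int j))"

lemma partial_prod_Suc:
  "1 \<le> i \<Longrightarrow> partial_prod a b (Suc i) v = partial_prod a b i v * (if v = i then a (int i) else b (int i))"
  unfolding partial_prod_def by (simp add: prod.atLeastLessThan_Suc)

lemma abs_less_bit_length: "\<bar>x\<bar> < 2 ^ bit_length x"
proof -
  have "nat \<bar>x\<bar> < 2 ^ bit_length x" using floorlog_leD[of 2 "nat \<bar>x\<bar>"] by (simp add: bit_length_def)
  then show ?thesis by (simp add: nat_less_iff)
qed

lemma wp_numerators:
  assumes n: "s ''n'' 0 = int n" and a: "a = s ''num''" and b: "b = s ''den''"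
    and E: "\<And>i v. i \<le> n + 1 \<Longrightarrow> bit_length (partial_prod a b i v) \<le> E"
      "\<And>i. 1 \<le> i \<Longrightarrow> i \<le> n \<Longrightarrow> bit_length (a (int i)) \<le> E \<and> bit_length (b (int i)) \<le> E"
  shows "wp n I numerators s (\<lambda>t s'. t \<le> (n + 1)\<^sup>2 * (4 * E + 300) \<and>
    (\<forall>v\<le>n. s' ''X'' (int v) = partial_prod a b (n + 1) v))"
proof -
  let ?d = "Set ''X'' (Val ''w'') (Const 1)"
  let ?c = "Cond (Eq (Val ''w'') (Val ''j''))
       (Set ''X'' (Val ''w'') (Times (Get ''X'' (Val ''w'')) (Get ''num'' (Val ''j''))))
       (Set ''X'' (Val ''w'') (Times (Get ''X'' (Val ''w'')) (Get ''den'' (Val ''j''))))"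
  let ?T = "(n + 1) * ((2 * E + 40) + 20) + 20"
  define inv0 where "inv0 j s1 \<longleftrightarrow> (\<forall>x<j. s1 ''X'' (int x) = 1)" for j :: nat and s1 :: state
  define inv where "inv j s1 \<longleftrightarrow> (\<forall>v\<le>n. s1 ''X'' (int v) = partial_prod a b j v)" for j :: nat and s1 :: state
  define inv2 where "inv2 i j s1 \<longleftrightarrow>
      (\<forall>v\<le>n. s1 ''X'' (int v) = partial_prod a b (if v < j then Suc i else i) v)" for i j :: nat and s1 :: state
  have first: "wp n I (For ''w'' 0 ?d) s
    (\<lambda>t s'. t \<le> (n + 1) * (10 + 20) + 20 \<and> inv0 (n + 1) s' \<and> frame (insert ''w'' (mods ?d)) s s')"
  proof (rule wp_For[where inv = inv0])
    fix j s1 assume "s1 ''w'' 0 = int j" "inv0 j s1"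
    then show "wp n I ?d s1 (\<lambda>t s'. t \<le> 10 \<and> inv0 (j + 1) (update ''w'' 0 (int (j + 1)) s'))"
      by (auto simp: wp_Set inv0_def update_apply less_Suc_eq)
  qed (use n in \<open>auto simp: inv0_def\<close>)
  show ?thesis unfolding numerators_def wp_Seq
  proof (rule wp_mono[OF first], elim conjE)
    fix t s1 assume t: "t \<le> (n + 1) * (10 + 20) + 20" and i0: "inv0 (n + 1) s1"
      and fr: "frame (insert ''w'' (mods ?d)) s s1"
    have eq: "s1 z = s z" if "z \<noteq> ''w''" "z \<noteq> ''X''" for z using frameD[OF fr, of z] that by simp
    have "wp n I (For ''j'' 1 (For ''w'' 0 ?c)) s1
      (\<lambda>t s'. t \<le> (n + 1) * (?T + 20) + 20 \<and> inv (n + 1) s' \<and> frame (insert ''j'' (mods (For ''w'' 0 ?c))) s1 s')"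
    proof (rule wp_For[where inv = inv])
      show "s1 ''n'' 0 = int n" using n by (simp add: eq)
      show "inv 1 (update ''j'' 0 (int 1) s1)"
        using i0 by (auto simp: inv_def inv0_def update_apply partial_prod_def)
      fix i s2 assume i: "1 \<le> i" "i \<le> n" "s2 ''j'' 0 = int i"
        and fr2: "frame (insert ''j'' (mods (For ''w'' 0 ?c))) s1 s2" and i2: "inv i s2"
      have eq2: "s2 z = s z" if "z \<in> {''n'', ''num'', ''den''}" for z
        using frameD[OF fr2, of z] eq[of z] that by auto
      have "wp n I (For ''w'' 0 ?c) s2
        (\<lambda>t s'. t \<le> ?T \<and> inv2 i (n + 1) s' \<and> frame (insert ''w'' (mods ?c)) s2 s')"
      proof (rule wp_For[where inv = "inv2 i"])
        show "s2 ''n'' 0 = int n" using n by (simp add: eq2)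
        show "inv2 i 0 (update ''w'' 0 (int 0) s2)" using i2 by (simp add: inv2_def inv_def update_apply)
        fix j s3 assume j: "j \<le> n" "s3 ''w'' 0 = int j"
          and fr3: "frame (insert ''w'' (mods ?c)) s2 s3" and i3: "inv2 i j s3"
        have eq3: "s3 ''num'' = a" "s3 ''den'' = b" "s3 ''j'' 0 = int i"
          using frameD[OF fr3, of "''num''"] frameD[OF fr3, of "''den''"] frameD[OF fr3, of "''j''"] a b i
          by (simp_all add: eq2)
        have Xj: "s3 ''X'' (int j) = partial_prod a b i j" using i3 j by (simp add: inv2_def)
        have bl: "bit_length (partial_prod a b i j) \<le> E" using E(1)[of i j] i by simp
        have "inv2 i (j + 1) (update ''w'' 0 (int (j + 1)) (update ''X'' (int j)
          (partial_prod a b i j * (if j = i then a (int i) else b (int i))) s3))"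
          using i3 j i partial_prod_Suc[OF i(1), of a b j] unfolding inv2_def
          by (auto simp: update_apply less_Suc_eq)
        then show "wp n I ?c s3 (\<lambda>t s'. t \<le> 2 * E + 40 \<and> inv2 i (j + 1) (update ''w'' 0 (int (j + 1)) s'))"
        proof (cases "j = i")
          case True
          have Xi: "s3 ''X'' (int i) = partial_prod a b i i" using Xj True by simp
          show ?thesis if "inv2 i (j + 1) (update ''w'' 0 (int (j + 1)) (update ''X'' (int j)
            (partial_prod a b i j * (if j = i then a (int i) else b (int i))) s3))"
            using that j bl E(2)[OF i(1,2)] True by (simp add: wp_Cond wp_Set eq3 Xi)
        next
          case False
          show ?thesis if "inv2 i (j + 1) (update ''w'' 0 (int (j + 1)) (update ''X'' (int j)
            (partial_prod a b i j * (if j = i then a (int i) else b (int i))) s3))"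
            using that j bl E(2)[OF i(1,2)] False by (simp add: wp_Cond wp_Set eq3 Xj)
        qed
      qed simp_all
      then show "wp n I (For ''w'' 0 ?c) s2 (\<lambda>t s'. t \<le> ?T \<and> inv (i + 1) (update ''j'' 0 (int (i + 1)) s'))"
        by (rule wp_mono) (auto simp: inv2_def inv_def update_apply)
    qed simp_all
    then show "wp n I (For ''j'' 1 (For ''w'' 0 ?c)) s1 (\<lambda>t2 s'. t + t2 \<le> (n + 1)\<^sup>2 * (4 * E + 300) \<and>
      (\<forall>v\<le>n. s' ''X'' (int v) = partial_prod a b (n + 1) v))"
    proof (rule wp_mono, elim conjE)
      fix t2 s' assume t2: "t2 \<le> (n + 1) * (?T + 20) + 20" and i: "inv (n + 1) s'"
      have "t + t2 \<le> ((n + 1) * (10 + 20) + 20) + ((n + 1) * (?T + 20) + 20)"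
        by (rule add_mono[OF t t2])
      also have "\<dots> = (n + 1)\<^sup>2 * (2 * E + 60) + (n + 1) * 70 + 40"
        by (simp add: power2_eq_square algebra_simps)
      also have "\<dots> \<le> (n + 1)\<^sup>2 * (2 * E + 60) + (n + 1)\<^sup>2 * 70 + (n + 1)\<^sup>2 * 40"
        using square_bounds[of n] by (intro add_mono mult_right_mono) simp_all
      also have "\<dots> \<le> (n + 1)\<^sup>2 * (4 * E + 300)" by (simp add: add_mult_distrib2[symmetric])
      finally show "t + t2 \<le> (n + 1)\<^sup>2 * (4 * E + 300) \<and>
        (\<forall>v\<le>n. s' ''X'' (int v) = partial_prod a b (n + 1) v)" using i by (simp add: inv_def)
    qed
  qed
qed

text \<open>Crude but sufficient: each factor \<open>fact n\<close> costs at most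
  \<open>n * n\<close> bits.\<close>

lemma fact_le_two_power: "(fact n :: int) \<le> 2 ^ (n * n)"
proof -
  have "(fact n :: int) \<le> of_nat (n ^ n)" using fact_le_power[of n, where 'a = int] by simp
  also have "\<dots> \<le> of_nat ((2 ^ n) ^ n)" by (intro of_nat_mono power_mono) (simp_all add: less_imp_le)
  finally show ?thesis by (simp add: power_mult)
qed

lemma wp_factorial:
  assumes n: "s ''n'' 0 = int n"
  shows "wp n I factorial s (\<lambda>t s'. t \<le> (n + 1) * (4 * (n * n) + 200) \<and> s' ''F'' 0 = fact n)"
proof -
  let ?c = "assign ''F'' (Times (Val ''F'') (Val ''j''))"
  let ?s0 = "update ''F'' 0 1 s"
  define inv where "inv j s1 \<longleftrightarrow> s1 ''F'' 0 = fact (j - 1)" for j :: nat and s1 :: state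
  have bl: "bit_length x \<le> n * n + 1" if "0 \<le> x" "x \<le> fact n" for x
  proof (rule bit_length_le)
    have "x \<le> 2 ^ (n * n)" using that fact_le_two_power[of n] by simp
    also have "\<dots> < 2 ^ (n * n + 1)" by simp
    finally show "\<bar>x\<bar> < 2 ^ (n * n + 1)" using that by simp
  qed
  have "wp n I (For ''j'' 1 ?c) ?s0
    (\<lambda>t s'. t \<le> (n + 1) * ((2 * (n * n) + 30) + 20) + 20 \<and> inv (n + 1) s' \<and> frame (insert ''j'' (mods ?c)) ?s0 s')"
  proof (rule wp_For[where inv = inv])
    fix j s1 assume j: "1 \<le> j" "j \<le> n" "s1 ''j'' 0 = int j" and inv: "inv j s1"
    obtain j' where j': "j = Suc j'" using j(1) by (cases j) auto
    have f: "(fact j :: int) = int j * fact j'" unfolding j' by simp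
    have f0: "int j \<le> fact j" using fact_ge_self[of j] by (metis of_nat_fact of_nat_mono)
    have f1: "(fact j :: int) \<le> fact n" by (rule fact_mono) (rule j(2))
    have f2: "(fact j' :: int) \<le> fact n" by (rule fact_mono) (use j(2) j' in simp)
    have "bit_length (int j) \<le> n * n + 1" by (rule bl) (use f0 f1 in linarith)+
    moreover have "bit_length (fact j') \<le> n * n + 1" by (rule bl) (simp, rule f2)
    moreover have "inv (j + 1) (update ''j'' 0 (int (j + 1)) (update ''F'' 0 (fact j' * int j) s1))"
      using f by (simp add: inv_def update_apply)
    ultimately show "wp n I ?c s1 (\<lambda>t s'. t \<le> 2 * (n * n) + 30 \<and> inv (j + 1) (update ''j'' 0 (int (j + 1)) s'))"
      using j inv unfolding inv_def j' by (simp add: wp_Set)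
  qed (use n in \<open>auto simp: inv_def update_apply\<close>)
  then show ?thesis unfolding factorial_def wp_Seq wp_Set aval.simps acost.simps
    by (rule wp_mono) (auto simp: inv_def algebra_simps)
qed

definition init_time :: "nat \<Rightarrow> nat \<Rightarrow> nat" where
  "init_time n E = (n + 1)\<^sup>2 * (4 * E + 300) + ((n + 1) * (4 * (n * n) + 200) + 30)"

lemma mods_init_blocks [simp]: "mods numerators = {''w'', ''X'', ''j''}" "mods factorial = {''F'', ''j''}"
  by (auto simp: numerators_def factorial_def)

lemma mods_init: "''n'' \<notin> mods init"
  by (simp add: init_def)

lemma wp_init:
  assumes n: "s ''n'' 0 = int n" and a: "a = s ''num''" and b: "b = s ''den''"
    and E: "\<And>i v. i \<le> n + 1 \<Longrightarrow> bit_length (partial_prod a b i v) \<le> E"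
      "\<And>i. 1 \<le> i \<Longrightarrow> i \<le> n \<Longrightarrow> bit_length (a (int i)) \<le> E \<and> bit_length (b (int i)) \<le> E"
  shows "wp n I init s (\<lambda>t s'. t \<le> init_time n E \<and>
    ((\<forall>v\<le>n. s' ''X'' (int v) = partial_prod a b (n + 1) v) \<and> s' ''F'' 0 = fact n \<and>
     s' ''D'' 0 = partial_prod a b (n + 1) 0 \<and> s' ''k'' 0 = 0 \<and> s' ''ko'' 0 = 0))"
  unfolding init_def init_time_def
proof (rule wp_SeqI[where P = "\<lambda>s'. \<forall>v\<le>n. s' ''X'' (int v) = partial_prod a b (n + 1) v"])
  show "wp n I numerators s (\<lambda>t s'. t \<le> (n + 1)\<^sup>2 * (4 * E + 300) \<and>
    (\<forall>v\<le>n. s' ''X'' (int v) = partial_prod a b (n + 1) v))"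
    by (rule wp_numerators[OF n a b]) (fact E)+
  fix s1 assume X: "\<forall>v\<le>n. s1 ''X'' (int v) = partial_prod a b (n + 1) v" and fr: "frame (mods numerators) s s1"
  have n1: "s1 ''n'' 0 = int n" using frameD[OF fr, of "''n''"] n by simp
  show "wp n I (factorial ;; (assign ''D'' (Get ''X'' (Const 0)) ;; assign ''k'' (Const 0) ;; assign ''ko'' (Const 0))) s1
    (\<lambda>t s'. t \<le> (n + 1) * (4 * (n * n) + 200) + 30 \<and>
    ((\<forall>v\<le>n. s' ''X'' (int v) = partial_prod a b (n + 1) v) \<and> s' ''F'' 0 = fact n \<and>
     s' ''D'' 0 = partial_prod a b (n + 1) 0 \<and> s' ''k'' 0 = 0 \<and> s' ''ko'' 0 = 0))"
  proof (rule wp_SeqI[OF wp_factorial[where s = s1, OF n1]])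
    fix s2 assume F: "s2 ''F'' 0 = fact n" and fr2: "frame (mods factorial) s1 s2"
    have X2: "s2 ''X'' = s1 ''X''" using frameD[OF fr2, of "''X''"] by simp
    have "s1 ''X'' 0 = partial_prod a b (n + 1) 0" using X[rule_format, of 0] by simp
    then show "wp n I (assign ''D'' (Get ''X'' (Const 0)) ;; assign ''k'' (Const 0) ;; assign ''ko'' (Const 0)) s2
      (\<lambda>t s'. t \<le> 30 \<and> ((\<forall>v\<le>n. s' ''X'' (int v) = partial_prod a b (n + 1) v) \<and> s' ''F'' 0 = fact n \<and>
     s' ''D'' 0 = partial_prod a b (n + 1) 0 \<and> s' ''k'' 0 = 0 \<and> s' ''ko'' 0 = 0))"
      using X F by (simp add: wp_simps update_apply X2)
  qed
qed

section \<open>From a rational point of the polytope to a feasible integer vector\<close>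

lemma polytope_outside:
  assumes M: "matroid V I" and x: "x \<in> matroid_polytope I" and v: "v \<notin> V"
  shows "x v = 0"
proof -
  obtain u where u: "x = mix I u" using x unfolding matroid_polytope_eq_mix[OF matroid_finite_sets[OF M]] by blast
  have "u S * indicator S v = 0" if "S \<in> I" for S
    using matroid_ground[OF M that] v by (auto simp: indicator_def)
  then show ?thesis unfolding u mix_def by (intro sum.neutral) blast
qed

text \<open>A valid constraint is nonnegative at the vertices, hence on their convex hull; the
  constant \<open>c 0\<close> enters each vertex because the weights add up to 1.\<close>

lemma polytope_constraint:
  assumes M: "matroid (ground n) I" and x: "x \<in> matroid_polytope I" and c: "valid_constraint n I c"
  shows "0 \<le> of_int (c 0) + (\<Sum>v\<in>ground n. of_int (c v) * x v)"
proof -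
  obtain u where u: "u \<in> weights I" "x = mix I u"
    using x unfolding matroid_polytope_eq_mix[OF matroid_finite_sets[OF M]] by blast
  have d: "real_of_int (dot n c (ivec S)) = of_int (c 0) + (\<Sum>v\<in>ground n. of_int (c v) * indicator S v)" for S
  proof -
    have "real_of_int (ivec S v) = indicator S v" if "v \<in> ground n" for v
      using that by (auto simp: ivec_def indicator_def ground_def)
    then show ?thesis unfolding dot_ground by (simp add: ivec_def)
  qed
  have "(\<Sum>v\<in>ground n. of_int (c v) * x v) = (\<Sum>v\<in>ground n. \<Sum>S\<in>I. u S * (of_int (c v) * indicator S v))"
    unfolding u(2) mix_def sum_distrib_left by (simp add: mult.left_commute)
  also have "\<dots> = (\<Sum>S\<in>I. \<Sum>v\<in>ground n. u S * (of_int (c v) * indicator S v))" by (rule sum.swap)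
  also have "\<dots> = (\<Sum>S\<in>I. u S * (\<Sum>v\<in>ground n. of_int (c v) * indicator S v))"
    by (simp only: sum_distrib_left)
  finally have "of_int (c 0) + (\<Sum>v\<in>ground n. of_int (c v) * x v) =
      (\<Sum>S\<in>I. u S * of_int (c 0)) + (\<Sum>S\<in>I. u S * (\<Sum>v\<in>ground n. of_int (c v) * indicator S v))"
    using weightsD(1)[OF u(1)] by (simp add: sum_distrib_right[symmetric])
  also have "\<dots> = (\<Sum>S\<in>I. u S * of_int (dot n c (ivec S)))"
    unfolding d by (simp add: distrib_left sum.distrib)
  also have "0 \<le> \<dots>"
    using weightsD(2)[OF u(1)] c by (intro sum_nonneg mult_nonneg_nonneg) (auto simp: valid_constraint_def)
  finally show ?thesis by simp
qed

lemma partial_prod_0: "partial_prod a b (n + 1) 0 = (\<Prod>j\<in>ground n. b (int j))"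
  unfolding partial_prod_def by (rule prod.cong) (auto simp: ground_def)

lemma partial_prod_ratio:
  assumes v: "v \<in> ground n" and b: "\<And>j. j \<in> ground n \<Longrightarrow> 0 < b (int j)"
  shows "(of_int (partial_prod a b (n + 1) v) / of_int (partial_prod a b (n + 1) 0) :: rat) =
    of_int (a (int v)) / of_int (b (int v))"
proof -
  define R where "R = (\<Prod>j\<in>ground n - {v}. b (int j))"
  have "partial_prod a b (n + 1) v = (\<Prod>j\<in>ground n. if v = j then a (int j) else b (int j))"
    unfolding partial_prod_def by (rule prod.cong) (auto simp: ground_def)
  also have "\<dots> = a (int v) * (\<Prod>j\<in>ground n - {v}. if v = j then a (int j) else b (int j))"
    using v by (simp add: prod.remove)
  also have "(\<Prod>j\<in>ground n - {v}. if v = j then a (int j) else b (int j)) = R"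
    unfolding R_def by (rule prod.cong) auto
  finally have 1: "partial_prod a b (n + 1) v = a (int v) * R" .
  have 2: "partial_prod a b (n + 1) 0 = b (int v) * R"
    unfolding partial_prod_0 R_def using v by (simp add: prod.remove)
  have "0 < R" unfolding R_def using b by (intro prod_pos) auto
  then show ?thesis unfolding 1 2 using b[OF v] by simp
qed

text \<open>Under multiplication the exponents of the bounds add up, so no intermediate product
  outgrows the encoding of the whole vector.\<close>

lemma partial_prod_bound:
  assumes g: "\<And>j. j \<in> ground n \<Longrightarrow> bit_length (a (int j)) \<le> g j \<and> bit_length (b (int j)) \<le> g j" and i: "i \<le> n + 1"
  shows "\<bar>partial_prod a b i v\<bar> \<le> 2 ^ (\<Sum>j\<in>ground n. g j)"
proof -
  have "\<bar>x\<bar> \<le> 2 ^ e" if "bit_length x \<le> e" for x :: int and e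
  proof -
    have "\<bar>x\<bar> \<le> 2 ^ bit_length x" using abs_less_bit_length[of x] by simp
    also have "(2::int) ^ bit_length x \<le> 2 ^ e" using that by (intro power_increasing) auto
    finally show ?thesis .
  qed
  then have fg: "\<bar>if v = j then a (int j) else b (int j)\<bar> \<le> 2 ^ g j" if "j \<in> ground n" for j using g[OF that] by simp
  have sub: "{1..<i} \<subseteq> ground n" using i by (auto simp: ground_def)
  have "\<bar>partial_prod a b i v\<bar> = (\<Prod>j\<in>{1..<i}. \<bar>if v = j then a (int j) else b (int j)\<bar>)"
    unfolding partial_prod_def by (rule abs_prod)
  also have "\<dots> \<le> (\<Prod>j\<in>{1..<i}. 2 ^ g j)"
    by (rule prod_mono) (rule conjI[OF abs_ge_zero fg], use sub in blast)
  also have "\<dots> = 2 ^ (\<Sum>j\<in>{1..<i}. g j)" by (rule power_sum[symmetric])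
  also have "\<dots> \<le> (2::int) ^ (\<Sum>j\<in>ground n. g j)"
    by (intro power_increasing sum_mono2) (use sub in auto)
  finally show ?thesis .
qed

lemma feasible_input:
  assumes M: "matroid (ground n) I" and q: "(\<lambda>v. of_rat (q v)) \<in> matroid_polytope I" and D: "0 < D"
    and X: "X 0 = D" "\<And>v. v \<in> ground n \<Longrightarrow> (of_int (X v) / of_int D :: rat) = q v"
  shows "feasible n I X"
  unfolding feasible_def
proof (intro allI impI)
  fix c assume c: "valid_constraint n I c"
  have "of_int (X v) = (of_rat (q v) * of_int D :: real)" if "v \<in> ground n" for v
    using arg_cong[OF X(2)[OF that], of "of_rat :: rat \<Rightarrow> real"] D by (simp add: of_rat_divide field_simps)
  then have "(\<Sum>v\<in>ground n. of_int (c v) * of_int (X v)) = (\<Sum>v\<in>ground n. of_int (c v) * of_rat (q v) :: real) * of_int D"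
    unfolding sum_distrib_right by (intro sum.cong) simp_all
  then have "real_of_int (dot n c X) = (of_int (c 0) + (\<Sum>v\<in>ground n. of_int (c v) * of_rat (q v))) * of_int D"
    unfolding dot_ground using X(1) by (simp add: algebra_simps)
  also have "0 \<le> \<dots>" using polytope_constraint[OF M q c] D by simp
  finally show "0 \<le> dot n c X" by simp
qed

text \<open>Mass 0 makes the remainder vanish, since every entry lies between 0 and the mass.
  Coordinate 0 then says that the weights add up to 1, and the other coordinates that the marginals
  are \<open>q\<close>.\<close>

lemma output_correct:
  assumes M: "matroid (ground n) I" and q: "(\<lambda>v. of_rat (q v)) \<in> matroid_polytope I"
    and inv: "outer_inv n I D0 (\<lambda>v. if v = 0 then 1 else q v) k s" and k: "k \<le> n + 1" and X0: "s ''X'' 0 = 0"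
  shows "\<exists>\<pi>. represents (output_list n s) \<pi> \<and> \<pi> \<in> distributions I \<and>
    marginal I \<pi> = (\<lambda>v. of_rat (q v)) \<and> card (set_pmf \<pi>) \<le> n + 1"
proof -
  define T where "T = out_block n s"
  define w where "w = out_weight s"
  have feas: "feasible n I (\<lambda>v. s ''X'' (int v))" and kk: "s ''k'' 0 = int k"
    and Tw: "\<And>j. j < k \<Longrightarrow> T j \<in> I \<and> 0 < w j"
    and sums: "\<And>v. v \<le> n \<Longrightarrow> (\<Sum>j<k. w j * of_int (ivec (T j) v)) + of_int (s ''X'' (int v)) / of_int (s ''D'' 0) =
       (if v = 0 then 1 else q v)"
    and ch: "chain n I T k (\<lambda>v. s ''X'' (int v))"
    using inv unfolding outer_inv_def T_def w_def by auto
  have "s ''X'' (int v) = 0" if "v \<le> n" for v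
    using feasible_nonneg[OF feas that] feasible_le_mass[OF feas that] X0 by simp
  then have sums: "(\<Sum>j<k. w j * of_int (ivec (T j) v)) = (if v = 0 then 1 else q v)" if "v \<le> n" for v
    using sums[OF that] that by simp
  have inj: "inj_on T {..<k}"
    by (rule linorder_inj_onI') (use chain_distinct[OF ch] in auto)
  define u :: "nat set \<Rightarrow> real" where "u S = of_rat (w (the_inv_into {..<k} T S))" for S
  have uT: "u (T j) = of_rat (w j)" if "j < k" for j
    unfolding u_def using the_inv_into_f_f[OF inj] that by simp
  have "sum u (T ` {..<k}) = of_rat (\<Sum>j<k. w j)"
    unfolding sum.reindex[OF inj] by (simp add: uT of_rat_sum)
  also have "(\<Sum>j<k. w j) = 1" using sums[of 0] by (simp add: ivec_def)
  finally have u1: "sum u (T ` {..<k}) = 1" by simp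
  have u0: "0 \<le> u S" if "S \<in> T ` {..<k}" for S using that Tw uT by (auto simp: less_imp_le)
  obtain \<pi> where \<pi>: "\<And>S. pmf \<pi> S = (if S \<in> T ` {..<k} then u S else 0)"
    using pmf_of_weights[OF _ u0 u1] by blast
  have pT: "pmf \<pi> (T j) = of_rat (w j)" if "j < k" for j using that uT by (simp add: \<pi>)
  have set: "set_pmf \<pi> = T ` {..<k}"
  proof -
    have "pmf \<pi> S \<noteq> 0 \<longleftrightarrow> S \<in> T ` {..<k}" for S
    proof
      assume "S \<in> T ` {..<k}"
      then obtain j where j: "j < k" "S = T j" by auto
      then show "pmf \<pi> S \<noteq> 0" using pT[OF j(1)] Tw[OF j(1)] by simp
    qed (auto simp: \<pi> split: if_splits)
    then show ?thesis unfolding set_pmf_eq by blast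
  qed
  have out: "output_list n s = map (\<lambda>i. (T i, w i)) [0..<k]"
    unfolding output_list_def T_def w_def out_block_def out_weight_def kk by simp
  have rep: "represents (output_list n s) \<pi>"
    unfolding represents_def out
  proof (intro conjI)
    show "distinct (map fst (map (\<lambda>i. (T i, w i)) [0..<k]))"
      using inj by (simp add: distinct_map o_def lessThan_atLeast0)
    show "fst ` set (map (\<lambda>i. (T i, w i)) [0..<k]) = set_pmf \<pi>"
      unfolding set by (simp add: image_image lessThan_atLeast0)
    show "\<forall>(S, p)\<in>set (map (\<lambda>i. (T i, w i)) [0..<k]). pmf \<pi> S = of_rat p" using pT by auto
  qed
  have dist: "\<pi> \<in> distributions I" using Tw by (auto simp: distributions_def set)
  have "marginal I \<pi> v = of_rat (q v)" for v
  proof -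
    have I: "finite I" by (rule matroid_finite_sets[OF M])
    have "marginal I \<pi> v = (\<Sum>S\<in>I. if v \<in> S then pmf \<pi> S else 0)"
      unfolding marginal_def by (rule sum.inter_filter[OF I])
    also have "\<dots> = (\<Sum>S\<in>T ` {..<k}. if v \<in> S then pmf \<pi> S else 0)"
      by (rule sum.mono_neutral_right[OF I]) (use Tw in \<open>auto simp: \<pi>\<close>)
    also have "\<dots> = (\<Sum>j<k. if v \<in> T j then of_rat (w j) else 0)"
      unfolding sum.reindex[OF inj] by (rule sum.cong) (auto simp: pT)
    finally have m: "marginal I \<pi> v = (\<Sum>j<k. if v \<in> T j then of_rat (w j) else 0)" .
    show ?thesis
    proof (cases "v \<in> ground n")
      case True
      then have v: "v \<le> n" "v \<noteq> 0" by (auto simp: ground_def)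
      have "(\<Sum>j<k. if v \<in> T j then of_rat (w j) else 0) = of_rat (\<Sum>j<k. w j * of_int (ivec (T j) v))"
        unfolding of_rat_sum by (rule sum.cong) (use v in \<open>auto simp: ivec_def\<close>)
      then show ?thesis using m sums[OF v(1)] v(2) by simp
    next
      case False
      \<comment> \<open>Off the ground set \<open>q\<close> is 0 as a point of the polytope. This
        includes index 0, where the homogenised vector has the value 1 instead.\<close>
      have "v \<notin> T j" if "j < k" for j using matroid_ground[OF M] Tw[OF that] False by blast
      then have "marginal I \<pi> v = 0" unfolding m by (intro sum.neutral) auto
      then show ?thesis using polytope_outside[OF M q False] by simp
    qed
  qed
  moreover have "card (set_pmf \<pi>) \<le> n + 1"
    unfolding set using card_image_le[of "{..<k}" T] k by simp
  ultimately show ?thesis using rep dist by blast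
qed

section \<open>The whole program and its running time\<close>

definition program :: com where
  "program = init ;; outer"

definition program_time :: "nat \<Rightarrow> nat \<Rightarrow> nat" where
  "program_time n e = init_time n (e + 1) + ((n + 1) * (step_time n (e + (n + 2) * (n * n) + 1) + 20) + 20)"

lemma wp_program:
  assumes M: "matroid (ground n) I" and q: "(\<lambda>v. of_rat (q v)) \<in> matroid_polytope I"
  shows "wp n I program (input_state n q) (\<lambda>t s. t \<le> program_time n (encoding_length n q) \<and>
    (\<exists>\<pi>. represents (output_list n s) \<pi> \<and> \<pi> \<in> distributions I \<and>
      marginal I \<pi> = (\<lambda>v. of_rat (q v)) \<and> card (set_pmf \<pi>) \<le> n + 1))"
proof -
  let ?s = "input_state n q"
  define a where "a = ?s ''num''"
  define b where "b = ?s ''den''"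
  define e where "e = encoding_length n q"
  have ab: "a (int j) = fst (quotient_of (q j))" "b (int j) = snd (quotient_of (q j))" if "j \<in> ground n" for j
    using that by (auto simp: a_def b_def input_state_def ground_def)
  have bpos: "0 < b (int j)" if "j \<in> ground n" for j
    unfolding ab(2)[OF that] by (rule quotient_of_denom_pos')
  have n: "?s ''n'' 0 = int n" by (simp add: input_state_def)
  define g where "g j = 1 + bit_length (fst (quotient_of (q j))) + bit_length (snd (quotient_of (q j)))" for j
  have ge: "(\<Sum>j\<in>ground n. g j) = e" by (simp add: e_def encoding_length_def g_def)
  have gab: "bit_length (a (int j)) \<le> g j \<and> bit_length (b (int j)) \<le> g j" if "j \<in> ground n" for j
    using ab[OF that] by (simp add: g_def)
  have pp: "\<bar>partial_prod a b i v\<bar> \<le> 2 ^ e" if "i \<le> n + 1" for i v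
    using partial_prod_bound[of n a g b i v, OF gab that] by (simp add: ge)
  have E1: "bit_length (partial_prod a b i v) \<le> e + 1" if "i \<le> n + 1" for i v
  proof (rule bit_length_le)
    have "(2::int) ^ e < 2 ^ (e + 1)" by simp
    then show "\<bar>partial_prod a b i v\<bar> < 2 ^ (e + 1)" using pp[OF that, of v] by linarith
  qed
  have E2: "bit_length (a (int i)) \<le> e + 1 \<and> bit_length (b (int i)) \<le> e + 1" if "1 \<le> i" "i \<le> n" for i
  proof -
    have i: "i \<in> ground n" using that by (simp add: ground_def)
    have "g i \<le> e" unfolding ge[symmetric] by (rule member_le_sum) (use i in auto)
    then show ?thesis using gab[OF i] by linarith
  qed
  define D0 where "D0 = partial_prod a b (n + 1) 0"
  have D0: "0 < D0" unfolding D0_def partial_prod_0 by (rule prod_pos) (rule bpos)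
  have ratio: "(of_int (partial_prod a b (n + 1) v) / of_int D0 :: rat) = q v" if "v \<in> ground n" for v
  proof -
    have "q v = of_int (a (int v)) / of_int (b (int v))"
      unfolding ab[OF that] by (rule quotient_of_div) simp
    then show ?thesis unfolding D0_def using partial_prod_ratio[OF that, of b a] bpos by simp
  qed
  \<comment> \<open>The bits of \<open>D0\<close>, those of \<open>n + 2\<close> factors
    \<open>fact n\<close>, and one more for a strict inequality.\<close>
  define L where "L = e + (n + 2) * (n * n) + 1"
  have L: "D0 * fact n ^ (n + 2) < 2 ^ L"
  proof -
    have "fact n ^ (n + 2) \<le> ((2::int) ^ (n * n)) ^ (n + 2)" by (rule power_mono[OF fact_le_two_power]) simp
    also have "\<dots> = 2 ^ ((n + 2) * (n * n))" by (simp only: power_mult[symmetric] mult.commute)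
    finally have "D0 * fact n ^ (n + 2) \<le> 2 ^ e * 2 ^ ((n + 2) * (n * n))"
      using pp[of "n + 1" 0] D0 unfolding D0_def by (intro mult_mono) auto
    also have "\<dots> = 2 ^ (e + (n + 2) * (n * n))" by (simp only: power_add)
    also have "\<dots> < (2::int) ^ L" unfolding L_def by simp
    finally show ?thesis .
  qed
  show ?thesis unfolding program_def program_time_def e_def[symmetric] L_def[symmetric]
  proof (rule wp_SeqI[OF wp_init[OF n a_def b_def E1 E2]], assumption, assumption, assumption, elim conjE)
    fix s1 assume X1: "\<forall>v\<le>n. s1 ''X'' (int v) = partial_prod a b (n + 1) v" and F1: "s1 ''F'' 0 = fact n"
      and D1: "s1 ''D'' 0 = partial_prod a b (n + 1) 0" and k1: "s1 ''k'' 0 = 0" "s1 ''ko'' 0 = 0"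
      and fr: "frame (mods init) ?s s1"
    have n1: "s1 ''n'' 0 = int n" using frameD[OF fr mods_init] n by simp
    have X10: "s1 ''X'' 0 = D0" using X1[rule_format, of 0] by (simp add: D0_def)
    have XD: "(of_int (s1 ''X'' (int v)) / of_int D0 :: rat) = q v" if "v \<in> ground n" for v
      using X1 ratio[OF that] that by (simp add: ground_def)
    have feas: "feasible n I (\<lambda>v. s1 ''X'' (int v))"
      by (rule feasible_input[OF M q D0]) (use X10 XD in simp_all)
    have "of_int (s1 ''X'' (int v)) / of_int D0 = (if v = 0 then 1 else q v)" if "v \<le> n" for v
      using XD[of v] X10 D0 that by (cases "v = 0") (auto simp: ground_def)
    then have inv: "outer_inv n I D0 (\<lambda>v. if v = 0 then 1 else q v) 0 s1"
      unfolding outer_inv_def chain_def using F1 feas D1[folded D0_def] D0 X10 k1 by simp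
    show "wp n I outer s1 (\<lambda>t s. t \<le> (n + 1) * (step_time n L + 20) + 20 \<and>
      (\<exists>\<pi>. represents (output_list n s) \<pi> \<and> \<pi> \<in> distributions I \<and>
      marginal I \<pi> = (\<lambda>v. of_rat (q v)) \<and> card (set_pmf \<pi>) \<le> n + 1))"
    proof (rule wp_mono[OF wp_outer[OF M n1 inv L]], elim conjE exE)
      fix t s k assume t: "t \<le> (n + 1) * (step_time n L + 20) + 20" and k: "k \<le> n + 1"
        and inv: "outer_inv n I D0 (\<lambda>v. if v = 0 then 1 else q v) k s" and X0: "s ''X'' 0 = 0"
      show "t \<le> (n + 1) * (step_time n L + 20) + 20 \<and>
        (\<exists>\<pi>. represents (output_list n s) \<pi> \<and> \<pi> \<in> distributions I \<and>
        marginal I \<pi> = (\<lambda>v. of_rat (q v)) \<and> card (set_pmf \<pi>) \<le> n + 1)"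
        using t output_correct[OF M q inv k X0] by blast
    qed
  qed
qed

text \<open>All time bounds arise from \<open>n\<close>, \<open>e\<close> and constants by sums and
  products, so closure under these two operations yields the polynomial without computing
  it.\<close>

definition poly_bounded :: "(nat \<Rightarrow> nat \<Rightarrow> nat) \<Rightarrow> bool" where
  "poly_bounded f \<longleftrightarrow> (\<exists>p. \<forall>n e. f n e \<le> poly p (n + e))"

lemma poly_bounded_const: "poly_bounded (\<lambda>n e. c)"
  unfolding poly_bounded_def by (rule exI[of _ "[:c:]"]) simp

lemma poly_bounded_fst: "poly_bounded (\<lambda>n e. n)"
  unfolding poly_bounded_def by (rule exI[of _ "[:0, 1:]"]) simp

lemma poly_bounded_snd: "poly_bounded (\<lambda>n e. e)"
  unfolding poly_bounded_def by (rule exI[of _ "[:0, 1:]"]) simp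

lemma poly_bounded_add:
  "poly_bounded f \<Longrightarrow> poly_bounded g \<Longrightarrow> poly_bounded (\<lambda>n e. f n e + g n e)"
  unfolding poly_bounded_def
proof (elim exE)
  fix p q assume "\<forall>n e. f n e \<le> poly p (n + e)" "\<forall>n e. g n e \<le> poly q (n + e)"
  then show "\<exists>p. \<forall>n e. f n e + g n e \<le> poly p (n + e)"
    by (intro exI[of _ "p + q"]) (simp add: add_mono)
qed

lemma poly_bounded_mult:
  "poly_bounded f \<Longrightarrow> poly_bounded g \<Longrightarrow> poly_bounded (\<lambda>n e. f n e * g n e)"
  unfolding poly_bounded_def
proof (elim exE)
  fix p q assume "\<forall>n e. f n e \<le> poly p (n + e)" "\<forall>n e. g n e \<le> poly q (n + e)"
  then show "\<exists>p. \<forall>n e. f n e * g n e \<le> poly p (n + e)"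
    by (intro exI[of _ "p * q"]) (simp add: mult_mono)
qed

lemma poly_bounded_program_time: "poly_bounded program_time"
proof -
  note rules = poly_bounded_const poly_bounded_fst poly_bounded_snd poly_bounded_add poly_bounded_mult
  have pot: "poly_bounded (\<lambda>n e. pot_bound n)" unfolding pot_bound_def by (intro rules)
  have phase: "poly_bounded (\<lambda>n e. phase_time n (m n e))" if "poly_bounded m" for m
    unfolding phase_time_def power2_eq_square by (intro rules pot that)
  have dec: "poly_bounded (\<lambda>n e. decompose_time n (J n e))" if "poly_bounded J" for J
    unfolding decompose_time_def by (intro rules phase pot that)
  have sea: "poly_bounded (\<lambda>n e. search_time n (J n e))" if "poly_bounded J" for J
    unfolding search_time_def probe_time_def by (intro rules dec that)
  have step: "poly_bounded (\<lambda>n e. step_time n (J n e))" if "poly_bounded J" for J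
    unfolding step_time_def by (intro rules dec sea that)
  have init: "poly_bounded (\<lambda>n e. init_time n (J n e))" if "poly_bounded J" for J
    unfolding init_time_def power2_eq_square by (intro rules that)
  show ?thesis unfolding program_time_def[abs_def] by (intro rules init step)
qed

theorem lemma5:
  shows
    "(\<forall>n E w I_l I_f.
        simple_graph (ground n) E \<and> matroid (ground n) I_l \<and> matroid (ground n) I_f \<longrightarrow>
        (\<exists>\<pi> q. surrogate_optimal n E w I_l I_f \<pi> \<and> marginal_optimal n E w I_l I_f q \<and>
               max_Ltilde n E w I_f (marginal I_l \<pi>) = max_Ltilde n E w I_f q)) \<and>
     (\<exists>(prog :: com) (p :: nat poly). \<forall>n E w I_l I_f (q :: nat \<Rightarrow> rat).
        simple_graph (ground n) E \<and> matroid (ground n) I_l \<and> matroid (ground n) I_f \<and>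
        marginal_optimal n E w I_l I_f (\<lambda>v. of_rat (q v)) \<longrightarrow>
        (\<exists>t s \<pi>.
           exec n I_l prog (input_state n q) t s \<and>
           t \<le> poly p (n + encoding_length n q) \<and>
           represents (output_list n s) \<pi> \<and>
           \<pi> \<in> distributions I_l \<and>
           marginal I_l \<pi> = (\<lambda>v. of_rat (q v)) \<and>
           card (set_pmf \<pi>) \<le> n + 1))"
proof (rule conjI)
  obtain p where p: "\<And>n e. program_time n e \<le> poly p (n + e)"
    using poly_bounded_program_time unfolding poly_bounded_def by blast
  have main: "\<exists>t s \<pi>. exec n I_l program (input_state n q) t s \<and> t \<le> poly p (n + encoding_length n q) \<and>
      represents (output_list n s) \<pi> \<and> \<pi> \<in> distributions I_l \<and>
      marginal I_l \<pi> = (\<lambda>v. of_rat (q v)) \<and> card (set_pmf \<pi>) \<le> n + 1"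
    if M: "matroid (ground n) I_l" and opt: "marginal_optimal n E w I_l I_f (\<lambda>v. of_rat (q v))"
    for n E w I_l I_f and q :: "nat \<Rightarrow> rat"
  proof -
    have "(\<lambda>v. of_rat (q v)) \<in> matroid_polytope I_l" using opt by (simp add: marginal_optimal_def is_arg_min_def)
    from wp_program[OF M this] obtain t s \<pi> where
      "exec n I_l program (input_state n q) t s" "t \<le> program_time n (encoding_length n q)"
      "represents (output_list n s) \<pi>" "\<pi> \<in> distributions I_l" "marginal I_l \<pi> = (\<lambda>v. of_rat (q v))"
      "card (set_pmf \<pi>) \<le> n + 1"
      unfolding wp_def by blast
    then show ?thesis using p[of n "encoding_length n q"] le_trans by blast
  qed
  show "\<exists>(prog :: com) (p :: nat poly). \<forall>n E w I_l I_f (q :: nat \<Rightarrow> rat).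
        simple_graph (ground n) E \<and> matroid (ground n) I_l \<and> matroid (ground n) I_f \<and>
        marginal_optimal n E w I_l I_f (\<lambda>v. of_rat (q v)) \<longrightarrow>
        (\<exists>t s \<pi>.
           exec n I_l prog (input_state n q) t s \<and>
           t \<le> poly p (n + encoding_length n q) \<and>
           represents (output_list n s) \<pi> \<and>
           \<pi> \<in> distributions I_l \<and>
           marginal I_l \<pi> = (\<lambda>v. of_rat (q v)) \<and>
           card (set_pmf \<pi>) \<le> n + 1)"
    by (rule exI[of _ program], rule exI[of _ p]) (intro allI impI, elim conjE, rule main)
qed (use equal_optimal_values in blast)

end
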